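(* Let $A$ be a unital C$^*$-algebra and let $\Phi : A \to A\otimes A$ be a $^*$-homomorphism. Assume that there are $n\geq 1$ and elements $u_{pq}\in A$ ($1\le p,q\le n$) which generate $A$ as a C$^*$-algebra, such that $$\Phi(u_{pq})=\sum_{k=1}^n u_{pk}\otimes u_{kq}\qquad (1\le p,q\le n),$$ and such that the matrix $(u_{pq})$ and the transpose matrix $(u_{qp})$ are invertible in $M_n(A)$. Then $(A,\Phi)$ is a compact quantum group.
   Context: $A\otimes A$ denotes the minimal C$^*$-tensor product and $\iota$ the identity map. A comultiplication on a unital C$^*$-algebra $A$ is a unital $^*$-homomorphism $\Phi:A\to A\otimes A$ with $(\Phi\otimes\iota)\Phi=(\iota\otimes\Phi)\Phi$. A compact quantum group is a pair $(A,\Phi)$ of a unital C$^*$-algebra $A$ and a comultiplication $\Phi$ on $A$ such that $\Phi(A)(1\otimes A)$ and $\Phi(A)(A\otimes 1)$ are dense in $A\otimes A$; here $\Phi(A)(1\otimes A)$ denotes the linear span of $\{\Phi(a)(1\otimes b): a,b\in A\}$, and similarly for $\Phi(A)(A\otimes 1)$. *)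

theory Defs
  imports "HOL-Analysis.Analysis"
begin

section \<open>Unital C*-algebras\<close>

class scaleC =
  fixes scaleC :: "complex \<Rightarrow> 'a \<Rightarrow> 'a"  (infixr \<open>*\<^sub>C\<close> 75)

class star_op =
  fixes star :: "'a \<Rightarrow> 'a"

text \<open>The class is not built on \<^class>\<open>ring_1\<close>, so that the zero algebra is included.\<close>

class unital_cstar_algebra = real_normed_algebra + banach + monoid_mult + scaleC + star_op +
  assumes scaleC_add_right: "c *\<^sub>C (x + y) = c *\<^sub>C x + c *\<^sub>C y"
    and scaleC_add_left: "(c + d) *\<^sub>C x = c *\<^sub>C x + d *\<^sub>C x"
    and scaleC_scaleC: "c *\<^sub>C (d *\<^sub>C x) = (c * d) *\<^sub>C x"
    and scaleC_of_real: "of_real r *\<^sub>C x = r *\<^sub>R x"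
    and norm_scaleC: "norm (c *\<^sub>C x) = cmod c * norm x"
    and mult_scaleC_left: "(c *\<^sub>C x) * y = c *\<^sub>C (x * y)"
    and mult_scaleC_right: "x * (c *\<^sub>C y) = c *\<^sub>C (x * y)"
    and star_star: "star (star x) = x"
    and star_add: "star (x + y) = star x + star y"
    and star_scaleC: "star (c *\<^sub>C x) = cnj c *\<^sub>C star x"
    and star_mult: "star (x * y) = star y * star x"
    and cstar_identity: "norm (star x * x) = (norm x)\<^sup>2"

definition csubspace :: "'a::unital_cstar_algebra set \<Rightarrow> bool" where
  "csubspace S \<longleftrightarrow> 0 \<in> S \<and> (\<forall>x\<in>S. \<forall>y\<in>S. x + y \<in> S) \<and> (\<forall>c. \<forall>x\<in>S. c *\<^sub>C x \<in> S)"

definition cstar_subalgebra :: "'a::unital_cstar_algebra set \<Rightarrow> bool" where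
  "cstar_subalgebra S \<longleftrightarrow> csubspace S \<and> (\<forall>x\<in>S. \<forall>y\<in>S. x * y \<in> S) \<and> (\<forall>x\<in>S. star x \<in> S) \<and> closed S"

definition star_hom_on :: "'a::unital_cstar_algebra set \<Rightarrow> ('a \<Rightarrow> 'b::unital_cstar_algebra) \<Rightarrow> bool" where
  "star_hom_on S f \<longleftrightarrow>
     (\<forall>x\<in>S. \<forall>y\<in>S. f (x + y) = f x + f y) \<and>
     (\<forall>c. \<forall>x\<in>S. f (c *\<^sub>C x) = c *\<^sub>C f x) \<and>
     (\<forall>x\<in>S. \<forall>y\<in>S. f (x * y) = f x * f y) \<and>
     (\<forall>x\<in>S. f (star x) = star (f x))"

abbreviation star_hom :: "('a::unital_cstar_algebra \<Rightarrow> 'b::unital_cstar_algebra) \<Rightarrow> bool" where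
  "star_hom \<equiv> star_hom_on UNIV"

definition matrix_invertible :: "nat \<Rightarrow> (nat \<Rightarrow> nat \<Rightarrow> 'a::unital_cstar_algebra) \<Rightarrow> bool" where
  "matrix_invertible n u \<longleftrightarrow> (\<exists>v. \<forall>p\<in>{1..n}. \<forall>q\<in>{1..n}.
     (\<Sum>k=1..n. u p k * v k q) = (if p = q then 1 else 0) \<and>
     (\<Sum>k=1..n. v p k * u k q) = (if p = q then 1 else 0))"


section \<open>The Hilbert space of square-summable families\<close>

typedef 'i ell2 = "{f::'i \<Rightarrow> complex. (\<lambda>i. (cmod (f i))\<^sup>2) summable_on UNIV}"
  morphisms ell2_apply Abs_ell2
  by (rule exI[of _ "\<lambda>_. 0"]) simp

setup_lifting type_definition_ell2

lemma ell2_eqI: "(\<And>i. ell2_apply x i = ell2_apply y i) \<Longrightarrow> x = y"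
  by transfer auto

lemma ell2_summable: "(\<lambda>i. (cmod (ell2_apply x i))\<^sup>2) summable_on A"
proof -
  have "(\<lambda>i. (cmod (ell2_apply x i))\<^sup>2) summable_on UNIV"
    by transfer
  then show ?thesis
    by (rule summable_on_subset_banach) simp
qed

lemma cmod_mult_le: "cmod a * cmod b \<le> (cmod a)\<^sup>2 + (cmod b)\<^sup>2"
proof -
  have "2 * (cmod a * cmod b) \<le> (cmod a)\<^sup>2 + (cmod b)\<^sup>2"
    using sum_squares_bound[of "cmod a" "cmod b"] by simp
  moreover have "0 \<le> cmod a * cmod b" by simp
  ultimately show ?thesis by linarith
qed

lemma ell2_mult_abs_summable:
  assumes "(\<lambda>i. (cmod (f i))\<^sup>2) summable_on UNIV" "(\<lambda>i. (cmod (g i))\<^sup>2) summable_on UNIV"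
  shows "(\<lambda>i. norm (cnj (f i) * g i)) summable_on UNIV"
  by (rule summable_on_comparison_test[where f = "\<lambda>i. (cmod (f i))\<^sup>2 + (cmod (g i))\<^sup>2"])
     (use assms cmod_mult_le in \<open>auto intro: summable_on_add simp: norm_mult\<close>)

instantiation ell2 :: (type) real_vector
begin

lift_definition zero_ell2 :: "'a ell2" is "\<lambda>_. 0" by simp

lift_definition uminus_ell2 :: "'a ell2 \<Rightarrow> 'a ell2" is "\<lambda>f i. - f i" by simp

lift_definition plus_ell2 :: "'a ell2 \<Rightarrow> 'a ell2 \<Rightarrow> 'a ell2" is "\<lambda>f g i. f i + g i"
proof -
  fix f g :: "'a \<Rightarrow> complex"
  assume *: "(\<lambda>i. (cmod (f i))\<^sup>2) summable_on UNIV" "(\<lambda>i. (cmod (g i))\<^sup>2) summable_on UNIV"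
  have le: "(cmod (f i + g i))\<^sup>2 \<le> 2 * ((cmod (f i))\<^sup>2 + (cmod (g i))\<^sup>2)" for i
  proof -
    have "(cmod (f i + g i))\<^sup>2 \<le> (cmod (f i) + cmod (g i))\<^sup>2"
      by (intro power_mono norm_triangle_ineq) simp
    also have "\<dots> \<le> 2 * ((cmod (f i))\<^sup>2 + (cmod (g i))\<^sup>2)"
      using sum_squares_bound[of "cmod (f i)" "cmod (g i)"] by (simp add: power2_sum)
    finally show ?thesis .
  qed
  show "(\<lambda>i. (cmod (f i + g i))\<^sup>2) summable_on UNIV"
    by (rule summable_on_comparison_test[where f = "\<lambda>i. 2 * ((cmod (f i))\<^sup>2 + (cmod (g i))\<^sup>2)"])
       (use * le in \<open>auto intro!: summable_on_add summable_on_cmult_right\<close>)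
qed

definition minus_ell2 :: "'a ell2 \<Rightarrow> 'a ell2 \<Rightarrow> 'a ell2" where
  "minus_ell2 x y = x + (- y)"

lift_definition scaleR_ell2 :: "real \<Rightarrow> 'a ell2 \<Rightarrow> 'a ell2" is "\<lambda>r f i. of_real r * f i"
  by (auto simp: norm_mult power_mult_distrib intro!: summable_on_cmult_right)

instance
  by standard (unfold minus_ell2_def, (transfer, simp add: fun_eq_iff algebra_simps)+)

end

instantiation ell2 :: (type) scaleC
begin

lift_definition scaleC_ell2 :: "complex \<Rightarrow> 'a ell2 \<Rightarrow> 'a ell2" is "\<lambda>c f i. c * f i"
  by (auto simp: norm_mult power_mult_distrib intro!: summable_on_cmult_right)

instance ..

end

lemma ell2_apply_simps [simp]:
  "ell2_apply 0 i = 0"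
  "ell2_apply (x + y) i = ell2_apply x i + ell2_apply y i"
  "ell2_apply (- x) i = - ell2_apply x i"
  "ell2_apply (x - y) i = ell2_apply x i - ell2_apply y i"
  "ell2_apply (r *\<^sub>R x) i = of_real r * ell2_apply x i"
  "ell2_apply (c *\<^sub>C x) i = c * ell2_apply x i"
  unfolding minus_ell2_def by (transfer, simp)+

lemma ell2_apply_sum [simp]: "ell2_apply (\<Sum>k\<in>F. g k) i = (\<Sum>k\<in>F. ell2_apply (g k) i)"
  by (induction F rule: infinite_finite_induct) auto

definition cinner :: "'i ell2 \<Rightarrow> 'i ell2 \<Rightarrow> complex" where
  "cinner x y = (\<Sum>\<^sub>\<infinity>i. cnj (ell2_apply x i) * ell2_apply y i)"

lemma cinner_summable: "(\<lambda>i. cnj (ell2_apply x i) * ell2_apply y i) summable_on A"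
proof -
  have "(\<lambda>i. norm (cnj (ell2_apply x i) * ell2_apply y i)) summable_on UNIV"
    by (intro ell2_mult_abs_summable ell2_summable)
  from abs_summable_summable[OF this] show ?thesis
    by (rule summable_on_subset_banach) simp
qed

lemma cinner_add_left: "cinner (x + y) z = cinner x z + cinner y z"
  unfolding cinner_def by (simp add: distrib_right infsum_add cinner_summable)

lemma cinner_add_right: "cinner z (x + y) = cinner z x + cinner z y"
  unfolding cinner_def by (simp add: distrib_left infsum_add cinner_summable)

lemma cinner_scaleC_right: "cinner x (c *\<^sub>C y) = c * cinner x y"
  unfolding cinner_def by (simp add: mult.left_commute infsum_cmult_right')

lemma cinner_scaleC_left: "cinner (c *\<^sub>C x) y = cnj c * cinner x y"
  unfolding cinner_def by (simp add: mult.assoc infsum_cmult_right')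

lemma cinner_commute: "cinner x y = cnj (cinner y x)"
  unfolding cinner_def infsum_cnj[symmetric] by (simp add: mult.commute)

lemma ell2_scaleR_scaleC: "r *\<^sub>R (x :: 'i ell2) = of_real r *\<^sub>C x"
  by (rule ell2_eqI) simp

lemma cinner_self: "cinner x x = of_real (\<Sum>\<^sub>\<infinity>i. (cmod (ell2_apply x i))\<^sup>2)"
proof -
  have "cinner x x = (\<Sum>\<^sub>\<infinity>i. complex_of_real ((cmod (ell2_apply x i))\<^sup>2))"
    unfolding cinner_def
    by (intro infsum_cong) (rule trans[OF mult.commute complex_norm_square[symmetric]])
  also have "\<dots> = of_real (\<Sum>\<^sub>\<infinity>i. (cmod (ell2_apply x i))\<^sup>2)"
    by (intro infsumI has_sum_of_real has_sum_infsum ell2_summable)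
  finally show ?thesis .
qed

instantiation ell2 :: (type) real_inner
begin

definition inner_ell2 :: "'a ell2 \<Rightarrow> 'a ell2 \<Rightarrow> real" where
  "inner_ell2 x y = Re (cinner x y)"

definition norm_ell2 :: "'a ell2 \<Rightarrow> real" where
  "norm_ell2 x = sqrt (\<Sum>\<^sub>\<infinity>i. (cmod (ell2_apply x i))\<^sup>2)"

definition sgn_ell2 :: "'a ell2 \<Rightarrow> 'a ell2" where
  "sgn_ell2 x = x /\<^sub>R norm x"

definition dist_ell2 :: "'a ell2 \<Rightarrow> 'a ell2 \<Rightarrow> real" where
  "dist_ell2 x y = norm (x - y)"

definition uniformity_ell2 :: "('a ell2 \<times> 'a ell2) filter" where
  "uniformity_ell2 = (INF e\<in>{0 <..}. principal {(x, y). dist x y < e})"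

definition open_ell2 :: "'a ell2 set \<Rightarrow> bool" where
  "open_ell2 U = (\<forall>x\<in>U. \<forall>\<^sub>F (x', y) in uniformity. x' = x \<longrightarrow> y \<in> U)"

instance
proof
  fix x y z :: "'a ell2" and r :: real
  show "inner x y = inner y x"
    unfolding inner_ell2_def by (subst cinner_commute) simp
  show "inner (x + y) z = inner x z + inner y z"
    by (simp add: inner_ell2_def cinner_add_left)
  show "inner (r *\<^sub>R x) y = r * inner x y"
    by (simp add: inner_ell2_def ell2_scaleR_scaleC cinner_scaleC_left)
  show "0 \<le> inner x x"
    by (simp add: inner_ell2_def cinner_self infsum_nonneg)
  show "inner x x = 0 \<longleftrightarrow> x = 0"
  proof
    assume "inner x x = 0"
    then have "(\<Sum>\<^sub>\<infinity>i. (cmod (ell2_apply x i))\<^sup>2) = 0"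
      by (simp add: inner_ell2_def cinner_self)
    then have "(cmod (ell2_apply x i))\<^sup>2 = 0" for i
      by (intro nonneg_infsum_le_0D[of _ UNIV]) (auto intro: ell2_summable)
    then show "x = 0"
      by (intro ell2_eqI) simp
  qed (simp add: inner_ell2_def cinner_self)
  show "norm x = sqrt (inner x x)"
    by (simp add: inner_ell2_def norm_ell2_def cinner_self)
qed (simp_all add: sgn_ell2_def dist_ell2_def uniformity_ell2_def open_ell2_def)

end

lemma cinner_self_norm: "cinner x x = of_real ((norm x)\<^sup>2)"
  by (simp add: cinner_self norm_ell2_def infsum_nonneg)

lemma norm_ell2_scaleC: "norm (c *\<^sub>C (x :: 'i ell2)) = cmod c * norm x"
  by (simp add: norm_ell2_def norm_mult power_mult_distrib infsum_cmult_right' real_sqrt_mult)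

lemma norm_ell2_sq: "(norm x)\<^sup>2 = (\<Sum>\<^sub>\<infinity>i. (cmod (ell2_apply x i))\<^sup>2)"
  by (simp add: norm_ell2_def infsum_nonneg)

lemma sum_le_norm_ell2: "finite F \<Longrightarrow> (\<Sum>i\<in>F. (cmod (ell2_apply x i))\<^sup>2) \<le> (norm x)\<^sup>2"
  unfolding norm_ell2_sq by (rule finite_sum_le_infsum) (auto intro: ell2_summable)

lemma cmod_le_norm_ell2: "cmod (ell2_apply x i) \<le> norm x"
  by (rule power2_le_imp_le) (use sum_le_norm_ell2[of "{i}" x] in auto)

lemma ell2_boundedI:
  assumes "\<And>F. finite F \<Longrightarrow> (\<Sum>i\<in>F. (cmod (f i))\<^sup>2) \<le> C\<^sup>2" "0 \<le> C"
  shows "\<exists>x. ell2_apply x = f \<and> norm x \<le> C"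
proof -
  have s: "(\<lambda>i. (cmod (f i))\<^sup>2) summable_on UNIV"
    by (rule nonneg_bdd_above_summable_on) (use assms in \<open>auto intro!: bdd_aboveI\<close>)
  then have ap: "ell2_apply (Abs_ell2 f) = f"
    by (simp add: Abs_ell2_inverse)
  have "(\<Sum>\<^sub>\<infinity>i. (cmod (f i))\<^sup>2) \<le> C\<^sup>2"
    by (rule infsum_le_finite_sums[OF s]) (use assms in auto)
  then have "norm (Abs_ell2 f) \<le> C"
    using assms(2) by (simp add: norm_ell2_def ap real_le_lsqrt)
  with ap show ?thesis by blast
qed

lemma cinner_Cauchy_Schwarz: "cmod (cinner x y) \<le> norm x * norm y"
proof (cases "cinner x y = 0")
  case False
  define c where "c = cnj (cinner x y) / cmod (cinner x y)"
  have c1: "cmod c = 1"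
    using False by (simp add: c_def norm_divide)
  have "c * cinner x y = (cinner x y * cnj (cinner x y)) / cmod (cinner x y)"
    by (simp add: c_def)
  also have "\<dots> = of_real (cmod (cinner x y))"
    using False by (simp add: complex_norm_square[symmetric] power2_eq_square)
  finally have c2: "c * cinner x y = of_real (cmod (cinner x y))" .
  note c = c1 c2
  have "cmod (cinner x y) = inner x (c *\<^sub>C y)"
    by (simp add: inner_ell2_def cinner_scaleC_right c)
  also have "\<dots> \<le> norm x * norm (c *\<^sub>C y)"
    by (rule norm_cauchy_schwarz)
  finally show ?thesis by (simp add: norm_ell2_scaleC c)
qed simp

instance ell2 :: (type) banach
proof
  fix X :: "nat \<Rightarrow> 'a ell2"
  assume X: "Cauchy X"
  define f where "f i = lim (\<lambda>n. ell2_apply (X n) i)" for i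
  have "Cauchy (\<lambda>n. ell2_apply (X n) i)" for i
  proof (rule metric_CauchyI)
    fix e :: real assume "e > 0"
    then obtain M where "\<forall>m\<ge>M. \<forall>n\<ge>M. dist (X m) (X n) < e"
      using X unfolding Cauchy_def by blast
    moreover have "dist (ell2_apply (X m) i) (ell2_apply (X n) i) \<le> dist (X m) (X n)" for m n
      using cmod_le_norm_ell2[of "X m - X n" i] by (simp add: dist_norm)
    ultimately show "\<exists>M. \<forall>m\<ge>M. \<forall>n\<ge>M. dist (ell2_apply (X m) i) (ell2_apply (X n) i) < e"
      by (meson le_less_trans)
  qed
  then have "convergent (\<lambda>n. ell2_apply (X n) i)" for i
    by (rule Cauchy_convergent)
  then have f: "(\<lambda>n. ell2_apply (X n) i) \<longlonglongrightarrow> f i" for i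
    by (simp add: f_def convergent_LIMSEQ_iff)
  have main: "\<exists>M. \<forall>n\<ge>M. \<exists>y. ell2_apply y = (\<lambda>i. f i - ell2_apply (X n) i) \<and> norm y \<le> e"
    if e: "e > 0" for e
  proof -
    obtain M where M: "\<forall>m\<ge>M. \<forall>n\<ge>M. dist (X m) (X n) < e"
      using X e unfolding Cauchy_def by blast
    have "\<exists>y. ell2_apply y = (\<lambda>i. f i - ell2_apply (X n) i) \<and> norm y \<le> e" if n: "n \<ge> M" for n
    proof (rule ell2_boundedI)
      fix F :: "'a set" assume F: "finite F"
      have lim: "(\<lambda>m. \<Sum>i\<in>F. (cmod (ell2_apply (X m) i - ell2_apply (X n) i))\<^sup>2)
             \<longlonglongrightarrow> (\<Sum>i\<in>F. (cmod (f i - ell2_apply (X n) i))\<^sup>2)"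
        by (intro tendsto_intros f)
      have "(\<Sum>i\<in>F. (cmod (ell2_apply (X m) i - ell2_apply (X n) i))\<^sup>2) \<le> e\<^sup>2" if "m \<ge> M" for m
      proof -
        have "(\<Sum>i\<in>F. (cmod (ell2_apply (X m) i - ell2_apply (X n) i))\<^sup>2) \<le> (norm (X m - X n))\<^sup>2"
          using sum_le_norm_ell2[OF F, of "X m - X n"] by simp
        also have "\<dots> \<le> e\<^sup>2"
          using M that n by (intro power_mono) (auto simp: dist_norm less_imp_le)
        finally show ?thesis .
      qed
      then show "(\<Sum>i\<in>F. (cmod (f i - ell2_apply (X n) i))\<^sup>2) \<le> e\<^sup>2"
        by (intro LIMSEQ_le_const2[OF lim]) auto
    qed (use e in simp)
    then show ?thesis by blast
  qed
  obtain n0 y0 where "ell2_apply y0 = (\<lambda>i. f i - ell2_apply (X n0) i)"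
    using main[of 1] by auto
  then have L: "ell2_apply (X n0 + y0) i = f i" for i
    by simp
  have "X \<longlonglongrightarrow> X n0 + y0"
  proof (rule metric_LIMSEQ_I)
    fix e :: real assume "e > 0"
    then obtain M where M: "\<And>n. n \<ge> M \<Longrightarrow> \<exists>y. ell2_apply y = (\<lambda>i. f i - ell2_apply (X n) i) \<and> norm y \<le> e / 2"
      using main[of "e/2"] by auto
    have "dist (X n) (X n0 + y0) < e" if n: "n \<ge> M" for n
    proof -
      obtain y where y: "ell2_apply y = (\<lambda>i. f i - ell2_apply (X n) i)" "norm y \<le> e / 2"
        using M[OF n] by blast
      have "y = X n0 + y0 - X n"
        by (rule ell2_eqI) (use L y(1) in simp)
      then show ?thesis
        using y(2) \<open>e > 0\<close> by (simp add: dist_norm norm_minus_commute)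
    qed
    then show "\<exists>M. \<forall>n\<ge>M. dist (X n) (X n0 + y0) < e" by blast
  qed
  then show "convergent X"
    by (auto simp: convergent_def)
qed

lift_definition ket :: "'i \<Rightarrow> 'i ell2" is "\<lambda>i j. if j = i then 1 else 0"
proof -
  fix i :: 'i
  have "(\<lambda>j. (cmod (if j = i then 1 else 0))\<^sup>2) summable_on {i}"
    by simp
  then show "(\<lambda>j. (cmod (if j = i then 1 else 0))\<^sup>2) summable_on UNIV"
    by (rule summable_on_cong_neutral[THEN iffD1, rotated -1]) auto
qed

lemma ket_apply: "ell2_apply (ket i) j = (if j = i then 1 else 0)"
  by transfer simp

lemma cinner_ket_left: "cinner (ket i) x = ell2_apply x i"
proof -
  have "cinner (ket i) x = (\<Sum>\<^sub>\<infinity>j\<in>{i}. cnj (ell2_apply (ket i) j) * ell2_apply x j)"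
    unfolding cinner_def by (rule infsum_cong_neutral) (auto simp: ket_apply)
  then show ?thesis by (simp add: ket_apply)
qed

lemma cinner_ket_right: "cinner x (ket i) = cnj (ell2_apply x i)"
  by (subst cinner_commute) (simp add: cinner_ket_left)

lemma cinner_zero [simp]: "cinner 0 x = 0" "cinner x 0 = 0"
  by (simp_all add: cinner_def)

lemma cinner_sum_right: "cinner x (\<Sum>k\<in>F. g k) = (\<Sum>k\<in>F. cinner x (g k))"
  by (induction F rule: infinite_finite_induct) (auto simp: cinner_add_right)

lemma cinner_sum_left: "cinner (\<Sum>k\<in>F. g k) x = (\<Sum>k\<in>F. cinner (g k) x)"
  by (induction F rule: infinite_finite_induct) (auto simp: cinner_add_left)

lemma norm_ket_sum:
  assumes "finite F"
  shows "(norm (\<Sum>i\<in>F. c i *\<^sub>C ket i))\<^sup>2 = (\<Sum>i\<in>F. (cmod (c i))\<^sup>2)"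
proof -
  have coeff: "ell2_apply (\<Sum>i\<in>F. c i *\<^sub>C ket i) j = (if j \<in> F then c j else 0)" for j
    using assms by (simp add: ket_apply if_distrib cong: if_cong)
  have "(norm (\<Sum>i\<in>F. c i *\<^sub>C ket i))\<^sup>2 = (\<Sum>\<^sub>\<infinity>j\<in>F. (cmod (c j))\<^sup>2)"
    unfolding norm_ell2_sq coeff by (rule infsum_cong_neutral) auto
  then show ?thesis using assms by simp
qed

lemma ell2_truncation:
  assumes e: "0 < e"
  shows "\<exists>F. finite F \<and> norm (x - (\<Sum>i\<in>F. ell2_apply x i *\<^sub>C ket i)) < e"
proof -
  have "((\<lambda>i. (cmod (ell2_apply x i))\<^sup>2) has_sum (norm x)\<^sup>2) UNIV"
    unfolding norm_ell2_sq by (intro has_sum_infsum ell2_summable)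
  then obtain F where F: "finite F" "dist (\<Sum>i\<in>F. (cmod (ell2_apply x i))\<^sup>2) ((norm x)\<^sup>2) \<le> e\<^sup>2 / 2"
    using has_sum_finite_approximation[where \<epsilon> = "e\<^sup>2/2"] e by (metis zero_less_divide_iff zero_less_numeral zero_less_power)
  define y where "y = (\<Sum>i\<in>F. ell2_apply x i *\<^sub>C ket i)"
  have y: "(norm y)\<^sup>2 = (\<Sum>i\<in>F. (cmod (ell2_apply x i))\<^sup>2)"
    unfolding y_def by (rule norm_ket_sum[OF F(1)])
  have "cinner x y = (\<Sum>i\<in>F. ell2_apply x i * cnj (ell2_apply x i))"
    by (simp add: y_def cinner_sum_right cinner_scaleC_right cinner_ket_right)
  also have "\<dots> = of_real ((norm y)\<^sup>2)"
    unfolding y by (simp add: complex_norm_square[symmetric] del: of_real_power)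
  finally have "inner x y = (norm y)\<^sup>2"
    by (simp add: inner_ell2_def del: of_real_power)
  then have "(norm (x - y))\<^sup>2 = (norm x)\<^sup>2 - (norm y)\<^sup>2"
    by (simp add: power2_norm_eq_inner inner_diff_left inner_diff_right inner_commute)
  also have "\<dots> \<le> e\<^sup>2 / 2"
    using F(2) unfolding y dist_real_def by linarith
  also have "\<dots> < e\<^sup>2" using e by simp
  finally have "norm (x - y) < e"
    using e by (simp add: power2_less_imp_less)
  with F(1) show ?thesis unfolding y_def by blast
qed

lemma bounded_linear_ket_eq_0:
  assumes f: "bounded_linear f" and 0: "\<And>c i. f (c *\<^sub>C ket i) = 0"
  shows "f x = 0"
proof -
  interpret bounded_linear f by fact
  obtain K where K: "K > 0" "\<And>x. norm (f x) \<le> norm x * K"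
    using pos_bounded by blast
  have "norm (f x) \<le> e" if e: "e > 0" for e
  proof -
    obtain F where F: "norm (x - (\<Sum>i\<in>F. ell2_apply x i *\<^sub>C ket i)) < e / K"
      using ell2_truncation[of "e / K" x] e K by auto
    have "f x = f (x - (\<Sum>i\<in>F. ell2_apply x i *\<^sub>C ket i))"
      by (simp add: diff sum 0)
    also have "norm \<dots> \<le> (e / K) * K"
      using K(2)[of "x - (\<Sum>i\<in>F. ell2_apply x i *\<^sub>C ket i)"] F K(1)
      by (meson less_imp_le mult_right_mono order_trans)
    finally show ?thesis using K(1) by simp
  qed
  then show ?thesis
    by (metis field_le_epsilon add_0 norm_le_zero_iff)
qed


section \<open>Bounded operators as a C*-algebra\<close>

typedef (overloaded) 'i bop =
  "{T :: 'i ell2 \<Rightarrow>\<^sub>L 'i ell2. \<forall>c x. blinfun_apply T (c *\<^sub>C x) = c *\<^sub>C blinfun_apply T x}"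
  morphisms blinfun_of_bop Abs_bop
  by (rule exI[of _ 0]) (auto intro: ell2_eqI)

lifting_forget ell2.lifting
setup_lifting type_definition_bop

lift_definition bop_apply :: "'i bop \<Rightarrow> 'i ell2 \<Rightarrow> 'i ell2" is blinfun_apply .

lemma bop_eqI: "(\<And>x. bop_apply S x = bop_apply T x) \<Longrightarrow> S = T"
  by transfer (rule blinfun_eqI)

lemma bop_apply_scaleC: "bop_apply T (c *\<^sub>C x) = c *\<^sub>C bop_apply T x"
  by transfer simp

lemma bounded_linear_bop_apply: "bounded_linear (bop_apply T)"
  by transfer (rule blinfun.bounded_linear_right)

instantiation bop :: (type) "{real_normed_algebra, monoid_mult, scaleC, star_op}"
begin

lift_definition zero_bop :: "'a bop" is 0
  by (auto intro: ell2_eqI)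

lift_definition one_bop :: "'a bop" is id_blinfun
  by (auto intro: ell2_eqI)

lift_definition plus_bop :: "'a bop \<Rightarrow> 'a bop \<Rightarrow> 'a bop" is "(+)"
  by (auto intro!: ell2_eqI simp: blinfun.add_left distrib_left)

lift_definition minus_bop :: "'a bop \<Rightarrow> 'a bop \<Rightarrow> 'a bop" is "(-)"
  by (auto intro!: ell2_eqI simp: blinfun.diff_left right_diff_distrib)

lift_definition uminus_bop :: "'a bop \<Rightarrow> 'a bop" is "uminus"
  by (auto intro!: ell2_eqI simp: blinfun.minus_left)

lift_definition scaleR_bop :: "real \<Rightarrow> 'a bop \<Rightarrow> 'a bop" is scaleR
  by (auto intro!: ell2_eqI simp: blinfun.scaleR_left)

lift_definition times_bop :: "'a bop \<Rightarrow> 'a bop \<Rightarrow> 'a bop" is blinfun_compose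
  by (auto intro!: ell2_eqI simp: blinfun_compose.rep_eq)

lift_definition norm_bop :: "'a bop \<Rightarrow> real" is norm .

lemma bounded_linear_ell2_scaleC: "bounded_linear (\<lambda>x :: 'i ell2. c *\<^sub>C x)"
  by (rule bounded_linear_intro[where K = "cmod c"])
     (auto intro!: ell2_eqI simp: distrib_left norm_ell2_scaleC mult.left_commute mult.commute)

lift_definition scaleC_bop :: "complex \<Rightarrow> 'a bop \<Rightarrow> 'a bop" is
  "\<lambda>c T. Blinfun (\<lambda>x. c *\<^sub>C blinfun_apply T x)"
  by (subst (1 2) bounded_linear_Blinfun_apply)
     (auto intro!: ell2_eqI bounded_linear_compose[OF bounded_linear_ell2_scaleC]
           blinfun.bounded_linear_right simp: mult.left_commute)

definition star_bop :: "'a bop \<Rightarrow> 'a bop" where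
  "star_bop T = (THE S. \<forall>x y. cinner (bop_apply S x) y = cinner x (bop_apply T y))"

definition sgn_bop :: "'a bop \<Rightarrow> 'a bop" where
  "sgn_bop x = scaleR (inverse (norm x)) x"

definition dist_bop :: "'a bop \<Rightarrow> 'a bop \<Rightarrow> real" where
  "dist_bop x y = norm (x - y)"

definition uniformity_bop :: "('a bop \<times> 'a bop) filter" where
  "uniformity_bop = (INF e\<in>{0 <..}. principal {(x, y). dist x y < e})"

definition open_bop :: "'a bop set \<Rightarrow> bool" where
  "open_bop U = (\<forall>x\<in>U. \<forall>\<^sub>F (x', y) in uniformity. x' = x \<longrightarrow> y \<in> U)"

lemma bop_apply_simps:
  "bop_apply 0 x = 0"
  "bop_apply 1 x = x"
  "bop_apply (S + T) x = bop_apply S x + bop_apply T x"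
  "bop_apply (S - T) x = bop_apply S x - bop_apply T x"
  "bop_apply (- S) x = - bop_apply S x"
  "bop_apply (r *\<^sub>R S) x = r *\<^sub>R bop_apply S x"
  "bop_apply (S * T) x = bop_apply S (bop_apply T x)"
       apply (transfer, simp add: blinfun.add_left blinfun.diff_left blinfun.minus_left blinfun.scaleR_left)+
  done

lemma bop_apply_scaleC_left: "bop_apply (c *\<^sub>C T) x = c *\<^sub>C bop_apply T x"
  by transfer
     (simp add: bounded_linear_Blinfun_apply bounded_linear_compose[OF bounded_linear_ell2_scaleC]
        blinfun.bounded_linear_right)

lemma norm_bop_apply: "norm (bop_apply T x) \<le> norm T * norm x"
  by transfer (rule norm_blinfun)

lemma norm_bop_leI: "0 \<le> C \<Longrightarrow> (\<And>x. norm (bop_apply T x) \<le> C * norm x) \<Longrightarrow> norm T \<le> C"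
  by transfer (rule norm_blinfun_bound)

lemma norm_bop_ge_0: "0 \<le> norm (T :: 'a bop)"
  by transfer simp

lemma bop_exists:
  assumes "\<And>x y. f (x + y) = f x + f y" "\<And>c x. f (c *\<^sub>C x) = c *\<^sub>C f x"
    "\<And>x. norm (f x) \<le> C * norm x" "0 \<le> C"
  shows "\<exists>T. bop_apply T = f \<and> norm T \<le> C"
proof -
  have bl: "bounded_linear f"
    by (rule bounded_linear_intro[where K = C]) (use assms in \<open>auto simp: ell2_scaleR_scaleC mult.commute\<close>)
  define T where "T = Abs_bop (Blinfun f)"
  have "blinfun_of_bop T = Blinfun f"
    unfolding T_def by (rule Abs_bop_inverse) (simp add: bl bounded_linear_Blinfun_apply assms)
  then have ap: "bop_apply T = f"
    by (simp add: bop_apply.rep_eq bl bounded_linear_Blinfun_apply)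
  moreover have "norm T \<le> C"
    by (rule norm_bop_leI) (use assms ap in auto)
  ultimately show ?thesis by blast
qed

lemma ex_adjoint:
  fixes T :: "'a bop"
  shows "\<exists>S. \<forall>x y. cinner (bop_apply S x) y = cinner x (bop_apply T y)"
proof -
  have vec: "\<exists>z. ell2_apply z = (\<lambda>i. cinner (bop_apply T (ket i)) y) \<and> norm z \<le> norm T * norm y" for y
  proof (rule ell2_boundedI)
    fix F :: "'a set" assume F: "finite F"
    define g where "g i = cinner (bop_apply T (ket i)) y" for i
    define z where "z = (\<Sum>i\<in>F. g i *\<^sub>C ket i)"
    have z: "(norm z)\<^sup>2 = (\<Sum>i\<in>F. (cmod (g i))\<^sup>2)"
      unfolding z_def by (rule norm_ket_sum[OF F])
    have "bop_apply T z = (\<Sum>i\<in>F. g i *\<^sub>C bop_apply T (ket i))"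
      unfolding z_def bounded_linear.linear[OF bounded_linear_bop_apply, THEN linear_sum]
      by (simp add: bop_apply_scaleC)
    then have "cinner (bop_apply T z) y = (\<Sum>i\<in>F. cnj (g i) * g i)"
      by (simp add: cinner_sum_left cinner_scaleC_left g_def)
    also have "\<dots> = of_real ((norm z)\<^sup>2)"
      unfolding z by (simp add: complex_norm_square mult.commute del: of_real_power)
    finally have "(norm z)\<^sup>2 = cmod (cinner (bop_apply T z) y)"
      by (simp add: norm_power del: of_real_power)
    also have "\<dots> \<le> norm (bop_apply T z) * norm y"
      by (rule cinner_Cauchy_Schwarz)
    also have "\<dots> \<le> norm T * norm z * norm y"
      by (intro mult_right_mono norm_bop_apply) simp
    finally have "norm z * norm z \<le> norm z * (norm T * norm y)"
      by (simp add: power2_eq_square mult_ac)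
    then have "norm z \<le> norm T * norm y"
      by (cases "norm z = 0") (use norm_bop_ge_0[of T] in \<open>auto\<close>)
    then have "(norm z)\<^sup>2 \<le> (norm T * norm y)\<^sup>2"
      by (intro power_mono) auto
    then show "(\<Sum>i\<in>F. (cmod (cinner (bop_apply T (ket i)) y))\<^sup>2) \<le> (norm T * norm y)\<^sup>2"
      unfolding z by (simp add: g_def)
  qed (simp add: norm_bop_ge_0)
  then obtain S where S: "\<And>y. ell2_apply (S y) = (\<lambda>i. cinner (bop_apply T (ket i)) y)"
      "\<And>y. norm (S y) \<le> norm T * norm y"
    by metis
  have "\<exists>S'. bop_apply S' = S \<and> norm S' \<le> norm T"
    by (rule bop_exists)
       (use S norm_bop_ge_0 in \<open>auto intro!: ell2_eqI simp: cinner_add_right cinner_scaleC_right\<close>)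
  then obtain S' where S': "bop_apply S' = S" by blast
  have "cinner (bop_apply T x) y - cinner x (S y) = 0" for x y
  proof (rule bounded_linear_ket_eq_0[of "\<lambda>x. cinner (bop_apply T x) y - cinner x (S y)"])
    have "bounded_linear (\<lambda>x. cinner x y)" for y :: "'a ell2"
      by (rule bounded_linear_intro[where K = "norm y"])
         (auto simp: cinner_add_left ell2_scaleR_scaleC cinner_scaleC_left cinner_Cauchy_Schwarz
                scaleR_conv_of_real)
    then show "bounded_linear (\<lambda>x. cinner (bop_apply T x) y - cinner x (S y))"
      by (intro bounded_linear_sub)
         (auto intro: bounded_linear_compose[where g = "bop_apply T", OF _ bounded_linear_bop_apply])
    show "cinner (bop_apply T (c *\<^sub>C ket i)) y - cinner (c *\<^sub>C ket i) (S y) = 0" for c i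
      by (simp add: bop_apply_scaleC cinner_scaleC_left cinner_ket_left S)
  qed
  then have "cinner (S y) x = cinner y (bop_apply T x)" for x y
    by (subst cinner_commute, subst (2) cinner_commute) simp
  then show ?thesis using S' by blast
qed

lemma cinner_eqI: "(\<And>y. cinner x y = cinner z y) \<Longrightarrow> x = z"
  by (rule ell2_eqI) (metis cinner_ket_right complex_cnj_cancel_iff)

lemma star_bop_left: "cinner (bop_apply (star T) x) y = cinner x (bop_apply T y)"
proof -
  have "\<exists>!S. \<forall>x y. cinner (bop_apply S x) y = cinner x (bop_apply T y)"
  proof (rule ex_ex1I[OF ex_adjoint])
    fix S S' :: "'a bop"
    assume "\<forall>x y. cinner (bop_apply S x) y = cinner x (bop_apply T y)"
      "\<forall>x y. cinner (bop_apply S' x) y = cinner x (bop_apply T y)"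
    then show "S = S'"
      by (intro bop_eqI cinner_eqI) simp
  qed
  from theI'[OF this] show ?thesis
    unfolding star_bop_def by blast
qed

lemma star_bop_right: "cinner x (bop_apply (star T) y) = cinner (bop_apply T x) y"
  by (subst cinner_commute, subst star_bop_left, subst cinner_commute) simp

lemma star_bop_eqI: "(\<And>x y. cinner (bop_apply S x) y = cinner x (bop_apply T y)) \<Longrightarrow> star T = S"
  by (intro bop_eqI cinner_eqI) (simp add: star_bop_left)

lemma norm_bop_mult: "norm (S * T) \<le> norm S * norm (T :: 'a bop)"
  by transfer (rule norm_blinfun_compose)

lemma norm_bop_sq_le: "(norm T)\<^sup>2 \<le> norm (star T * T :: 'a bop)"
proof -
  have "norm T \<le> sqrt (norm (star T * T))"
  proof (rule norm_bop_leI)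
    fix x
    have "complex_of_real ((norm (bop_apply T x))\<^sup>2) = cinner (bop_apply (star T * T) x) x"
      by (simp only: cinner_self_norm[symmetric] bop_apply_simps star_bop_left)
    then have "(norm (bop_apply T x))\<^sup>2 = cmod (cinner (bop_apply (star T * T) x) x)"
      by (metis norm_of_real abs_of_nonneg zero_le_power2)
    also have "\<dots> \<le> norm (bop_apply (star T * T) x) * norm x"
      by (rule cinner_Cauchy_Schwarz)
    also have "\<dots> \<le> (norm (star T * T) * norm x) * norm x"
      by (intro mult_right_mono norm_bop_apply) simp
    finally have "norm (bop_apply T x) \<le> sqrt (norm (star T * T) * (norm x)\<^sup>2)"
      by (intro real_le_rsqrt) (simp add: power2_eq_square mult_ac)
    then show "norm (bop_apply T x) \<le> sqrt (norm (star T * T)) * norm x"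
      by (simp add: real_sqrt_mult)
  qed (simp add: norm_bop_ge_0)
  then show ?thesis
    using norm_bop_ge_0[of T] norm_bop_ge_0[of "star T * T"]
    by (metis power_mono real_sqrt_pow2)
qed

lemma star_star_bop: "star (star T) = (T :: 'a bop)"
  by (rule star_bop_eqI) (simp add: star_bop_right)

lemma norm_star_bop: "norm (star T) = norm (T :: 'a bop)"
proof -
  have le: "norm S \<le> norm (star S)" for S :: "'a bop"
  proof -
    have "norm S * norm S \<le> norm (star S) * norm S"
      using norm_bop_sq_le[of S] norm_bop_mult[of "star S" S] by (simp add: power2_eq_square)
    then show ?thesis
      using norm_bop_ge_0[of S] norm_bop_ge_0[of "star S"] by (cases "norm S = 0") auto
  qed
  from le[of T] le[of "star T"] show ?thesis by (simp add: star_star_bop)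
qed

instance
proof
  fix a b c :: "'a bop" and r s :: real
  show "a + b + c = a + (b + c)" "a + b = b + a" "0 + a = a" "- a + a = 0" "a - b = a + - b"
    by (transfer, simp)+
  show "r *\<^sub>R (a + b) = r *\<^sub>R a + r *\<^sub>R b" "(r + s) *\<^sub>R a = r *\<^sub>R a + s *\<^sub>R a"
    "r *\<^sub>R s *\<^sub>R a = (r * s) *\<^sub>R a" "1 *\<^sub>R a = a"
    by (transfer, simp add: algebra_simps)+
  show "a * b * c = a * (b * c)" "(a + b) * c = a * c + b * c" "a * (b + c) = a * b + a * c"
    "r *\<^sub>R a * b = r *\<^sub>R (a * b)" "a * r *\<^sub>R b = r *\<^sub>R (a * b)" "1 * a = a" "a * 1 = a"
    by (rule bop_eqI,
        simp add: bop_apply_simps bounded_linear_bop_apply bounded_linear.linear linear_add linear_scale)+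
  show "norm (a * b) \<le> norm a * norm b"
    by (rule norm_bop_mult)
  show "norm a = 0 \<longleftrightarrow> a = 0" "norm (a + b) \<le> norm a + norm b" "norm (r *\<^sub>R a) = \<bar>r\<bar> * norm a"
    by (transfer, simp add: norm_triangle_ineq)+
qed (simp_all add: sgn_bop_def dist_bop_def uniformity_bop_def open_bop_def)

end

instance bop :: (type) banach
proof
  fix X :: "nat \<Rightarrow> 'a bop"
  have dist: "dist S T = dist (blinfun_of_bop S) (blinfun_of_bop T)" for S T :: "'a bop"
    unfolding dist_bop_def dist_norm by transfer simp
  assume "Cauchy X"
  then have "Cauchy (\<lambda>n. blinfun_of_bop (X n))"
    unfolding Cauchy_def dist .
  then obtain L where L: "(\<lambda>n. blinfun_of_bop (X n)) \<longlonglongrightarrow> L"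
    using Cauchy_convergent_iff convergent_def by blast
  have Lx: "(\<lambda>n. blinfun_apply (blinfun_of_bop (X n)) x) \<longlonglongrightarrow> blinfun_apply L x" for x
    by (intro tendsto_intros L)
  have "blinfun_apply L (c *\<^sub>C x) = c *\<^sub>C blinfun_apply L x" for c x
  proof (rule LIMSEQ_unique[OF Lx])
    have "(\<lambda>n. c *\<^sub>C blinfun_apply (blinfun_of_bop (X n)) x) \<longlonglongrightarrow> c *\<^sub>C blinfun_apply L x"
      by (rule bounded_linear.tendsto[OF bounded_linear_ell2_scaleC Lx])
    then show "(\<lambda>n. blinfun_apply (blinfun_of_bop (X n)) (c *\<^sub>C x)) \<longlonglongrightarrow> c *\<^sub>C blinfun_apply L x"
      by (simp add: bop_apply.rep_eq[symmetric] bop_apply_scaleC)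
  qed
  then have "blinfun_of_bop (Abs_bop L) = L"
    by (intro Abs_bop_inverse) simp
  then have "X \<longlonglongrightarrow> Abs_bop L"
    using L by (simp add: tendsto_iff dist)
  then show "convergent X"
    by (auto simp: convergent_def)
qed

instance bop :: (type) unital_cstar_algebra
proof
  fix a b :: "'a bop" and r :: real and z w :: complex
  show "z *\<^sub>C (a + b) = z *\<^sub>C a + z *\<^sub>C b" "(z + w) *\<^sub>C a = z *\<^sub>C a + w *\<^sub>C a"
    "z *\<^sub>C (w *\<^sub>C a) = (z * w) *\<^sub>C a" "of_real r *\<^sub>C a = r *\<^sub>R a"
    "(z *\<^sub>C a) * b = z *\<^sub>C (a * b)" "a * (z *\<^sub>C b) = z *\<^sub>C (a * b)"
    by (rule bop_eqI, rule ell2_eqI,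
        simp add: bop_apply_simps bop_apply_scaleC_left bop_apply_scaleC algebra_simps)+
  have le: "norm (z *\<^sub>C a) \<le> cmod z * norm a" for z and a :: "'a bop"
    by (rule norm_bop_leI)
       (auto simp: norm_bop_ge_0 bop_apply_scaleC_left norm_ell2_scaleC mult.assoc norm_bop_apply mult_left_mono)
  show "norm (z *\<^sub>C a) = cmod z * norm a"
  proof (cases "z = 0")
    case False
    have "inverse z *\<^sub>C (z *\<^sub>C a) = a"
      by (rule bop_eqI, rule ell2_eqI) (use False in \<open>simp add: bop_apply_scaleC_left\<close>)
    then have "norm a \<le> inverse (cmod z) * norm (z *\<^sub>C a)"
      using le[of "inverse z" "z *\<^sub>C a"] by (simp add: norm_inverse)
    then have "cmod z * norm a \<le> norm (z *\<^sub>C a)"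
      using False by (simp add: field_simps)
    then show ?thesis using le[of z a] by simp
  qed (use le[of 0 a] norm_bop_ge_0[of "0 *\<^sub>C a"] in auto)
  show "star (star a) = a" by (rule star_star_bop)
  show "star (a + b) = star a + star b" "star (a * b) = star b * star a"
    "star (z *\<^sub>C a) = cnj z *\<^sub>C star a"
    by (rule star_bop_eqI, simp add: bop_apply_simps bop_apply_scaleC_left star_bop_left
          cinner_add_left cinner_add_right cinner_scaleC_left cinner_scaleC_right)+
  show "norm (star a * a) = (norm a)\<^sup>2"
    using norm_bop_sq_le[of a] norm_bop_mult[of "star a" a]
    by (simp add: norm_star_bop power2_eq_square)
qed

section \<open>Tensor products of vectors and operators\<close>

lemma summable_on_ell2_reindex:
  "inj_on h A \<Longrightarrow> (\<lambda>i. (cmod (ell2_apply x (h i)))\<^sup>2) summable_on A"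
  using summable_on_reindex[of h A "\<lambda>i. (cmod (ell2_apply x i))\<^sup>2"] ell2_summable[of x "h ` A"]
  by (simp add: o_def)

definition tensor_ell2 :: "'i ell2 \<Rightarrow> 'j ell2 \<Rightarrow> ('i \<times> 'j) ell2" where
  "tensor_ell2 x y = Abs_ell2 (\<lambda>(i, j). ell2_apply x i * ell2_apply y j)"

lemma tensor_ell2_apply: "ell2_apply (tensor_ell2 x y) (i, j) = ell2_apply x i * ell2_apply y j"
proof -
  have "\<exists>z. ell2_apply z = (\<lambda>(i, j). ell2_apply x i * ell2_apply y j) \<and> norm z \<le> norm x * norm y"
  proof (rule ell2_boundedI)
    fix F :: "('a \<times> 'b) set" assume F: "finite F"
    have "(\<Sum>p\<in>F. (cmod (case p of (i, j) \<Rightarrow> ell2_apply x i * ell2_apply y j))\<^sup>2)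
        \<le> (\<Sum>p\<in>fst ` F \<times> snd ` F. (cmod (case p of (i, j) \<Rightarrow> ell2_apply x i * ell2_apply y j))\<^sup>2)"
      using F by (intro sum_mono2) force+
    also have "\<dots> = (\<Sum>i\<in>fst ` F. (cmod (ell2_apply x i))\<^sup>2) * (\<Sum>j\<in>snd ` F. (cmod (ell2_apply y j))\<^sup>2)"
      by (simp add: sum_product sum.cartesian_product norm_mult power_mult_distrib case_prod_unfold)
    also have "\<dots> \<le> (norm x)\<^sup>2 * (norm y)\<^sup>2"
      using F by (intro mult_mono sum_le_norm_ell2) (auto intro: sum_nonneg)
    finally show "(\<Sum>p\<in>F. (cmod (case p of (i, j) \<Rightarrow> ell2_apply x i * ell2_apply y j))\<^sup>2)
        \<le> (norm x * norm y)\<^sup>2"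
      by (simp add: power_mult_distrib)
  qed simp
  then obtain z where "ell2_apply z = (\<lambda>(i, j). ell2_apply x i * ell2_apply y j)" by blast
  then show ?thesis
    unfolding tensor_ell2_def by (metis ell2_apply_inverse case_prod_conv)
qed

lemma ket_tensor: "ket (i, j) = tensor_ell2 (ket i) (ket j)"
proof (rule ell2_eqI)
  fix p show "ell2_apply (ket (i, j)) p = ell2_apply (tensor_ell2 (ket i) (ket j)) p"
    by (cases p) (simp add: ket_apply tensor_ell2_apply)
qed

definition op_tensor :: "'i bop \<Rightarrow> 'j bop \<Rightarrow> ('i \<times> 'j) bop" where
  "op_tensor S T = (THE R. \<forall>x y. bop_apply R (tensor_ell2 x y) = tensor_ell2 (bop_apply S x) (bop_apply T y))"

lemma bop_tensor_eqI:
  fixes R R' :: "('i \<times> 'j) bop"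
  assumes "\<And>x y. bop_apply R (tensor_ell2 x y) = bop_apply R' (tensor_ell2 x y)"
  shows "R = R'"
proof (rule bop_eqI)
  fix z
  have "bop_apply R z - bop_apply R' z = 0"
  proof (rule bounded_linear_ket_eq_0[of "\<lambda>z. bop_apply R z - bop_apply R' z"])
    show "bounded_linear (\<lambda>z. bop_apply R z - bop_apply R' z)"
      by (intro bounded_linear_sub bounded_linear_bop_apply)
    fix c and p :: "'i \<times> 'j"
    obtain i j where "p = (i, j)" by (cases p)
    then show "bop_apply R (c *\<^sub>C ket p) - bop_apply R' (c *\<^sub>C ket p) = 0"
      by (simp add: bop_apply_scaleC ket_tensor assms)
  qed
  then show "bop_apply R z = bop_apply R' z" by simp
qed

lemma amplification:
  fixes c :: "'i \<times> 'j \<Rightarrow> 'p" and S :: "'i bop"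
  assumes c: "bij c"
  shows "\<exists>R. \<forall>z i j. ell2_apply (bop_apply R z) (c (i, j)) =
           ell2_apply (bop_apply S (Abs_ell2 (\<lambda>i. ell2_apply z (c (i, j))))) i"
proof -
  define sl where "sl z j = Abs_ell2 (\<lambda>i. ell2_apply z (c (i, j)))" for z j
  have sl: "ell2_apply (sl z j) i = ell2_apply z (c (i, j))" for z i j
  proof -
    have "inj (\<lambda>i. c (i, j))"
      using bij_is_inj[OF c] by (auto simp: inj_on_def)
    then show ?thesis
      unfolding sl_def by (simp add: Abs_ell2_inverse summable_on_ell2_reindex)
  qed
  have sl_lin: "sl (z + w) j = sl z j + sl w j" "sl (d *\<^sub>C z) j = d *\<^sub>C sl z j" for z w j d
    by (rule ell2_eqI, simp add: sl)+
  have sl_norm: "(\<Sum>j\<in>J. (norm (sl z j))\<^sup>2) \<le> (norm z)\<^sup>2" if J: "finite J" for z J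
  proof -
    have inj: "inj_on (\<lambda>(j, i). c (i, j)) A" for A
      using bij_is_inj[OF c] by (auto simp: inj_on_def)
    have summ: "(\<lambda>(j, i). (cmod (ell2_apply z (c (i, j))))\<^sup>2) summable_on A" for A
      using summable_on_ell2_reindex[OF inj, of z A] by (simp add: case_prod_unfold)
    have "(\<Sum>j\<in>J. (norm (sl z j))\<^sup>2) = (\<Sum>\<^sub>\<infinity>j\<in>J. \<Sum>\<^sub>\<infinity>i. (cmod (ell2_apply z (c (i, j))))\<^sup>2)"
      using J by (simp add: norm_ell2_sq sl)
    also have "\<dots> = (\<Sum>\<^sub>\<infinity>(j, i)\<in>J \<times> UNIV. (cmod (ell2_apply z (c (i, j))))\<^sup>2)"
      by (rule infsum_Sigma'_banach) (rule summ)
    also have "\<dots> = (\<Sum>\<^sub>\<infinity>p\<in>(\<lambda>(j, i). c (i, j)) ` (J \<times> UNIV). (cmod (ell2_apply z p))\<^sup>2)"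
      by (subst infsum_reindex[OF inj]) (simp add: o_def case_prod_unfold)
    also have "\<dots> \<le> (norm z)\<^sup>2"
      unfolding norm_ell2_sq by (rule infsum_mono2) (auto intro: ell2_summable)
    finally show ?thesis .
  qed
  have "\<exists>w. ell2_apply w = (\<lambda>p. case inv c p of (i, j) \<Rightarrow> ell2_apply (bop_apply S (sl z j)) i)
            \<and> norm w \<le> norm S * norm z" for z
  proof (rule ell2_boundedI)
    fix F :: "'p set" assume F: "finite F"
    define G where "G = inv c ` F"
    have G: "finite G" "F = c ` G"
      using F c by (auto simp: G_def image_image bij_is_surj surj_f_inv_f)
    have "(\<Sum>p\<in>F. (cmod (case inv c p of (i, j) \<Rightarrow> ell2_apply (bop_apply S (sl z j)) i))\<^sup>2)
        = (\<Sum>(i, j)\<in>G. (cmod (ell2_apply (bop_apply S (sl z j)) i))\<^sup>2)"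
      unfolding G(2) using bij_is_inj[OF c]
      by (subst sum.reindex) (auto simp: inj_on_def case_prod_unfold inv_f_f intro!: sum.cong)
    also have "\<dots> \<le> (\<Sum>(i, j)\<in>fst ` G \<times> snd ` G. (cmod (ell2_apply (bop_apply S (sl z j)) i))\<^sup>2)"
      using G by (intro sum_mono2) force+
    also have "\<dots> = (\<Sum>j\<in>snd ` G. \<Sum>i\<in>fst ` G. (cmod (ell2_apply (bop_apply S (sl z j)) i))\<^sup>2)"
      by (subst sum.swap) (simp add: sum.cartesian_product)
    also have "\<dots> \<le> (\<Sum>j\<in>snd ` G. (norm (bop_apply S (sl z j)))\<^sup>2)"
      using G by (intro sum_mono sum_le_norm_ell2) auto
    also have "\<dots> \<le> (\<Sum>j\<in>snd ` G. (norm S)\<^sup>2 * (norm (sl z j))\<^sup>2)"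
      unfolding power_mult_distrib[symmetric] by (intro sum_mono power_mono norm_bop_apply) simp
    also have "\<dots> \<le> (norm S)\<^sup>2 * (norm z)\<^sup>2"
      unfolding sum_distrib_left[symmetric] using G by (intro mult_left_mono sl_norm) auto
    finally show "(\<Sum>p\<in>F. (cmod (case inv c p of (i, j) \<Rightarrow> ell2_apply (bop_apply S (sl z j)) i))\<^sup>2)
        \<le> (norm S * norm z)\<^sup>2"
      by (simp add: power_mult_distrib)
  qed simp
  then obtain f where f: "\<And>z. ell2_apply (f z) = (\<lambda>p. case inv c p of (i, j) \<Rightarrow> ell2_apply (bop_apply S (sl z j)) i)"
      "\<And>z. norm (f z) \<le> norm S * norm z"
    by metis
  have "\<exists>R. bop_apply R = f \<and> norm R \<le> norm S"
  proof (rule bop_exists)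
    show "f (x + y) = f x + f y" for x y
      by (rule ell2_eqI)
         (simp add: f(1) sl_lin case_prod_unfold linear_add[OF bounded_linear.linear[OF bounded_linear_bop_apply]])
    show "f (d *\<^sub>C x) = d *\<^sub>C f x" for d x
      by (rule ell2_eqI) (simp add: f(1) sl_lin case_prod_unfold bop_apply_scaleC)
  qed (use f in auto)
  then obtain R where "bop_apply R = f" by blast
  then have "ell2_apply (bop_apply R z) (c (i, j)) = ell2_apply (bop_apply S (sl z j)) i" for z i j
    using bij_is_inj[OF c] by (simp add: f(1) inv_f_f)
  then show ?thesis
    unfolding sl_def by blast
qed

lemma op_tensor_apply:
  "bop_apply (op_tensor S T) (tensor_ell2 x y) = tensor_ell2 (bop_apply S x) (bop_apply T y)"
proof -
  have ex: "\<exists>R. \<forall>x y. bop_apply R (tensor_ell2 x y) = tensor_ell2 (bop_apply S x) (bop_apply T y)"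
    for S :: "'i bop" and T :: "'j bop"
  proof -
    obtain L :: "('i \<times> 'j) bop" where L: "\<And>z i j. ell2_apply (bop_apply L z) (i, j) =
           ell2_apply (bop_apply S (Abs_ell2 (\<lambda>i. ell2_apply z (i, j)))) i"
      using amplification[of id S] by auto
    have "bij (prod.swap :: 'j \<times> 'i \<Rightarrow> 'i \<times> 'j)" by simp
    then obtain M :: "('i \<times> 'j) bop" where M: "\<And>z i j. ell2_apply (bop_apply M z) (i, j) =
           ell2_apply (bop_apply T (Abs_ell2 (\<lambda>j. ell2_apply z (i, j)))) j"
      using amplification[of "prod.swap :: 'j \<times> 'i \<Rightarrow> 'i \<times> 'j" T] by auto
    have abs: "Abs_ell2 (\<lambda>j. a * ell2_apply v j) = a *\<^sub>C v" for a and v :: "'k ell2"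
      by (metis ell2_apply_inverse ell2_apply_simps(6) ext)
    have abs': "Abs_ell2 (\<lambda>j. ell2_apply v j * a) = a *\<^sub>C v" for a and v :: "'k ell2"
      using abs[of a v] by (simp add: mult.commute)
    have "bop_apply (L * M) (tensor_ell2 x y) = tensor_ell2 (bop_apply S x) (bop_apply T y)" for x y
    proof -
      have 1: "bop_apply M (tensor_ell2 x y) = tensor_ell2 x (bop_apply T y)"
      proof (rule ell2_eqI)
        fix p show "ell2_apply (bop_apply M (tensor_ell2 x y)) p = ell2_apply (tensor_ell2 x (bop_apply T y)) p"
          by (cases p) (simp add: M tensor_ell2_apply abs bop_apply_scaleC)
      qed
      have 2: "bop_apply L (tensor_ell2 x y) = tensor_ell2 (bop_apply S x) y" for y
      proof (rule ell2_eqI)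
        fix p show "ell2_apply (bop_apply L (tensor_ell2 x y)) p = ell2_apply (tensor_ell2 (bop_apply S x) y) p"
          by (cases p) (simp add: L tensor_ell2_apply abs' bop_apply_scaleC)
      qed
      show ?thesis by (simp add: bop_apply_simps 1 2)
    qed
    then show ?thesis by blast
  qed
  have "\<exists>!R. \<forall>x y. bop_apply R (tensor_ell2 x y) = tensor_ell2 (bop_apply S x) (bop_apply T y)"
    using ex[of S T] by (rule ex_ex1I) (auto intro: bop_tensor_eqI)
  from theI'[OF this] show ?thesis
    unfolding op_tensor_def by blast
qed

definition assoc_ell2 :: "(('i \<times> 'j) \<times> 'k) ell2 \<Rightarrow> ('i \<times> ('j \<times> 'k)) ell2" where
  "assoc_ell2 x = Abs_ell2 (\<lambda>(i, (j, k)). ell2_apply x ((i, j), k))"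

lemma assoc_ell2_apply: "ell2_apply (assoc_ell2 x) (i, (j, k)) = ell2_apply x ((i, j), k)"
proof -
  have "inj (\<lambda>(i, (j, k)). ((i, j), k))" by (auto simp: inj_on_def)
  from summable_on_ell2_reindex[OF this, of x] show ?thesis
    unfolding assoc_ell2_def by (simp add: Abs_ell2_inverse case_prod_unfold)
qed

text \<open>Equality of operators under the identification of \<open>(H \<otimes> K) \<otimes> L\<close> with \<open>H \<otimes> (K \<otimes> L)\<close>.\<close>

definition assoc_eq :: "(('i \<times> 'j) \<times> 'k) bop \<Rightarrow> ('i \<times> ('j \<times> 'k)) bop \<Rightarrow> bool" where
  "assoc_eq R R' \<longleftrightarrow> (\<forall>x. assoc_ell2 (bop_apply R x) = bop_apply R' (assoc_ell2 x))"


section \<open>The minimal tensor product and compact quantum groups\<close>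

text \<open>
  Representations act on spaces \<^typ>\<open>'i ell2\<close>; by the choice of an orthonormal basis, every
  nonzero Hilbert space is of this form. The minimal tensor product of \<open>A\<close> and \<open>B\<close> is, as usual,
  the closure of the algebraic tensor product in \<open>B(H \<otimes> K)\<close>, where \<open>A\<close> and \<open>B\<close> are
  represented faithfully on \<open>H\<close> and \<open>K\<close> by \<open>\<pi>\<close> and \<open>\<rho>\<close>. Such representations exist by the
  Gelfand--Naimark theorem, and up to canonical isomorphism the result does not depend on them.
  They are carried along as parameters: \<open>a \<otimes> b\<close> is \<open>op_tensor (\<pi> a) (\<rho> b)\<close>. They need not be
  unital, so the unit is \<open>op_tensor (\<pi> 1) (\<rho> 1)\<close>.
\<close>

definition faithful_rep :: "('a::unital_cstar_algebra \<Rightarrow> 'i bop) \<Rightarrow> bool" where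
  "faithful_rep \<pi> \<longleftrightarrow> star_hom \<pi> \<and> inj \<pi>"

abbreviation cspan :: "'a::unital_cstar_algebra set \<Rightarrow> 'a set" where
  "cspan S \<equiv> csubspace hull S"

definition min_tensor ::
  "('a::unital_cstar_algebra \<Rightarrow> 'i bop) \<Rightarrow> ('b::unital_cstar_algebra \<Rightarrow> 'j bop) \<Rightarrow> ('i \<times> 'j) bop set" where
  "min_tensor \<pi> \<rho> = closure (cspan {op_tensor (\<pi> a) (\<rho> b) | a b. True})"

text \<open>
  For *-homomorphisms \<open>f : A \<rightarrow> C\<close> and \<open>g : B \<rightarrow> D\<close> into operator algebras, \<open>tensor_hom \<pi> \<rho> f g\<close> is
  \<open>f \<otimes> g : A \<otimes> B \<rightarrow> C \<otimes> D\<close>, the unique *-homomorphism mapping each \<open>a \<otimes> b\<close> to \<open>f a \<otimes> g b\<close>;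
  outside \<open>A \<otimes> B\<close> it is set to 0. The identity map of \<open>A\<close>, as a map into \<open>B(H)\<close>, is \<open>\<pi>\<close>.
\<close>

definition tensor_hom ::
  "('a::unital_cstar_algebra \<Rightarrow> 'i bop) \<Rightarrow> ('b::unital_cstar_algebra \<Rightarrow> 'j bop) \<Rightarrow>
   ('a \<Rightarrow> 'k bop) \<Rightarrow> ('b \<Rightarrow> 'l bop) \<Rightarrow> ('i \<times> 'j) bop \<Rightarrow> ('k \<times> 'l) bop" where
  "tensor_hom \<pi> \<rho> f g = (THE h.
     star_hom_on (min_tensor \<pi> \<rho>) h \<and>
     (\<forall>a b. h (op_tensor (\<pi> a) (\<rho> b)) = op_tensor (f a) (g b)) \<and>
     (\<forall>x. x \<notin> min_tensor \<pi> \<rho> \<longrightarrow> h x = 0))"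

definition comultiplication ::
  "('a::unital_cstar_algebra \<Rightarrow> 'i bop) \<Rightarrow> ('a \<Rightarrow> ('i \<times> 'i) bop) \<Rightarrow> bool" where
  "comultiplication \<pi> \<Phi> \<longleftrightarrow>
     star_hom \<Phi> \<and> range \<Phi> \<subseteq> min_tensor \<pi> \<pi> \<and> \<Phi> 1 = op_tensor (\<pi> 1) (\<pi> 1) \<and>
     (\<forall>a. assoc_eq (tensor_hom \<pi> \<pi> \<Phi> \<pi> (\<Phi> a)) (tensor_hom \<pi> \<pi> \<pi> \<Phi> (\<Phi> a)))"

definition compact_quantum_group ::
  "('a::unital_cstar_algebra \<Rightarrow> 'i bop) \<Rightarrow> ('a \<Rightarrow> ('i \<times> 'i) bop) \<Rightarrow> bool" where
  "compact_quantum_group \<pi> \<Phi> \<longleftrightarrow>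
     comultiplication \<pi> \<Phi> \<and>
     closure (cspan {\<Phi> a * op_tensor (\<pi> 1) (\<pi> b) | a b. True}) = min_tensor \<pi> \<pi> \<and>
     closure (cspan {\<Phi> a * op_tensor (\<pi> b) (\<pi> 1) | a b. True}) = min_tensor \<pi> \<pi>"

end

theory Submission
  imports Defs
begin

text \<open>
  If \<open>v\<close> inverts \<open>u\<close>, then \<open>\<Sum>\<^sub>k \<Phi>(u\<^sub>p\<^sub>k)(1 \<otimes> v\<^sub>k\<^sub>q) = u\<^sub>p\<^sub>q \<otimes> 1\<close>, and an inverse of the transpose gives
  the same for the adjoints \<open>u\<^sub>p\<^sub>q*\<close>. Elements \<open>a\<close> such that \<open>a \<otimes> 1\<close> and \<open>a* \<otimes> 1\<close> lie in the closure of
  \<open>\<Phi>(A)(1 \<otimes> A)\<close> form a C*-subalgebra, hence exhaust \<open>A\<close>; the other leg is symmetric.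
  Unitality of \<open>\<Phi>\<close> follows, since \<open>\<Phi>(1)\<close> acts as a unit on \<open>\<Phi>(A)(1 \<otimes> A)\<close>.
  Coassociativity is checked on the generators.

  The analytic part is the existence of \<open>\<Phi> \<otimes> \<iota>\<close> and \<open>\<iota> \<otimes> \<Phi>\<close> on the minimal tensor product.
  Compressing one leg to finitely many coordinates reduces the norm estimate to the contractivity of
  *-homomorphisms on matrices over \<open>A\<close>, which form a closed algebra because faithful
  representations are isometric. Both facts about *-homomorphisms are obtained without spectral
  theory: contractivity from the power series of \<open>sqrt (1 - t)\<close>, and isometry from the estimate
  \<open>\<parallel>p(a)\<parallel> \<le> sup \<bar>p\<bar>\<close> for polynomials of self-adjoint elements.
\<close>

section \<open>Unital C*-algebras\<close>

lemma scaleC_zero_left [simp]: "0 *\<^sub>C (x :: 'a::unital_cstar_algebra) = 0"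
  using scaleC_of_real[of 0 x] by simp

lemma scaleC_one [simp]: "1 *\<^sub>C (x :: 'a::unital_cstar_algebra) = x"
  using scaleC_of_real[of 1 x] by simp

lemma scaleC_zero_right [simp]: "c *\<^sub>C (0 :: 'a::unital_cstar_algebra) = 0"
  using scaleC_add_right[of c 0 "0::'a"] by simp

lemma scaleC_minus_left: "(- c) *\<^sub>C (x :: 'a::unital_cstar_algebra) = - (c *\<^sub>C x)"
  using scaleC_add_left[of c "- c" x] by (simp add: eq_neg_iff_add_eq_0 add.commute)

lemma scaleC_minus_right: "c *\<^sub>C (- x :: 'a::unital_cstar_algebra) = - (c *\<^sub>C x)"
  using scaleC_add_right[of c x "- x"] by (simp add: eq_neg_iff_add_eq_0 add.commute)

lemma scaleC_minus_one: "(- 1) *\<^sub>C (x :: 'a::unital_cstar_algebra) = - x"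
  by (simp add: scaleC_minus_left)

lemma scaleC_diff_right: "c *\<^sub>C (x - y :: 'a::unital_cstar_algebra) = c *\<^sub>C x - c *\<^sub>C y"
  using scaleC_add_right[of c x "- y"] by (simp add: scaleC_minus_right)

lemma scaleC_sum_right: "c *\<^sub>C (\<Sum>i\<in>I. x i :: 'a::unital_cstar_algebra) = (\<Sum>i\<in>I. c *\<^sub>C x i)"
  by (induction I rule: infinite_finite_induct) (auto simp: scaleC_add_right)

lemma bounded_linear_scaleC: "bounded_linear (\<lambda>x :: 'a::unital_cstar_algebra. c *\<^sub>C x)"
  by (rule bounded_linear_intro[where K = "cmod c"])
     (simp_all add: scaleC_add_right scaleC_of_real[symmetric] scaleC_scaleC norm_scaleC mult.commute)

lemma star_zero [simp]: "star (0 :: 'a::unital_cstar_algebra) = 0"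
  using star_add[of 0 "0::'a"] by simp

lemma star_minus: "star (- x :: 'a::unital_cstar_algebra) = - star x"
  using star_add[of x "- x"] by (simp add: eq_neg_iff_add_eq_0 add.commute)

lemma star_diff: "star (x - y :: 'a::unital_cstar_algebra) = star x - star y"
  using star_add[of x "- y"] by (simp add: star_minus)

lemma star_sum: "star (\<Sum>i\<in>I. x i :: 'a::unital_cstar_algebra) = (\<Sum>i\<in>I. star (x i))"
  by (induction I rule: infinite_finite_induct) (auto simp: star_add)

lemma star_scaleR: "star (r *\<^sub>R x :: 'a::unital_cstar_algebra) = r *\<^sub>R star x"
  by (simp add: scaleC_of_real[symmetric] star_scaleC)

lemma star_one [simp]: "star (1 :: 'a::unital_cstar_algebra) = 1"
  by (metis mult_1_left mult_1_right star_mult star_star)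

lemma star_power: "star (x ^ n :: 'a::unital_cstar_algebra) = star x ^ n"
  by (induction n) (auto simp: star_mult power_commutes)

lemma norm_star [simp]: "norm (star x :: 'a::unital_cstar_algebra) = norm x"
proof -
  have le: "norm y \<le> norm (star y)" for y :: 'a
  proof (cases "norm y = 0")
    case False
    have "norm y * norm y \<le> norm (star y) * norm y"
      using norm_mult_ineq[of "star y" y] by (simp add: cstar_identity power2_eq_square)
    then show ?thesis using False by (simp add: mult_le_cancel_right)
  qed simp
  from le[of x] le[of "star x"] show ?thesis by (simp add: star_star)
qed

lemma bounded_linear_star: "bounded_linear (star :: 'a::unital_cstar_algebra \<Rightarrow> 'a)"
  by (rule bounded_linear_intro[where K = 1]) (simp_all add: star_add star_scaleR)

text \<open>The C*-identity turns \<open>p * p = p\<close> into \<open>(norm p)^2 = norm p\<close>,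
  so the norm is 0 or 1.\<close>

lemma norm_projection_le_1:
  assumes "star p = p" "p * p = (p :: 'a::unital_cstar_algebra)"
  shows "norm p \<le> 1"
proof -
  have "(norm p)\<^sup>2 = norm p" using cstar_identity[of p] assms by simp
  then show ?thesis by (metis le_numeral_extra(4) mult_cancel_right2 norm_ge_zero power2_eq_square zero_le_one order.trans)
qed

text \<open>Here \<open>star x * x\<close> is a projection, and the C*-identity carries its norm
  bound over to x. Isometries and matrix units are the cases in use.\<close>

lemma norm_partial_isometry_le_1:
  assumes "star (star x * x * (star x * x)) = star x * x * (star x * x)" "star x * x * (star x * x) = star x * (x :: 'a::unital_cstar_algebra)"
  shows "norm x \<le> 1"
proof -
  have "norm (star x * x) \<le> 1"
    by (rule norm_projection_le_1) (use assms in \<open>auto simp: star_mult star_star\<close>)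
  then have "(norm x)\<^sup>2 \<le> 1\<^sup>2" by (simp add: cstar_identity)
  then show ?thesis by (rule power2_le_imp_le) simp
qed

text \<open>Only an inequality, because in the zero algebra the unit has norm 0.\<close>

lemma norm_one_le [simp]: "norm (1 :: 'a::unital_cstar_algebra) \<le> 1"
  by (rule norm_projection_le_1) auto

lemma norm_isometry_le_1: "star x * x = (1 :: 'a::unital_cstar_algebra) \<Longrightarrow> norm x \<le> 1"
  by (rule norm_partial_isometry_le_1) auto

lemma norm_power_le: "norm (x ^ n :: 'a::unital_cstar_algebra) \<le> norm x ^ n"
proof (induction n)
  case (Suc n)
  have "norm (x ^ Suc n) \<le> norm x * norm (x ^ n)" by (simp add: norm_mult_ineq)
  also have "\<dots> \<le> norm x * norm x ^ n" by (intro mult_left_mono Suc) simp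
  finally show ?case by simp
qed simp

lemma norm_power_le_1: "norm x \<le> 1 \<Longrightarrow> norm (x ^ n :: 'a::unital_cstar_algebra) \<le> 1"
  using norm_power_le[of x n] power_le_one[of "norm x" n] by simp

section \<open>Subspaces, C*-subalgebras and *-homomorphisms defined on them\<close>

lemma csubspaceD:
  assumes "csubspace S"
  shows "0 \<in> S" "x \<in> S \<Longrightarrow> y \<in> S \<Longrightarrow> x + y \<in> S" "x \<in> S \<Longrightarrow> c *\<^sub>C x \<in> S"
    "x \<in> S \<Longrightarrow> - x \<in> S" "x \<in> S \<Longrightarrow> y \<in> S \<Longrightarrow> x - y \<in> S" "x \<in> S \<Longrightarrow> r *\<^sub>R x \<in> S"
    "(\<And>i. i \<in> I \<Longrightarrow> f i \<in> S) \<Longrightarrow> sum f I \<in> S"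
proof -
  show 0: "0 \<in> S" and add: "x \<in> S \<Longrightarrow> y \<in> S \<Longrightarrow> x + y \<in> S" and sc: "x \<in> S \<Longrightarrow> c *\<^sub>C x \<in> S" for x y c
    using assms by (auto simp: csubspace_def)
  show mi: "x \<in> S \<Longrightarrow> - x \<in> S" for x using sc[of x "- 1"] by (simp add: scaleC_minus_one)
  show "x \<in> S \<Longrightarrow> y \<in> S \<Longrightarrow> x - y \<in> S" using add[of x "- y"] mi[of y] by simp
  show "x \<in> S \<Longrightarrow> r *\<^sub>R x \<in> S" using sc[of x "of_real r"] by (simp add: scaleC_of_real)
  show "(\<And>i. i \<in> I \<Longrightarrow> f i \<in> S) \<Longrightarrow> sum f I \<in> S"
    by (induction I rule: infinite_finite_induct) (auto intro: 0 add)
qed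

lemma cstar_subalgebraD:
  assumes "cstar_subalgebra S"
  shows "csubspace S" "x \<in> S \<Longrightarrow> y \<in> S \<Longrightarrow> x * y \<in> S" "x \<in> S \<Longrightarrow> star x \<in> S" "closed S"
  using assms by (auto simp: cstar_subalgebra_def)

lemma cstar_subalgebra_UNIV [simp]: "cstar_subalgebra UNIV"
  by (simp add: cstar_subalgebra_def csubspace_def)

text \<open>Exponents start at 1, since a C*-subalgebra need not contain the unit.\<close>

lemma cstar_subalgebra_power: "cstar_subalgebra D \<Longrightarrow> x \<in> D \<Longrightarrow> x ^ Suc n \<in> D"
  by (induction n) (auto intro: cstar_subalgebraD)

lemma star_hom_onD:
  assumes "star_hom_on S f"
  shows "x \<in> S \<Longrightarrow> y \<in> S \<Longrightarrow> f (x + y) = f x + f y" "x \<in> S \<Longrightarrow> f (c *\<^sub>C x) = c *\<^sub>C f x"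
    "x \<in> S \<Longrightarrow> y \<in> S \<Longrightarrow> f (x * y) = f x * f y" "x \<in> S \<Longrightarrow> f (star x) = star (f x)"
  using assms by (auto simp: star_hom_on_def)

lemma star_hom_on_linear:
  assumes "star_hom_on S f" "csubspace S"
  shows "f 0 = 0" "x \<in> S \<Longrightarrow> f (- x) = - f x" "x \<in> S \<Longrightarrow> y \<in> S \<Longrightarrow> f (x - y) = f x - f y"
    "x \<in> S \<Longrightarrow> f (r *\<^sub>R x) = r *\<^sub>R f x"
    "(\<And>i. i \<in> I \<Longrightarrow> g i \<in> S) \<Longrightarrow> f (sum g I) = (\<Sum>i\<in>I. f (g i))"
proof -
  note S = csubspaceD[OF assms(2)] and f = star_hom_onD[OF assms(1)]
  show 0: "f 0 = 0" using f(2)[of 0 0] S(1) by simp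
  show mi: "x \<in> S \<Longrightarrow> f (- x) = - f x" for x using f(2)[of x "- 1"] by (simp add: scaleC_minus_one)
  show "x \<in> S \<Longrightarrow> y \<in> S \<Longrightarrow> f (x - y) = f x - f y" using f(1)[of x "- y"] S(4) mi by simp
  show "x \<in> S \<Longrightarrow> f (r *\<^sub>R x) = r *\<^sub>R f x" using f(2)[of x "of_real r"] by (simp add: scaleC_of_real)
  show "(\<And>i. i \<in> I \<Longrightarrow> g i \<in> S) \<Longrightarrow> f (sum g I) = (\<Sum>i\<in>I. f (g i))"
    by (induction I rule: infinite_finite_induct) (auto simp: 0 f S)
qed

lemma csubspace_UNIV [simp]: "csubspace UNIV"
  by (simp add: csubspace_def)

lemmas star_homD = star_hom_onD[where S = UNIV, simplified]
lemmas star_hom_linear = star_hom_on_linear[where S = UNIV, simplified]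

section \<open>Square roots and contractivity of *-homomorphisms\<close>

text \<open>The Taylor coefficients of sqrt (1 - t) at t = 0.\<close>

definition sqrt_coeff :: "nat \<Rightarrow> real" where
  "sqrt_coeff n = (- 1) ^ n * ((1 / 2) gchoose n)"

lemma sqrt_coeff_0 [simp]: "sqrt_coeff 0 = 1"
  by (simp add: sqrt_coeff_def)

text \<open>Consecutive binomial coefficients differ by the factor (1/2 - n) / (n + 1), of modulus
  at most 1. This crude bound already gives absolute convergence for
  \<open>norm t < 1\<close>.\<close>

lemma abs_sqrt_coeff_le_1: "\<bar>sqrt_coeff n\<bar> \<le> 1"
proof (induction n)
  case (Suc n)
  have "((1 / 2 :: real) gchoose Suc n) = (1 / 2 gchoose n) * ((1 / 2 - n) / (n + 1))"
    using gbinomial_mult_1[of "1/2::real" n] by (simp add: field_simps)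
  moreover have "\<bar>(1 / 2 - real n) / (n + 1)\<bar> \<le> 1"
    by (simp add: field_simps abs_le_iff)
  ultimately have "\<bar>(1 / 2 :: real) gchoose Suc n\<bar> \<le> \<bar>(1 / 2 :: real) gchoose n\<bar> * 1"
    using mult_left_mono[of "\<bar>(1 / 2 - real n) / (n + 1)\<bar>" 1 "\<bar>(1 / 2 :: real) gchoose n\<bar>"]
    by (simp only: abs_mult abs_ge_zero)
  then show ?case
    using Suc by (simp add: sqrt_coeff_def abs_mult)
qed simp

text \<open>Vandermonde's identity for 1/2 + 1/2 = 1: the square of the series is 1 - t.\<close>

lemma sqrt_coeff_convolution:
  "(\<Sum>i\<le>n. sqrt_coeff i * sqrt_coeff (n - i)) = (if n = 0 then 1 else if n = 1 then - 1 else 0)"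
proof -
  have "(\<Sum>i\<le>n. sqrt_coeff i * sqrt_coeff (n - i)) =
      (- 1) ^ n * (\<Sum>i\<le>n. ((1 / 2) gchoose i) * ((1 / 2) gchoose (n - i)))"
    unfolding sum_distrib_left
    by (intro sum.cong) (auto simp: sqrt_coeff_def power_add[symmetric] mult_ac)
  also have "(\<Sum>i\<le>n. ((1 / 2 :: real) gchoose i) * ((1 / 2) gchoose (n - i))) = (1 gchoose n)"
    using gbinomial_Vandermonde[of "1/2::real" "1/2" n] by (simp add: atMost_atLeast0)
  also have "(1 :: real) gchoose n = of_nat (1 choose n)"
    using binomial_gbinomial[of 1 n, where 'a = real] by simp
  finally show ?thesis
    by (cases n) (auto simp: binomial_eq_0_iff)
qed

text \<open>z stands for 1 - sqrt (1 - t), and the equation is (1 - z)^2 = 1 - t written without the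
  unit. Since its power series has no constant term, z lies in every C*-subalgebra that contains t,
  unital or not.\<close>

lemma ex_sqrt_one_minus:
  fixes t :: "'a::unital_cstar_algebra"
  assumes t: "norm t < 1" "star t = t"
  shows "\<exists>z. star z = z \<and> t = 2 *\<^sub>R z - z * z \<and> (\<forall>D. cstar_subalgebra D \<longrightarrow> t \<in> D \<longrightarrow> z \<in> D)"
proof -
  define g where "g n = sqrt_coeff n *\<^sub>R t ^ n" for n
  have "norm (g n) \<le> norm t ^ n" for n
    using mult_mono[OF abs_sqrt_coeff_le_1[of n] norm_power_le[of t n]] by (simp add: g_def)
  then have sg: "summable (\<lambda>n. norm (g n))"
    by (intro summable_comparison_test[OF _ summable_geometric[of "norm t"]]) (use t in auto)
  define y where "y = suminf g"
  have gy: "g sums y" unfolding y_def using sg by (simp add: summable_norm_cancel summable_sums)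
  have conv: "(\<Sum>i\<le>n. g i * g (n - i)) = (if n = 0 then 1 else if n = 1 then - t else 0)" for n
  proof -
    have "(\<Sum>i\<le>n. g i * g (n - i)) = (\<Sum>i\<le>n. sqrt_coeff i * sqrt_coeff (n - i)) *\<^sub>R t ^ n"
      unfolding scaleR_sum_left by (intro sum.cong) (auto simp: g_def power_add[symmetric])
    then show ?thesis unfolding sqrt_coeff_convolution by auto
  qed
  have "(\<lambda>n. if n = 0 then 1 else if n = 1 then - t else 0) sums (y * y)"
    using Cauchy_product_sums[OF sg sg] by (simp add: conv y_def)
  moreover have "(\<lambda>n. if n = 0 then 1 else if n = 1 then - t else 0) sums (\<Sum>n\<in>{0, 1::nat}. if n = 0 then 1 else if n = 1 then - t else (0::'a))"
    by (rule sums_finite) auto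
  ultimately have "y * y = (\<Sum>n\<in>{0, 1::nat}. if n = 0 then 1 else if n = 1 then - t else (0::'a))"
    by (rule sums_unique2)
  then have yy: "y * y = 1 - t" by simp
  have "(\<lambda>n. star (g n)) sums star y"
    by (rule bounded_linear.sums[OF bounded_linear_star gy])
  moreover have "star (g n) = g n" for n by (simp add: g_def star_scaleR star_power t)
  ultimately have "g sums star y" by simp
  then have sy: "star y = y" by (rule sums_unique2[OF _ gy])
  have "(1 - y) \<in> D" if D: "cstar_subalgebra D" "t \<in> D" for D
  proof -
    \<comment> \<open>Without the constant term 1 the partial sums involve only positive powers of
      t, so they stay in D.\<close>
    have "(\<lambda>n. g (Suc n)) sums (y - g 0)"
      using gy by (simp add: sums_Suc_iff)
    then have lim: "(\<lambda>N. \<Sum>n<N. g (Suc n)) \<longlonglongrightarrow> y - 1"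
      by (simp add: sums_def g_def)
    have "y - 1 \<in> D"
    proof (rule closed_sequentially[OF cstar_subalgebraD(4)[OF D(1)] _ lim])
      show "(\<Sum>n<N. g (Suc n)) \<in> D" for N
        unfolding g_def using cstar_subalgebraD(1)[OF D(1)] cstar_subalgebra_power[OF D]
        by (intro csubspaceD(7) csubspaceD(6))
    qed
    then have "- (y - 1) \<in> D" by (rule csubspaceD(4)[OF cstar_subalgebraD(1)[OF D(1)]])
    then show ?thesis by simp
  qed
  moreover have "t = 2 *\<^sub>R (1 - y) - (1 - y) * (1 - y)"
    by (simp add: algebra_simps yy scaleR_2)
  ultimately show ?thesis
    by (intro exI[of _ "1 - y"]) (simp add: star_diff sy)
qed

text \<open>Combined with the last clause of \<open>ex_sqrt_one_minus\<close>, this shows that z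
  commutes with a. Closure under adjoints comes from applying \<open>star\<close> to
  \<open>a * z = z * a\<close>, with a self-adjoint.\<close>

lemma cstar_subalgebra_commutant:
  assumes "star a = (a :: 'a::unital_cstar_algebra)"
  shows "cstar_subalgebra {z. a * z = z * a}"
  unfolding cstar_subalgebra_def csubspace_def
proof (intro conjI ballI allI)
  show "closed {z. a * z = z * a}"
    by (intro closed_Collect_eq continuous_intros)
qed (use assms in \<open>auto simp: algebra_simps mult_scaleC_left mult_scaleC_right\<close>,
     (metis mult.assoc star_mult star_star)+)

text \<open>\<open>y + i z\<close> is an isometry with real part \<open>y\<close>.\<close>

lemma norm_le_1_of_squares:
  assumes "star y = y" "star z = z" "y * z = z * y" "y * y + z * z = (1 :: 'a::unital_cstar_algebra)"
  shows "norm y \<le> 1"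
proof -
  define w where "w = y + \<i> *\<^sub>C z"
  have sw: "star w = y - \<i> *\<^sub>C z"
    by (simp add: w_def star_add star_scaleC assms scaleC_minus_left)
  have "star w * w = y * y + z * z"
    unfolding sw unfolding w_def
    by (simp add: distrib_left left_diff_distrib mult_scaleC_left mult_scaleC_right scaleC_scaleC scaleC_diff_right assms(3) scaleC_minus_one)
  then have w: "norm w \<le> 1" using assms by (intro norm_isometry_le_1) simp
  have "2 *\<^sub>R y = w + star w" unfolding sw by (simp add: w_def scaleR_2)
  then have "2 * norm y = norm (w + star w)" by (metis norm_scaleR abs_numeral)
  also have "\<dots> \<le> 1 + 1" by (rule norm_triangle_mono) (use w in auto)
  finally show ?thesis by simp
qed

text \<open>For self-adjoint x of norm below 1, write x^2 = 2z - z^2. F preserves this unit-free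
  equation even if F is not unital, so F x and 1 - F z are commuting self-adjoint elements whose
  squares add up to 1. Scaling and the C*-identity extend the bound to all x.\<close>

lemma star_hom_on_norm_le:
  fixes F :: "'a::unital_cstar_algebra \<Rightarrow> 'b::unital_cstar_algebra"
  assumes D: "cstar_subalgebra D" and F: "star_hom_on D F" and x: "x \<in> D"
  shows "norm (F x) \<le> norm x"
proof -
  note Da = cstar_subalgebraD[OF D] and Fh = star_hom_onD[OF F] star_hom_on_linear[OF F cstar_subalgebraD(1)[OF D]]
  note Ds = csubspaceD[OF Da(1)]
  have 1: "norm (F x) \<le> 1" if x: "x \<in> D" "star x = x" "norm x < 1" for x
  proof -
    have "norm (x * x) < 1"
      using cstar_identity[of x] x by (simp add: power_less_one_iff abs_square_less_1)
    then obtain z where z: "star z = z" "x * x = 2 *\<^sub>R z - z * z"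
        and zD: "\<And>E. cstar_subalgebra E \<Longrightarrow> x * x \<in> E \<Longrightarrow> z \<in> E"
      using ex_sqrt_one_minus[of "x * x"] x by (auto simp: star_mult)
    have zD': "z \<in> D" by (rule zD) (use x D Da in auto)
    have "z \<in> {z. x * z = z * x}"
      by (rule zD) (use cstar_subalgebra_commutant[OF x(2)] in \<open>auto simp: mult.assoc\<close>)
    then have "F (x * z) = F (z * x)" by simp
    then have comm: "F x * F z = F z * F x" using x zD' by (simp add: Fh)
    have "F (x * x) = F (2 *\<^sub>R z - z * z)" by (simp add: z)
    then have "F x * F x = 2 *\<^sub>R F z - F z * F z"
      using x zD' Da Ds by (simp add: Fh)
    then have "F x * F x + (1 - F z) * (1 - F z) = 1"
      by (simp add: algebra_simps scaleR_2)
    moreover have "star (F x) = F x" "star (F z) = F z" using Fh(4) x zD' z by metis+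
    ultimately show ?thesis
      by (intro norm_le_1_of_squares[of _ "1 - F z"]) (auto simp: algebra_simps comm star_diff)
  qed
  have 2: "norm (F x) \<le> norm x" if x: "x \<in> D" "star x = x" for x
  proof (rule dense_ge)
    fix r assume r: "norm x < r"
    then have r0: "r > 0" using norm_ge_zero[of x] by linarith
    have "norm (F ((1 / r) *\<^sub>R x)) \<le> 1"
      by (rule 1) (use x r r0 Ds in \<open>auto simp: star_scaleR field_simps\<close>)
    then show "norm (F x) \<le> r" using x r0 by (simp add: Fh field_simps)
  qed
  have "(norm (F x))\<^sup>2 = norm (F (star x * x))" using x Da by (simp add: Fh cstar_identity)
  also have "\<dots> \<le> norm (star x * x)" by (rule 2) (use x Da in \<open>auto simp: star_mult star_star\<close>)
  also have "\<dots> = (norm x)\<^sup>2" by (rule cstar_identity)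
  finally show ?thesis by (rule power2_le_imp_le) simp
qed

lemma star_hom_bounded_linear:
  fixes f :: "'a::unital_cstar_algebra \<Rightarrow> 'b::unital_cstar_algebra"
  assumes "star_hom f"
  shows "bounded_linear f"
  by (rule bounded_linear_intro[where K = 1])
     (use star_hom_on_norm_le[OF cstar_subalgebra_UNIV assms] in \<open>auto simp: star_homD[OF assms] star_hom_linear[OF assms]\<close>)

section \<open>Polynomials of a self-adjoint element\<close>

definition ceval :: "complex poly \<Rightarrow> 'a::unital_cstar_algebra \<Rightarrow> 'a" where
  "ceval p a = fold_coeffs (\<lambda>c x. c *\<^sub>C 1 + a * x) p 0"

lemma ceval_0 [simp]: "ceval 0 a = 0"
  by (simp add: ceval_def)

lemma ceval_pCons [simp]: "ceval (pCons c p) a = c *\<^sub>C 1 + a * ceval p a"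
  by (cases "p = 0 \<and> c = 0") (auto simp: ceval_def)

lemma ceval_1 [simp]: "ceval 1 a = 1"
  by (simp add: one_pCons)

lemma ceval_add: "ceval (p + q) a = ceval p a + ceval q a"
proof (induction p arbitrary: q)
  case (pCons c p)
  then show ?case by (cases q) (simp add: scaleC_add_left algebra_simps)
qed simp

lemma ceval_smult: "ceval (smult c p) a = c *\<^sub>C ceval p a"
  by (induction p) (auto simp: scaleC_add_right scaleC_scaleC mult_scaleC_right)

lemma ceval_diff: "ceval (p - q) a = ceval p a - ceval q a"
  using ceval_add[of p "- q" a] ceval_smult[of "- 1" q a] by (simp add: scaleC_minus_one)

lemma ceval_mult: "ceval (p * q) a = ceval p a * ceval q a"
  by (induction p) (auto simp: ceval_add ceval_smult mult_scaleC_left algebra_simps)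

lemma ceval_power: "ceval (p ^ n) a = ceval p a ^ n"
  by (induction n) (auto simp: ceval_mult)

lemma ceval_pcompose: "ceval (pcompose p q) a = ceval p (ceval q a)"
  by (induction p) (auto simp: pcompose_pCons ceval_add ceval_mult)

lemma ceval_monom: "ceval (monom c n) a = c *\<^sub>C a ^ n"
  by (induction n) (auto simp: monom_0 monom_Suc mult_scaleC_right)

lemma ceval_eq_sum: "degree p \<le> n \<Longrightarrow> ceval p a = (\<Sum>i\<le>n. coeff p i *\<^sub>C a ^ i)"
proof (induction p arbitrary: n)
  case (pCons c p)
  show ?case
  proof (cases n)
    case 0
    then have "p = 0" using pCons.prems by (auto split: if_splits)
    then show ?thesis using 0 by simp
  next
    case (Suc m)
    then have "degree p \<le> m" using pCons.prems by (auto split: if_splits)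
    from pCons.IH[OF this] show ?thesis
      unfolding Suc sum.atMost_Suc_shift
      by (simp add: sum_distrib_left mult_scaleC_right)
  qed
qed simp

lemma ceval_commute: "a * b = b * a \<Longrightarrow> ceval p a * b = b * ceval p a"
proof (induction p)
  case (pCons c p)
  then have "a * (ceval p a * b) = b * (a * ceval p a)"
    by (metis mult.assoc)
  then show ?case
    by (simp add: distrib_left distrib_right mult_scaleC_left mult_scaleC_right mult.assoc)
qed simp

lemma star_ceval:
  assumes "star a = (a :: 'a::unital_cstar_algebra)" "\<And>i. coeff p i \<in> \<real>"
  shows "star (ceval p a) = ceval p a"
  using assms(2)
proof (induction p)
  case (pCons c p)
  have "coeff p i \<in> \<real>" for i using pCons.prems[of "Suc i"] by simp
  moreover have "cnj c = c" using pCons.prems[of 0] by (simp add: Reals_cnj_iff)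
  ultimately show ?case
    using pCons.IH ceval_commute[of a a p] by (simp add: star_add star_scaleC star_mult assms(1))
qed simp

text \<open>The extra factor a turns the constant term into a multiple of a, so f need not preserve
  the unit.\<close>

lemma star_hom_ceval:
  assumes "star_hom f"
  shows "f (a * ceval p a) = f a * ceval p (f a)"
  by (induction p)
     (auto simp: star_homD[OF assms] star_hom_linear[OF assms] distrib_left mult_scaleC_right)

section \<open>Coefficient bounds and unitary dilation\<close>

lemma sum_roots_of_unity:
  assumes "0 < L" "\<not> int L dvd m"
  shows "(\<Sum>j<L. cis (2 * pi * real j * real_of_int m / real L)) = 0"
proof -
  define x where "x = cis (2 * pi * real_of_int m / real L)"
  have "x \<noteq> 1"
  proof
    assume "x = 1"
    then have "cos (2 * pi * real_of_int m / real L) = 1"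
      by (metis x_def cis.sel(1) one_complex.sel(1))
    then obtain k :: int where "2 * pi * real_of_int m / real L = real_of_int k * 2 * pi"
      using cos_one_2pi_int by auto
    then have "real_of_int m = real_of_int (k * int L)" using assms(1) by (simp add: field_simps)
    then have "m = k * int L" by linarith
    then show False using assms(2) by simp
  qed
  moreover have "x ^ L = 1"
    using assms(1) unfolding x_def Complex.DeMoivre by (simp add: cis_multiple_2pi)
  moreover have "cis (2 * pi * real j * real_of_int m / real L) = x ^ j" for j
    by (simp add: x_def Complex.DeMoivre mult_ac)
  ultimately show ?thesis by (simp add: geometric_sum)
qed

text \<open>The coefficients are recovered from the values at the roots of unity.\<close>

lemma cmod_coeff_le:
  assumes deg: "degree p \<le> n" and M: "\<And>z. cmod z = 1 \<Longrightarrow> cmod (poly p z) \<le> M"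
  shows "cmod (coeff p k) \<le> M"
proof (cases "k \<le> n")
  case False
  then have "coeff p k = 0" using deg by (intro coeff_eq_0) simp
  moreover have "0 \<le> M" using M[of 1] norm_ge_zero by (metis norm_one order.trans)
  ultimately show ?thesis by simp
next
  case True
  \<comment> \<open>With n + 1 roots of unity, the exponents i, k \<le> n are separated: L divides i
    - k only if i = k.\<close>
  define L where "L = Suc n"
  define \<zeta> where "\<zeta> j = cis (2 * pi * real j / real L)" for j
  have orth: "(\<Sum>j<L. \<zeta> j ^ i * cnj (\<zeta> j) ^ k) = (if i = k then of_nat L else 0)" if "i \<le> n" for i
  proof -
    have "\<zeta> j ^ i * cnj (\<zeta> j) ^ k = cis (2 * pi * real j * real_of_int (int i - int k) / real L)" for j
      by (simp add: \<zeta>_def Complex.DeMoivre cis_cnj cis_mult algebra_simps diff_divide_distrib)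
    moreover have "int L dvd int i - int k \<longleftrightarrow> i = k"
      using that True zdvd_imp_le[of "int L" "int i - int k"] zdvd_imp_le[of "int L" "int k - int i"]
      by (cases i k rule: linorder_cases) (auto simp: L_def dvd_diff_commute)
    ultimately show ?thesis
      using sum_roots_of_unity[of L "int i - int k"] by (auto simp: L_def)
  qed
  have "(\<Sum>j<L. poly p (\<zeta> j) * cnj (\<zeta> j) ^ k) = (\<Sum>j<L. \<Sum>i\<le>n. coeff p i * (\<zeta> j ^ i * cnj (\<zeta> j) ^ k))"
    by (subst poly_as_sum_of_monoms'[OF deg, symmetric])
       (simp add: poly_sum poly_monom sum_distrib_right mult.assoc)
  also have "\<dots> = (\<Sum>i\<le>n. coeff p i * (\<Sum>j<L. \<zeta> j ^ i * cnj (\<zeta> j) ^ k))"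
    by (subst sum.swap) (simp add: sum_distrib_left)
  also have "\<dots> = (\<Sum>i\<le>n. if i = k then coeff p i * of_nat L else 0)"
    by (intro sum.cong) (auto simp: orth)
  also have "\<dots> = coeff p k * of_nat L" using True by simp
  finally have eq: "coeff p k * of_nat L = (\<Sum>j<L. poly p (\<zeta> j) * cnj (\<zeta> j) ^ k)" ..
  have "cmod (coeff p k) * L = cmod (\<Sum>j<L. poly p (\<zeta> j) * cnj (\<zeta> j) ^ k)"
    unfolding eq[symmetric] by (simp add: norm_mult)
  also have "\<dots> \<le> (\<Sum>j<L. M)"
    by (rule order.trans[OF norm_sum sum_mono])
       (auto simp: norm_mult norm_power \<zeta>_def intro: M)
  finally show ?thesis by (simp add: L_def mult.commute)
qed

text \<open>A self-adjoint contraction is the real part of the unitary \<open>a + i sqrt (1 - a\<^sup>2)\<close>.\<close>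

lemma ex_unitary_dilation:
  fixes a :: "'a::unital_cstar_algebra"
  assumes a: "star a = a" "norm a < 1"
  shows "\<exists>w. star w * w = 1 \<and> w * star w = 1 \<and> w * a = (1/2) *\<^sub>R (w * w + 1) \<and> a * w = w * a"
proof -
  have "norm (a * a) < 1"
    using cstar_identity[of a] a by (simp add: power_less_one_iff abs_square_less_1)
  then obtain z where z: "star z = z" "a * a = 2 *\<^sub>R z - z * z"
      and zD: "\<And>E. cstar_subalgebra E \<Longrightarrow> a * a \<in> E \<Longrightarrow> z \<in> E"
    using ex_sqrt_one_minus[of "a * a"] a by (auto simp: star_mult)
  have "z \<in> {z. a * z = z * a}"
    by (rule zD) (use cstar_subalgebra_commutant[OF a(1)] in \<open>auto simp: mult.assoc\<close>)
  then have az: "a * z = z * a" by simp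
  define y where "y = 1 - z"
  have y: "star y = y" "a * y = y * a" "a * a + y * y = 1"
    using z az by (auto simp: y_def star_diff algebra_simps scaleR_2)
  define w where "w = a + \<i> *\<^sub>C y"
  have sw: "star w = a - \<i> *\<^sub>C y"
    by (simp add: w_def star_add star_scaleC a y scaleC_minus_left)
  have 1: "star w * w = 1" "w * star w = 1"
    unfolding sw unfolding w_def
    using y(3)
    by (simp_all add: algebra_simps mult_scaleC_left mult_scaleC_right scaleC_scaleC scaleC_diff_right
          scaleC_add_right y(2) scaleC_minus_one)
  have "2 *\<^sub>R a = w + star w" unfolding sw by (simp add: w_def scaleR_2)
  then have "2 *\<^sub>R (w * a) = w * w + 1"
    by (metis 1(2) distrib_left mult_scaleR_right)
  then have "w * a = (1/2) *\<^sub>R (w * w + 1)"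
    by (metis divide_self_if scaleR_one scaleR_scaleR times_divide_eq_left mult_1 zero_neq_numeral)
  moreover have "a * w = w * a"
    by (simp add: w_def algebra_simps mult_scaleC_left mult_scaleC_right y)
  ultimately show ?thesis using 1 by blast
qed

text \<open>On the unit circle z Re z = (z^2 + 1) / 2, and w and a satisfy the same relation.
  Multiplying p(a) by w^n therefore gives a polynomial in w, whose modulus at a point z of the
  circle is that of p at Re z.\<close>

lemma ex_homogenized_poly:
  fixes a w :: "'a::unital_cstar_algebra"
  assumes w: "w * a = (1/2) *\<^sub>R (w * w + 1)" "a * w = w * a"
  shows "degree p \<le> n \<Longrightarrow> \<exists>q. degree q \<le> 2 * n \<and> ceval q w = w ^ n * ceval p a \<and>
    (\<forall>z. cmod z = 1 \<longrightarrow> poly q z = z ^ n * poly p (of_real (Re z)))"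
proof (induction p arbitrary: n)
  case 0
  then show ?case by (intro exI[of _ 0]) simp
next
  case (pCons c p)
  show ?case
  proof (cases "p = 0")
    case True
    then show ?thesis
      by (intro exI[of _ "monom c n"])
         (auto simp: ceval_monom mult_scaleC_right poly_monom degree_monom_eq intro: order.trans[OF degree_monom_le])
  next
    case False
    then obtain m where m: "n = Suc m" "degree p \<le> m"
      using pCons.prems by (cases n) auto
    from pCons.IH[OF m(2)] obtain q where q: "degree q \<le> 2 * m" "ceval q w = w ^ m * ceval p a"
      "\<And>z. cmod z = 1 \<Longrightarrow> poly q z = z ^ m * poly p (of_real (Re z))" by blast
    \<comment> \<open>One of the n = m + 1 factors w absorbs the a of Horner's scheme through
      \<open>w * a = (1/2) *\<^sub>R (w * w + 1)\<close>; the other m go into q.\<close>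
    define r where "r = monom c n + [:1/2, 0, 1/2:] * q"
    have "degree r \<le> 2 * n"
    proof -
      have "degree ([:1/2, 0, 1/2:] * q) \<le> 2 + degree q"
        by (rule order.trans[OF degree_mult_le]) simp
      then show ?thesis unfolding r_def
        using q(1) m by (intro degree_add_le) (auto intro: order.trans[OF degree_monom_le])
    qed
    moreover have "ceval r w = w ^ n * ceval (pCons c p) a"
    proof -
      have half: "ceval [:1/2, 0, 1/2:] w = w * a"
        unfolding w(1) by (simp add: mult_scaleC_right scaleC_of_real[symmetric] scaleC_add_right)
      have "a * w ^ m = w ^ m * a" by (rule power_commuting_commutes[OF w(2)[symmetric], symmetric])
      then have "w * a * (w ^ m * ceval p a) = w ^ Suc m * (a * ceval p a)"
        by (metis mult.assoc power_Suc)
      then have "ceval r w = c *\<^sub>C w ^ n + w ^ Suc m * (a * ceval p a)"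
        by (simp only: r_def ceval_add ceval_mult ceval_monom half q(2))
      then show ?thesis by (simp add: m(1) distrib_left mult_scaleC_right)
    qed
    moreover have "poly r z = z ^ n * poly (pCons c p) (of_real (Re z))" if z: "cmod z = 1" for z
    proof -
      have "z * cnj z = 1" using z complex_norm_square[of z] by simp
      then have "z * of_real (Re z) = (1 + z * z) / 2"
        by (simp add: complex_eq_iff)
      then have half: "poly [:1/2, 0, 1/2:] z = z * of_real (Re z)" by (simp add: field_simps)
      have "poly r z = c * z ^ n + z * of_real (Re z) * (z ^ m * poly p (of_real (Re z)))"
        by (simp only: r_def poly_add poly_mult poly_monom half q(3)[OF z])
      then show ?thesis by (simp add: m(1) algebra_simps)
    qed
    ultimately show ?thesis by blast
  qed
qed

lemma norm_ceval_le_degree: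
  fixes a :: "'a::unital_cstar_algebra"
  assumes a: "star a = a" "norm a < 1" and deg: "degree p \<le> n"
    and M: "\<And>t. \<bar>t\<bar> \<le> 1 \<Longrightarrow> cmod (poly p (of_real t)) \<le> M"
  shows "norm (ceval p a) \<le> (2 * real n + 1) * M"
proof -
  obtain w where w: "star w * w = 1" "w * star w = 1" "w * a = (1/2) *\<^sub>R (w * w + 1)" "a * w = w * a"
    using ex_unitary_dilation[OF a] by blast
  obtain q where q: "degree q \<le> 2 * n" "ceval q w = w ^ n * ceval p a"
      "\<And>z. cmod z = 1 \<Longrightarrow> poly q z = z ^ n * poly p (of_real (Re z))"
    using ex_homogenized_poly[OF w(3,4) deg] by blast
  have c: "cmod (coeff q k) \<le> M" for k
  proof (rule cmod_coeff_le[OF q(1)])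
    fix z assume z: "cmod z = 1"
    then show "cmod (poly q z) \<le> M"
      using M[of "Re z"] abs_Re_le_cmod[of z] by (simp add: q(3) norm_mult norm_power)
  qed
  have w1: "norm w \<le> 1" by (rule norm_isometry_le_1[OF w(1)])
  have "star w ^ n * w ^ n = 1"
  proof (induction n)
    case (Suc n)
    have "star w ^ Suc n * w ^ Suc n = star w ^ n * (star w * w) * w ^ n"
      by (simp add: power_commutes mult.assoc) (metis mult.assoc power_commutes)
    then show ?case using Suc by (simp add: w)
  qed simp
  then have "ceval p a = star w ^ n * ceval q w"
    by (simp add: q(2) mult.assoc[symmetric])
  then have "norm (ceval p a) \<le> norm (star w ^ n) * norm (ceval q w)"
    by (simp add: norm_mult_ineq)
  also have "\<dots> \<le> 1 * norm (ceval q w)"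
    by (intro mult_right_mono norm_power_le_1) (use w1 in auto)
  also have "norm (ceval q w) \<le> (\<Sum>i\<le>2*n. M)"
    unfolding ceval_eq_sum[OF q(1)]
  proof (rule order.trans[OF norm_sum sum_mono])
    fix i
    have "norm (coeff q i *\<^sub>C w ^ i) \<le> M * 1"
      unfolding norm_scaleC by (intro mult_mono c norm_power_le_1 w1) (use c[of i] norm_ge_zero order.trans in \<open>blast+\<close>)
    then show "norm (coeff q i *\<^sub>C w ^ i) \<le> M" by simp
  qed
  finally show ?thesis by (simp add: algebra_simps)
qed

text \<open>The C*-identity doubles the exponent at each step. Powers of two suffice, as only
  arbitrarily large exponents are required.\<close>

lemma norm_self_adjoint_power2:
  fixes y :: "'a::unital_cstar_algebra"
  assumes "star y = y"
  shows "norm (y ^ (2 ^ k)) = norm y ^ (2 ^ k)"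
proof (induction k)
  case (Suc k)
  have "norm (y ^ (2 ^ Suc k)) = norm (star (y ^ 2 ^ k) * y ^ 2 ^ k)"
    by (simp add: star_power assms power_add[symmetric] mult_2)
  also have "\<dots> = (norm y ^ 2 ^ k)\<^sup>2" by (simp add: cstar_identity Suc)
  also have "\<dots> = norm y ^ (2 ^ Suc k)" by (simp add: power_mult[symmetric] mult.commute)
  finally show ?case .
qed simp

text \<open>The factor that depends on the degree disappears when the estimate is applied to powers of the polynomial.\<close>

lemma norm_ceval_le_1:
  fixes a :: "'a::unital_cstar_algebra"
  assumes a: "star a = a" "norm a < 1" and real: "\<And>i. coeff p i \<in> \<real>"
    and M: "\<And>t. \<bar>t\<bar> \<le> 1 \<Longrightarrow> cmod (poly p (of_real t)) \<le> M"
  shows "norm (ceval p a) \<le> M"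
proof (rule ccontr)
  assume "\<not> norm (ceval p a) \<le> M"
  moreover have M0: "0 \<le> M" using order.trans[OF norm_ge_zero M[of 0]] by simp
  moreover define y where "y = ceval p a"
  ultimately have My: "M < norm y" by simp
  with M0 have y0: "0 < norm y" by linarith
  define N where "N = degree p"
  define r where "r = M / norm y"
  have r: "0 \<le> r" "r < 1" using My y0 M0 by (auto simp: r_def)
  \<comment> \<open>Dividing the estimate for \<open>p ^ m\<close> by \<open>norm y ^ m\<close>
    leaves a linear factor in m times \<open>r ^ m\<close>, which tends to 0 and so cannot stay
    above 1.\<close>
  have ge: "1 \<le> (2 * real (m * N) + 1) * r ^ m" if m: "m = 2 ^ k" for m k
  proof -
    have "norm (ceval (p ^ m) a) \<le> (2 * real (m * N) + 1) * M ^ m"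
    proof (rule norm_ceval_le_degree[OF a])
      show "degree (p ^ m) \<le> m * N" unfolding N_def using degree_power_le[of p m] by (simp add: mult.commute)
      show "cmod (poly (p ^ m) (of_real t)) \<le> M ^ m" if "\<bar>t\<bar> \<le> 1" for t
        by (simp add: norm_power poly_power power_mono M that)
    qed
    also have "norm (ceval (p ^ m) a) = norm y ^ m"
      unfolding m ceval_power y_def by (intro norm_self_adjoint_power2 star_ceval a real)
    finally show ?thesis using y0 by (simp add: r_def power_divide field_simps)
  qed
  have "(\<lambda>m. of_nat m * r ^ m) \<longlonglongrightarrow> 0" by (rule powser_times_n_limit_0) (use r in auto)
  moreover have "(\<lambda>m. r ^ m) \<longlonglongrightarrow> 0" by (rule LIMSEQ_realpow_zero) (use r in auto)
  ultimately have "(\<lambda>m. (2 * real N) * (of_nat m * r ^ m) + r ^ m) \<longlonglongrightarrow> (2 * real N) * 0 + 0"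
    by (intro tendsto_add tendsto_mult_left)
  then have "(\<lambda>m. (2 * real (m * N) + 1) * r ^ m) \<longlonglongrightarrow> 0" by (simp add: algebra_simps)
  then have "\<forall>\<^sub>F m in sequentially. (2 * real (m * N) + 1) * r ^ m < 1"
    by (rule order_tendstoD) simp
  then obtain m0 where "\<forall>m\<ge>m0. (2 * real (m * N) + 1) * r ^ m < 1"
    unfolding eventually_sequentially by blast
  moreover have "2 ^ m0 \<ge> m0" by (simp add: less_imp_le)
  ultimately show False using ge[of "2 ^ m0" m0] by fastforce
qed

lemma norm_ceval_le:
  fixes a :: "'a::unital_cstar_algebra"
  assumes a: "star a = a" "norm a < r" and real: "\<And>i. coeff p i \<in> \<real>"
    and M: "\<And>t. \<bar>t\<bar> \<le> r \<Longrightarrow> cmod (poly p (of_real t)) \<le> M"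
  shows "norm (ceval p a) \<le> M"
proof -
  have r: "r > 0" using a norm_ge_zero[of a] by linarith
  define q where "q = pcompose p [:0, of_real r:]"
  have "norm (ceval q ((1/r) *\<^sub>R a)) \<le> M"
  proof (rule norm_ceval_le_1)
    show "cmod (poly q (of_real t)) \<le> M" if "\<bar>t\<bar> \<le> 1" for t
    proof -
      have "\<bar>r * t\<bar> \<le> r" using that r by (simp add: abs_mult mult_left_le)
      from M[OF this] show ?thesis by (simp add: q_def poly_pcompose mult.commute)
    qed
    show "coeff q i \<in> \<real>" for i
      unfolding q_def coeff_pcompose_linear using real by (auto intro: Reals_mult Reals_power)
  qed (use a r in \<open>auto simp: star_scaleR field_simps\<close>)
  also have "ceval q ((1/r) *\<^sub>R a) = ceval p a"
    unfolding q_def ceval_pcompose using r by (simp add: scaleC_of_real mult_scaleC_right)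
  finally show ?thesis .
qed

text \<open>If \<open>\<parallel>f a\<parallel> < s < \<parallel>a\<parallel>\<close>, truncating the spectrum of \<open>a\<close> at \<open>s\<close> gives an element
  that \<open>f\<close> does not distinguish from \<open>a\<close>. The approximating polynomials have no constant term
  because \<open>f\<close> need not be unital.\<close>

lemma inj_star_hom_norm:
  fixes f :: "'a::unital_cstar_algebra \<Rightarrow> 'b::unital_cstar_algebra"
  assumes f: "star_hom f" and inj: "inj f"
  shows "norm (f x) = norm x"
proof -
  note fh = star_homD[OF f] star_hom_linear[OF f]
  note fle = star_hom_on_norm_le[OF cstar_subalgebra_UNIV f, simplified]
  have 1: "norm a \<le> norm (f a)" if sa: "star a = a" and a1: "norm a < 1" for a
  proof (rule ccontr)
    assume "\<not> norm a \<le> norm (f a)"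
    then obtain s where s: "norm (f a) < s" "s < norm a" using dense[of "norm (f a)" "norm a"] by auto
    have s0: "0 < s" using s norm_ge_zero[of "f a"] by linarith
    define cl where "cl t = max (- s) (min s t)" for t :: real
    have "\<exists>p. (\<forall>i. coeff p i \<in> \<real>) \<and> (\<forall>t. \<bar>t\<bar> \<le> 1 \<longrightarrow> cmod (poly (pCons 0 p) (of_real t) - of_real (cl t)) \<le> e)"
      if e: "e > 0" for e
    proof -
      obtain g where g: "real_polynomial_function g" "\<And>t. t \<in> {-1..1} \<Longrightarrow> \<bar>cl t - g t\<bar> < e / 2"
      proof (rule Stone_Weierstrass_real_polynomial_function[of "{-1..1::real}" cl "e / 2"])
        show "continuous_on {- 1..1} cl" unfolding cl_def by (intro continuous_intros)
      qed (use e in auto)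
      from g(1) obtain c n where c: "g = (\<lambda>t. \<Sum>i\<le>n. c i * t ^ i)"
        unfolding real_polynomial_function_iff_sum by blast
      define q where "q = (\<Sum>i\<le>n. monom (complex_of_real (c i)) i)"
      have q: "poly q (of_real t) = of_real (g t)" for t by (simp add: q_def c poly_sum poly_monom)
      have qr: "coeff q i \<in> \<real>" for i by (auto simp: q_def coeff_sum intro: sum_in_Reals)
      \<comment> \<open>As cl 0 = 0, the constant term b = g 0 has modulus below e / 2, so dropping
        it costs at most another e / 2.\<close>
      obtain b p where bp: "q = pCons b p" by (cases q)
      have b: "b = of_real (g 0)" using q[of 0] by (simp add: bp)
      have "cmod (poly (pCons 0 p) (of_real t) - of_real (cl t)) \<le> e" if t: "\<bar>t\<bar> \<le> 1" for t
      proof -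
        have "poly (pCons 0 p) (of_real t) = of_real (g t - g 0)"
          using q[of t] by (simp add: bp b eq_diff_eq add.commute)
        then have "cmod (poly (pCons 0 p) (of_real t) - of_real (cl t)) = \<bar>g t - g 0 - cl t\<bar>"
          by (metis of_real_diff norm_of_real)
        moreover have "\<bar>cl t - g t\<bar> < e / 2" "\<bar>g 0\<bar> < e / 2"
          using g(2)[of t] g(2)[of 0] t s0 by (auto simp: cl_def abs_le_iff)
        ultimately show ?thesis by linarith
      qed
      moreover have "coeff p i \<in> \<real>" for i using qr[of "Suc i"] by (simp add: bp)
      ultimately show ?thesis by blast
    qed
    then have "\<forall>k. \<exists>p. (\<forall>i. coeff p i \<in> \<real>) \<and>
        (\<forall>t. \<bar>t\<bar> \<le> 1 \<longrightarrow> cmod (poly (pCons 0 p) (of_real t) - of_real (cl t)) \<le> inverse (real (Suc k)))"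
      by simp
    then obtain p where pr: "\<And>k i. coeff (p k) i \<in> \<real>"
      and p: "\<And>k t. \<bar>t\<bar> \<le> 1 \<Longrightarrow> cmod (poly (pCons 0 (p k)) (of_real t) - of_real (cl t)) \<le> inverse (real (Suc k))"
      by metis
    define X where "X k = ceval (pCons 0 (p k)) a" for k
    have pr': "coeff (pCons 0 (p k)) i \<in> \<real>" for k i using pr by (simp add: coeff_pCons split: nat.split)
    \<comment> \<open>On [-1, 1] both polynomials are close to cl and hence to each other;
      \<open>norm_ceval_le\<close> transfers this to a.\<close>
    have dX: "norm (X k - X l) \<le> inverse (real (Suc k)) + inverse (real (Suc l))" for k l
      unfolding X_def ceval_diff[symmetric]
    proof (rule norm_ceval_le[OF sa a1])
      show "coeff (pCons 0 (p k) - pCons 0 (p l)) i \<in> \<real>" for i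
        unfolding coeff_diff by (intro Reals_diff pr')
      show "cmod (poly (pCons 0 (p k) - pCons 0 (p l)) (of_real t)) \<le> inverse (real (Suc k)) + inverse (real (Suc l))"
        if t: "\<bar>t\<bar> \<le> 1" for t
        using norm_triangle_mono[OF p[OF t, of k] p[OF t, of l, unfolded norm_minus_commute[of _ "of_real (cl t)"]]]
        by (simp add: algebra_simps)
    qed
    have inv0: "(\<lambda>k. inverse (real (Suc k))) \<longlonglongrightarrow> 0" by (rule LIMSEQ_inverse_real_of_nat)
    have "Cauchy X"
    proof (rule metric_CauchyI)
      fix e :: real assume "e > 0"
      then have "\<forall>\<^sub>F k in sequentially. inverse (real (Suc k)) < e / 2"
        by (intro order_tendstoD[OF inv0]) simp
      then obtain K where K: "\<And>k. k \<ge> K \<Longrightarrow> inverse (real (Suc k)) < e / 2"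
        unfolding eventually_sequentially by blast
      have "dist (X k) (X l) < e" if "k \<ge> K" "l \<ge> K" for k l
        using dX[of k l] K[OF that(1)] K[OF that(2)] by (simp add: dist_norm)
      then show "\<exists>M. \<forall>m\<ge>M. \<forall>n\<ge>M. dist (X m) (X n) < e" by blast
    qed
    then obtain c where c: "X \<longlonglongrightarrow> c" using Cauchy_convergent convergent_def by blast
    \<comment> \<open>Since cl is bounded by s, the limit c will have norm at most s, hence strictly
      less than a.\<close>
    have "norm (X k) \<le> s + inverse (real (Suc k))" for k
      unfolding X_def
    proof (rule norm_ceval_le[OF sa a1 pr'])
      fix t :: real assume t: "\<bar>t\<bar> \<le> 1"
      have "cmod (of_real (cl t)) \<le> s" using s0 by (auto simp: cl_def)
      from norm_triangle_mono[OF this p[OF t, of k]]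
      show "cmod (poly (pCons 0 (p k)) (of_real t)) \<le> s + inverse (real (Suc k))" by simp
    qed
    moreover have "(\<lambda>k. s + inverse (real (Suc k))) \<longlonglongrightarrow> s + 0" by (intro tendsto_intros inv0)
    ultimately have cs: "norm c \<le> s"
      using LIMSEQ_le[OF tendsto_norm[OF c], of "\<lambda>k. s + inverse (real (Suc k))" "s + 0"] by auto
    have "(\<lambda>k. f (X k)) \<longlonglongrightarrow> f c"
      by (rule bounded_linear.tendsto[OF star_hom_bounded_linear[OF f] c])
    \<comment> \<open>As \<open>norm (f a) < s\<close>, only arguments in [-s, s] matter at f a, and
      there cl is the identity.\<close>
    moreover have "(\<lambda>k. f (X k)) \<longlonglongrightarrow> f a"
    proof (rule LIM_zero_cancel[OF Lim_null_comparison])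
      show "(\<lambda>k. inverse (real (Suc k))) \<longlonglongrightarrow> 0" by (rule inv0)
      have "norm (f (X k) - f a) \<le> inverse (real (Suc k))" for k
      proof -
        have "f (X k) - f a = ceval (pCons 0 (p k) - [:0, 1:]) (f a)"
          by (simp only: ceval_diff) (simp add: X_def star_hom_ceval[OF f])
        also have "norm \<dots> \<le> inverse (real (Suc k))"
        proof (rule norm_ceval_le[OF _ s(1)])
          show "star (f a) = f a" using sa fh(4) by metis
          show "coeff (pCons 0 (p k) - [:0, 1:]) i \<in> \<real>" for i
            unfolding coeff_diff by (intro Reals_diff pr') (auto simp: coeff_pCons split: nat.split)
          fix t :: real assume t: "\<bar>t\<bar> \<le> s"
          then have "cl t = t" "\<bar>t\<bar> \<le> 1" using s a1 by (auto simp: cl_def)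
          with p[of t k] show "cmod (poly (pCons 0 (p k) - [:0, 1:]) (of_real t)) \<le> inverse (real (Suc k))"
            by (simp add: right_diff_distrib)
        qed
        finally show ?thesis .
      qed
      then show "\<forall>\<^sub>F k in sequentially. norm (f (X k) - f a) \<le> inverse (real (Suc k))" by simp
    qed
    ultimately have "f c = f a" by (rule LIMSEQ_unique)
    then have "c = a" using inj by (simp add: inj_eq)
    then show False using cs s by simp
  qed
  have 2: "norm a \<le> norm (f a)" if sa: "star a = a" for a
  proof (cases "a = 0")
    case False
    define r where "r = 1 / (2 * norm a)"
    have r: "r > 0" "r * norm a < 1" using False by (auto simp: r_def)
    have "norm (r *\<^sub>R a) \<le> norm (f (r *\<^sub>R a))"
      by (rule 1) (use r sa in \<open>auto simp: star_scaleR\<close>)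
    then show ?thesis using r by (simp add: fh)
  qed simp
  have "(norm x)\<^sup>2 = norm (star x * x)" by (simp add: cstar_identity)
  also have "\<dots> \<le> norm (f (star x * x))" by (rule 2) (simp add: star_mult star_star)
  also have "\<dots> = (norm (f x))\<^sup>2" by (simp add: fh cstar_identity)
  finally have "norm x \<le> norm (f x)" by (rule power2_le_imp_le) simp
  with fle[of x] show ?thesis by simp
qed

section \<open>Tensor products of operators\<close>

lemma tensor_ell2_linear:
  "tensor_ell2 (x + x') y = tensor_ell2 x y + tensor_ell2 x' y"
  "tensor_ell2 x (y + y') = tensor_ell2 x y + tensor_ell2 x y'"
  "tensor_ell2 (c *\<^sub>C x) y = c *\<^sub>C tensor_ell2 x y"
  "tensor_ell2 x (c *\<^sub>C y) = c *\<^sub>C tensor_ell2 x y"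
  by (rule ell2_eqI, clarsimp simp: tensor_ell2_apply algebra_simps split_paired_all)+

lemma cinner_tensor_ell2: "cinner (tensor_ell2 a b) (tensor_ell2 x y) = cinner a x * cinner b y"
proof -
  let ?f = "\<lambda>i. cnj (ell2_apply a i) * ell2_apply x i" and ?g = "\<lambda>j. cnj (ell2_apply b j) * ell2_apply y j"
  have eq: "(\<lambda>p. cnj (ell2_apply (tensor_ell2 a b) p) * ell2_apply (tensor_ell2 x y) p) = (\<lambda>(i, j). ?f i * ?g j)"
    by (rule ext) (clarsimp simp: tensor_ell2_apply mult_ac)
  have "(\<lambda>(i, j). ?f i * ?g j) summable_on UNIV \<times> UNIV"
    using cinner_summable[of "tensor_ell2 a b" "tensor_ell2 x y" UNIV] unfolding eq by simp
  then have "(\<Sum>\<^sub>\<infinity>i. \<Sum>\<^sub>\<infinity>j. ?f i * ?g j) = (\<Sum>\<^sub>\<infinity>(i, j)\<in>UNIV \<times> UNIV. ?f i * ?g j)"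
    by (rule infsum_Sigma'_banach)
  then show ?thesis
    by (simp add: cinner_def eq infsum_cmult_right' infsum_cmult_left')
qed

lemma op_tensor_linear:
  "op_tensor (S + S') T = op_tensor S T + op_tensor S' T"
  "op_tensor S (T + T') = op_tensor S T + op_tensor S T'"
  "op_tensor (c *\<^sub>C S) T = c *\<^sub>C op_tensor S T"
  "op_tensor S (c *\<^sub>C T) = c *\<^sub>C op_tensor S T"
  by (rule bop_tensor_eqI,
      simp add: op_tensor_apply bop_apply_simps bop_apply_scaleC_left tensor_ell2_linear)+

lemma op_tensor_zero_left: "op_tensor 0 T = 0"
  using op_tensor_linear(3)[of 0 0 T] by simp

lemma op_tensor_mult: "op_tensor S T * op_tensor S' T' = op_tensor (S * S') (T * T')"
  by (rule bop_tensor_eqI) (simp add: op_tensor_apply bop_apply_simps)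

lemma star_op_tensor: "star (op_tensor S T) = op_tensor (star S) (star T)"
proof (rule bop_tensor_eqI, rule ell2_eqI)
  fix x y p
  show "ell2_apply (bop_apply (star (op_tensor S T)) (tensor_ell2 x y)) p =
        ell2_apply (bop_apply (op_tensor (star S) (star T)) (tensor_ell2 x y)) p"
    by (cases p) (simp add: cinner_ket_left[symmetric] ket_tensor star_bop_right op_tensor_apply cinner_tensor_ell2)
qed

text \<open>The rank-one operator that sends \<open>ket j\<close> to \<open>ket l\<close> and kills
  the other basis vectors. \<open>matrix_unit_apply\<close> shows that such an operator
  exists.\<close>

definition matrix_unit :: "'i \<Rightarrow> 'i \<Rightarrow> 'i bop" where
  "matrix_unit l j = (SOME R. \<forall>x. bop_apply R x = ell2_apply x j *\<^sub>C ket l)"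

lemma matrix_unit_apply: "bop_apply (matrix_unit l j) x = ell2_apply x j *\<^sub>C ket l"
proof -
  have "norm (ket l) \<le> 1"
  proof -
    have "1 *\<^sub>C ket l = ket l" by (rule ell2_eqI) simp
    with norm_ket_sum[of "{l}" "\<lambda>_. 1"] have "(norm (ket l))\<^sup>2 \<le> 1\<^sup>2" by simp
    then show ?thesis by (rule power2_le_imp_le) simp
  qed
  then have "norm (ell2_apply x j *\<^sub>C ket l) \<le> 1 * norm x" for x :: "'a ell2"
    unfolding norm_ell2_scaleC using mult_mono[OF cmod_le_norm_ell2[of x j], of "norm (ket l)" 1] by simp
  then have "\<exists>R. bop_apply R = (\<lambda>x. ell2_apply x j *\<^sub>C ket l) \<and> norm R \<le> 1"
    by (intro bop_exists ell2_eqI) (simp_all add: algebra_simps)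
  then have "\<exists>R. \<forall>x. bop_apply R x = ell2_apply x j *\<^sub>C ket l" by metis
  from someI_ex[OF this] show ?thesis unfolding matrix_unit_def by blast
qed

lemma matrix_unit_mult: "matrix_unit l j * matrix_unit k m = (if j = k then matrix_unit l m else 0)"
  by (rule bop_eqI, rule ell2_eqI) (auto simp: bop_apply_simps matrix_unit_apply ket_apply)

lemma star_matrix_unit: "star (matrix_unit l j) = matrix_unit j l"
  by (rule star_bop_eqI)
     (simp add: matrix_unit_apply cinner_scaleC_left cinner_scaleC_right cinner_ket_left cinner_ket_right)

text \<open>Diagonal matrix units on both sides isolate one matrix coefficient of T.\<close>

lemma matrix_unit_sandwich:
  "matrix_unit l l * T * matrix_unit j j = ell2_apply (bop_apply T (ket j)) l *\<^sub>C matrix_unit l j"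
  by (rule bop_eqI, rule ell2_eqI)
     (simp add: bop_apply_simps matrix_unit_apply bop_apply_scaleC bop_apply_scaleC_left)

definition coord_proj :: "'i set \<Rightarrow> 'i bop" where
  "coord_proj J = (\<Sum>j\<in>J. matrix_unit j j)"

lemma star_coord_proj: "star (coord_proj J) = coord_proj J"
  by (simp add: coord_proj_def star_sum star_matrix_unit)

lemma coord_proj_idem: "finite J \<Longrightarrow> coord_proj J * coord_proj J = coord_proj J"
  by (simp add: coord_proj_def sum_product matrix_unit_mult)

lemma bop_apply_sum: "bop_apply (\<Sum>i\<in>I. T i) x = (\<Sum>i\<in>I. bop_apply (T i) x)"
  by (induction I rule: infinite_finite_induct) (auto simp: bop_apply_simps)

lemma coord_proj_ket: "finite J \<Longrightarrow> j \<in> J \<Longrightarrow> bop_apply (coord_proj J) (ket j) = ket j"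
  by (rule ell2_eqI) (simp add: coord_proj_def bop_apply_sum matrix_unit_apply ket_apply mult_delta_left)

lemma coord_proj_sandwich:
  "coord_proj J * T * coord_proj J =
     (\<Sum>l\<in>J. \<Sum>j\<in>J. ell2_apply (bop_apply T (ket j)) l *\<^sub>C matrix_unit l j)"
  by (simp add: coord_proj_def sum_distrib_left sum_distrib_right matrix_unit_sandwich[symmetric])
     (rule sum.swap)

text \<open>Finitely supported vectors are fixed by a suitable Q, so on them the form
  \<open>inner w (bop_apply X z)\<close> is that of \<open>Q * X * Q\<close>. These vectors are
  dense, and the choice w = X x gives the bound.\<close>

lemma norm_bop_le_truncation:
  fixes X :: "'i bop"
  assumes C: "0 \<le> C"
    and Q: "\<And>F. finite F \<Longrightarrow> \<exists>Q. star Q = Q \<and> (\<forall>p\<in>F. bop_apply Q (ket p) = ket p) \<and> norm (Q * X * Q) \<le> C"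
  shows "norm X \<le> C"
proof (rule norm_bop_leI[OF C])
  fix x
  define tr where "tr F z = (\<Sum>i\<in>F. ell2_apply z i *\<^sub>C ket i)" for F and z :: "'i ell2"
  have "\<exists>F. finite F \<and> norm (tr F z - z) \<le> inverse (real (Suc n))" for z :: "'i ell2" and n
    using ell2_truncation[of "inverse (real (Suc n))" z] by (auto simp: tr_def norm_minus_commute less_imp_le)
  then obtain F where F: "\<And>z n. finite (F z n)" "\<And>z n. norm (tr (F z n) z - z) \<le> inverse (real (Suc n))"
    by metis
  have lim: "(\<lambda>n. tr (F z n) z) \<longlonglongrightarrow> z" for z
    by (rule LIM_zero_cancel[OF Lim_null_comparison[OF _ LIMSEQ_inverse_real_of_nat]]) (use F in simp)
  have bound: "inner w' (bop_apply X z') \<le> C * (norm w' * norm z')"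
    if w': "w' = tr (F w n) w" and z': "z' = tr (F z n) z" for w z w' z' n
  proof -
    have "finite (F w n \<union> F z n)" using F by simp
    then obtain Q where Q: "star Q = Q" "\<And>p. p \<in> F w n \<union> F z n \<Longrightarrow> bop_apply Q (ket p) = ket p" "norm (Q * X * Q) \<le> C"
      using Q by blast
    have Qfix: "bop_apply Q w' = w'" "bop_apply Q z' = z'"
      unfolding w' z' tr_def bounded_linear.linear[OF bounded_linear_bop_apply, THEN linear_sum]
      by (simp_all add: bop_apply_scaleC Q(2))
    have "inner w' (bop_apply X z') = inner (bop_apply Q w') (bop_apply X (bop_apply Q z'))" by (simp add: Qfix)
    also have "\<dots> = inner w' (bop_apply (Q * X * Q) z')"
      unfolding inner_ell2_def bop_apply_simps by (subst (1) Q(1)[symmetric]) (simp add: star_bop_left)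
    also have "\<dots> \<le> norm w' * norm (bop_apply (Q * X * Q) z')" by (rule norm_cauchy_schwarz)
    also have "\<dots> \<le> norm w' * (C * norm z')"
      by (intro mult_left_mono order.trans[OF norm_bop_apply] mult_right_mono Q) auto
    finally show ?thesis by (simp add: mult_ac)
  qed
  define y where "y = bop_apply X x"
  have Xc: "(\<lambda>n. bop_apply X (tr (F x n) x)) \<longlonglongrightarrow> y"
    unfolding y_def by (rule bounded_linear.tendsto[OF bounded_linear_bop_apply lim])
  have "inner y y \<le> C * (norm y * norm x)"
  proof (rule LIMSEQ_le)
    show "(\<lambda>n. inner (tr (F y n) y) (bop_apply X (tr (F x n) x))) \<longlonglongrightarrow> inner y y"
      by (intro tendsto_inner lim Xc)
    show "(\<lambda>n. C * (norm (tr (F y n) y) * norm (tr (F x n) x))) \<longlonglongrightarrow> C * (norm y * norm x)"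
      by (intro tendsto_mult tendsto_norm lim tendsto_const)
  qed (use bound in blast)
  then have "norm y * norm y \<le> norm y * (C * norm x)"
    by (simp add: power2_norm_eq_inner[symmetric] power2_eq_square mult_ac)
  then show "norm (bop_apply X x) \<le> C * norm x"
    unfolding y_def[symmetric] using C by (cases "norm y = 0") auto
qed

text \<open>Both \<open>op_tensor\<close> and its flip are instances, so that one argument serves either leg.\<close>

locale tensor_pairing =
  fixes \<tau> :: "'h bop \<Rightarrow> 'k bop \<Rightarrow> 'x bop"
  assumes add_left: "\<tau> (S + S') T = \<tau> S T + \<tau> S' T"
    and add_right: "\<tau> S (T + T') = \<tau> S T + \<tau> S T'"
    and scaleC_left: "\<tau> (c *\<^sub>C S) T = c *\<^sub>C \<tau> S T"
    and scaleC_right: "\<tau> S (c *\<^sub>C T) = c *\<^sub>C \<tau> S T"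
    and mult: "\<tau> S T * \<tau> S' T' = \<tau> (S * S') (T * T')"
    and star: "star (\<tau> S T) = \<tau> (star S) (star T)"
    and inj: "\<tau> S (matrix_unit m m) = 0 \<Longrightarrow> S = 0"
    and truncation: "0 \<le> C \<Longrightarrow> (\<And>J. finite J \<Longrightarrow> norm (\<tau> 1 (coord_proj J) * X * \<tau> 1 (coord_proj J)) \<le> C) \<Longrightarrow> norm X \<le> C"
begin

lemma zero_left: "\<tau> 0 T = 0" using scaleC_left[of 0 0 T] by simp

lemma zero_right: "\<tau> S 0 = 0" using scaleC_right[of S 0 0] by simp

lemma sum_left: "\<tau> (\<Sum>i\<in>I. S i) T = (\<Sum>i\<in>I. \<tau> (S i) T)"
  by (induction I rule: infinite_finite_induct) (auto simp: zero_left add_left)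

lemma sum_right: "\<tau> S (\<Sum>i\<in>I. T i) = (\<Sum>i\<in>I. \<tau> S (T i))"
  by (induction I rule: infinite_finite_induct) (auto simp: zero_right add_right)

lemma norm_coord_proj: "finite J \<Longrightarrow> norm (\<tau> 1 (coord_proj J)) \<le> 1"
  by (rule norm_projection_le_1) (auto simp: star mult star_coord_proj coord_proj_idem)

lemma norm_matrix_unit: "norm (\<tau> 1 (matrix_unit l j)) \<le> 1"
  by (rule norm_partial_isometry_le_1) (auto simp: star mult star_matrix_unit matrix_unit_mult)

text \<open>Because \<open>matrix_unit m m\<close> is a projection, S \<mapsto>
  \<open>\<tau> S (matrix_unit m m)\<close> is an injective *-homomorphism and thus
  isometric.\<close>

lemma norm_with_matrix_unit: "norm (\<tau> S (matrix_unit m m)) = norm S"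
proof (rule inj_star_hom_norm)
  show "star_hom (\<lambda>S. \<tau> S (matrix_unit m m))"
    by (simp add: star_hom_on_def add_left scaleC_left mult star matrix_unit_mult star_matrix_unit)
  show "inj (\<lambda>S. \<tau> S (matrix_unit m m))"
  proof (rule injI)
    fix S S' assume "\<tau> S (matrix_unit m m) = \<tau> S' (matrix_unit m m)"
    then have "\<tau> (S + (- 1) *\<^sub>C S') (matrix_unit m m) = 0"
      unfolding add_left scaleC_left by (simp add: scaleC_minus_one)
    from inj[OF this] show "S = S'" by (simp add: scaleC_minus_one)
  qed
qed

text \<open>\<open>\<tau> S T\<close> factors as \<open>\<tau> S 1 * \<tau> 1 T\<close>, and each
  leg is a *-homomorphism, hence contractive.\<close>

lemma norm_le: "norm (\<tau> S T) \<le> norm S * norm T"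
proof -
  have "star_hom (\<lambda>S. \<tau> S 1)" "star_hom (\<lambda>T. \<tau> 1 T)"
    by (simp_all add: star_hom_on_def add_left scaleC_left add_right scaleC_right mult star)
  then have "norm (\<tau> S 1) \<le> norm S" "norm (\<tau> 1 T) \<le> norm T"
    using star_hom_on_norm_le[OF cstar_subalgebra_UNIV, of "\<lambda>S. \<tau> S 1" S]
      star_hom_on_norm_le[OF cstar_subalgebra_UNIV, of "\<lambda>T. \<tau> 1 T" T] by auto
  then have "norm (\<tau> S 1 * \<tau> 1 T) \<le> norm S * norm T"
    by (intro order.trans[OF norm_mult_ineq] mult_mono) auto
  then show ?thesis by (simp add: mult)
qed

lemma bounded_linear_left: "bounded_linear (\<lambda>S. \<tau> S T)"
  by (rule bounded_linear_intro[where K = "norm T"])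
     (simp_all add: add_left scaleC_of_real[symmetric] scaleC_left norm_le)

end

text \<open>Injectivity is tested on the vectors \<open>tensor_ell2 x (ket m)\<close>. For
  truncation, the projection onto the second coordinates that occur in F fixes every basis vector
  indexed by F.\<close>

lemma tensor_pairing_op_tensor: "tensor_pairing (op_tensor :: 'h bop \<Rightarrow> 'k bop \<Rightarrow> _)"
proof
  fix S :: "'h bop" and m :: 'k
  assume 0: "op_tensor S (matrix_unit m m) = 0"
  show "S = 0"
  proof (rule bop_eqI, rule ell2_eqI)
    fix x i
    have "bop_apply (op_tensor S (matrix_unit m m)) (tensor_ell2 x (ket m)) = 0"
      by (simp add: 0 bop_apply_simps)
    then have "ell2_apply (tensor_ell2 (bop_apply S x) (bop_apply (matrix_unit m m) (ket m))) (i, m) = 0"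
      by (simp add: op_tensor_apply)
    then show "ell2_apply (bop_apply S x) i = ell2_apply (bop_apply 0 x) i"
      by (simp add: tensor_ell2_apply matrix_unit_apply ket_apply bop_apply_simps)
  qed
next
  fix C and X :: "('h \<times> 'k) bop"
  assume C: "0 \<le> C" "\<And>J :: 'k set. finite J \<Longrightarrow> norm (op_tensor 1 (coord_proj J) * X * op_tensor 1 (coord_proj J)) \<le> C"
  show "norm X \<le> C"
  proof (rule norm_bop_le_truncation[OF C(1)])
    fix F :: "('h \<times> 'k) set" assume F: "finite F"
    have mem: "(i, k) \<in> F \<Longrightarrow> k \<in> snd ` F" for i k by force
    show "\<exists>Q. star Q = Q \<and> (\<forall>p\<in>F. bop_apply Q (ket p) = ket p) \<and> norm (Q * X * Q) \<le> C"
      by (rule exI[of _ "op_tensor 1 (coord_proj (snd ` F))"])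
         (use F in \<open>auto simp: C(2) star_op_tensor star_coord_proj ket_tensor op_tensor_apply bop_apply_simps
            coord_proj_ket[OF finite_imageI mem]\<close>)
  qed
qed (simp_all add: op_tensor_linear op_tensor_mult star_op_tensor)

lemma tensor_pairing_flip: "tensor_pairing (\<lambda>(S :: 'h bop) (T :: 'k bop). op_tensor T S)"
proof
  fix S :: "'h bop" and m :: 'k
  assume 0: "op_tensor (matrix_unit m m) S = 0"
  show "S = 0"
  proof (rule bop_eqI, rule ell2_eqI)
    fix x i
    have "bop_apply (op_tensor (matrix_unit m m) S) (tensor_ell2 (ket m) x) = 0"
      by (simp add: 0 bop_apply_simps)
    then have "ell2_apply (tensor_ell2 (bop_apply (matrix_unit m m) (ket m)) (bop_apply S x)) (m, i) = 0"
      by (simp add: op_tensor_apply)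
    then show "ell2_apply (bop_apply S x) i = ell2_apply (bop_apply 0 x) i"
      by (simp add: tensor_ell2_apply matrix_unit_apply ket_apply bop_apply_simps)
  qed
next
  fix C and X :: "('k \<times> 'h) bop"
  assume C: "0 \<le> C" "\<And>J :: 'k set. finite J \<Longrightarrow> norm (op_tensor (coord_proj J) 1 * X * op_tensor (coord_proj J) 1) \<le> C"
  show "norm X \<le> C"
  proof (rule norm_bop_le_truncation[OF C(1)])
    fix F :: "('k \<times> 'h) set" assume F: "finite F"
    have mem: "(i, k) \<in> F \<Longrightarrow> i \<in> fst ` F" for i k by force
    show "\<exists>Q. star Q = Q \<and> (\<forall>p\<in>F. bop_apply Q (ket p) = ket p) \<and> norm (Q * X * Q) \<le> C"
      by (rule exI[of _ "op_tensor (coord_proj (fst ` F)) 1"])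
         (use F in \<open>auto simp: C(2) star_op_tensor star_coord_proj ket_tensor op_tensor_apply bop_apply_simps
            coord_proj_ket[OF finite_imageI mem]\<close>)
  qed
qed (simp_all add: op_tensor_linear op_tensor_mult star_op_tensor)

section \<open>Matrices over a C*-algebra\<close>

text \<open>The amplification of f to matrices over A indexed by J, realised through matrix units.
  Entries of x outside J \<times> J are ignored.\<close>

definition op_matrix :: "('h bop \<Rightarrow> 'k bop \<Rightarrow> 'x bop) \<Rightarrow> ('a \<Rightarrow> 'h bop) \<Rightarrow> 'k set \<Rightarrow> ('k \<Rightarrow> 'k \<Rightarrow> 'a) \<Rightarrow> 'x bop" where
  "op_matrix \<tau> f J x = (\<Sum>l\<in>J. \<Sum>j\<in>J. \<tau> (f (x l j)) (matrix_unit l j))"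

context tensor_pairing
begin

context
  fixes f :: "'a::unital_cstar_algebra \<Rightarrow> 'h bop" and J :: "'k set"
  assumes f: "star_hom f" and J: "finite J"
begin

lemma op_matrix_add: "op_matrix \<tau> f J x + op_matrix \<tau> f J y = op_matrix \<tau> f J (\<lambda>l j. x l j + y l j)"
  by (simp add: op_matrix_def star_homD[OF f] add_left sum.distrib)

lemma op_matrix_scaleC: "c *\<^sub>C op_matrix \<tau> f J x = op_matrix \<tau> f J (\<lambda>l j. c *\<^sub>C x l j)"
  by (simp add: op_matrix_def star_homD[OF f] scaleC_left scaleC_sum_right)

lemma op_matrix_diff: "op_matrix \<tau> f J x - op_matrix \<tau> f J y = op_matrix \<tau> f J (\<lambda>l j. x l j - y l j)"
  using op_matrix_add[of "\<lambda>l j. x l j - y l j" y] by (simp add: diff_eq_eq)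

lemma star_op_matrix: "star (op_matrix \<tau> f J x) = op_matrix \<tau> f J (\<lambda>l j. star (x j l))"
  unfolding op_matrix_def star_sum by (subst sum.swap) (simp add: star star_matrix_unit star_homD[OF f])

lemma row_mult_op_matrix:
  assumes "k \<in> J"
  shows "\<tau> S (matrix_unit l k) * op_matrix \<tau> f J y = (\<Sum>j\<in>J. \<tau> (S * f (y k j)) (matrix_unit l j))"
proof -
  have "\<tau> S (matrix_unit l k) * op_matrix \<tau> f J y =
      (\<Sum>k'\<in>J. if k' = k then \<Sum>j\<in>J. \<tau> (S * f (y k' j)) (matrix_unit l j) else 0)"
    unfolding op_matrix_def sum_distrib_left
    by (intro sum.cong) (auto simp: mult matrix_unit_mult zero_right)
  then show ?thesis using assms J by simp
qed

lemma op_matrix_mult: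
  "op_matrix \<tau> f J x * op_matrix \<tau> f J y = op_matrix \<tau> f J (\<lambda>l j. \<Sum>k\<in>J. x l k * y k j)"
proof -
  have "op_matrix \<tau> f J x * op_matrix \<tau> f J y =
      (\<Sum>l\<in>J. \<Sum>k\<in>J. \<tau> (f (x l k)) (matrix_unit l k) * op_matrix \<tau> f J y)"
    by (subst (1) op_matrix_def) (simp add: sum_distrib_right)
  also have "\<dots> = (\<Sum>l\<in>J. \<Sum>k\<in>J. \<Sum>j\<in>J. \<tau> (f (x l k * y k j)) (matrix_unit l j))"
    by (intro sum.cong refl) (simp add: row_mult_op_matrix star_homD[OF f])
  also have "\<dots> = (\<Sum>l\<in>J. \<Sum>j\<in>J. \<Sum>k\<in>J. \<tau> (f (x l k * y k j)) (matrix_unit l j))"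
    by (rule sum.cong[OF refl]) (rule sum.swap)
  finally show ?thesis
    by (simp add: op_matrix_def star_hom_linear[OF f] sum_left)
qed

text \<open>Matrix units of norm at most 1 on both sides move the entry into the diagonal place (l,
  l) and delete all others.\<close>

lemma norm_entry_le:
  assumes "l \<in> J" "j \<in> J"
  shows "norm (f (x l j)) \<le> norm (op_matrix \<tau> f J x)"
proof -
  let ?R = "op_matrix \<tau> f J x"
  have "\<tau> 1 (matrix_unit l l) * ?R * \<tau> 1 (matrix_unit j l) = (\<Sum>j'\<in>J. if j' = j then \<tau> (f (x l j')) (matrix_unit l l) else 0)"
    unfolding row_mult_op_matrix[OF assms(1)] sum_distrib_right
    by (intro sum.cong) (auto simp: mult matrix_unit_mult zero_right)
  also have "\<dots> = \<tau> (f (x l j)) (matrix_unit l l)" using assms J by simp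
  finally have "norm (f (x l j)) = norm (\<tau> 1 (matrix_unit l l) * ?R * \<tau> 1 (matrix_unit j l))"
    by (simp add: norm_with_matrix_unit)
  also have "\<dots> \<le> (1 * norm ?R) * 1"
    by (intro order.trans[OF norm_mult_ineq] mult_mono norm_matrix_unit) auto
  finally show ?thesis by simp
qed

end

text \<open>The entries of a convergent sequence of matrices are Cauchy in A, because an entry is
  dominated by its matrix and an injective f is isometric. Completeness of A supplies the limit
  matrix.\<close>

lemma closed_op_matrices:
  assumes f: "star_hom (f :: 'a::unital_cstar_algebra \<Rightarrow> 'h bop)" "inj f" and J: "finite J"
  shows "closed (range (op_matrix \<tau> f J))"
  unfolding closed_sequential_limits
proof (intro allI impI)
  fix X Y assume "(\<forall>n. X n \<in> range (op_matrix \<tau> f J)) \<and> X \<longlonglongrightarrow> Y"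
  then have "\<forall>n. \<exists>x. X n = op_matrix \<tau> f J x" and Y: "X \<longlonglongrightarrow> Y" by blast+
  then obtain x where X: "X n = op_matrix \<tau> f J (x n)" for n
    using choice[of "\<lambda>n x. X n = op_matrix \<tau> f J x"] by blast
  have conv: "convergent (\<lambda>n. x n l j)" if "l \<in> J" "j \<in> J" for l j
  proof (rule Cauchy_convergent, rule metric_CauchyI)
    fix e :: real assume "e > 0"
    then obtain N where N: "\<forall>m\<ge>N. \<forall>n\<ge>N. dist (X m) (X n) < e"
      using LIMSEQ_imp_Cauchy[OF Y] unfolding Cauchy_def by blast
    have "dist (x m l j) (x n l j) \<le> dist (X m) (X n)" for m n
      using norm_entry_le[OF f(1) J that, of "\<lambda>l j. x m l j - x n l j"]
      by (simp add: dist_norm X op_matrix_diff[OF f(1) J] inj_star_hom_norm[OF f])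
    then show "\<exists>N. \<forall>m\<ge>N. \<forall>n\<ge>N. dist (x m l j) (x n l j) < e"
      using N by (meson le_less_trans)
  qed
  define y where "y l j = lim (\<lambda>n. x n l j)" for l j
  have "(\<lambda>n. x n l j) \<longlonglongrightarrow> y l j" if "l \<in> J" "j \<in> J" for l j
    using conv[OF that] unfolding y_def by (simp add: convergent_LIMSEQ_iff)
  then have "(\<lambda>n. \<tau> (f (x n l j)) (matrix_unit l j)) \<longlonglongrightarrow> \<tau> (f (y l j)) (matrix_unit l j)" if "l \<in> J" "j \<in> J" for l j
    using that
    by (intro bounded_linear.tendsto[OF bounded_linear_left] bounded_linear.tendsto[OF star_hom_bounded_linear[OF f(1)]])
  then have "X \<longlonglongrightarrow> op_matrix \<tau> f J y"
    unfolding X op_matrix_def by (intro tendsto_sum)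
  then have "Y = op_matrix \<tau> f J y" using Y LIMSEQ_unique by blast
  then show "Y \<in> range (op_matrix \<tau> f J)" by blast
qed

lemma cstar_subalgebra_op_matrices:
  assumes f: "star_hom (f :: 'a::unital_cstar_algebra \<Rightarrow> 'h bop)" "inj f" and J: "finite J"
  shows "cstar_subalgebra (range (op_matrix \<tau> f J))"
proof -
  have "op_matrix \<tau> f J (\<lambda>_ _. 0) = 0"
    by (simp add: op_matrix_def star_hom_linear[OF f(1)] zero_left)
  then have "0 \<in> range (op_matrix \<tau> f J)" by (metis rangeI)
  then show ?thesis
    unfolding cstar_subalgebra_def csubspace_def
    using closed_op_matrices[OF assms]
    by (auto simp: op_matrix_add[OF f(1) J] op_matrix_scaleC[OF f(1) J] op_matrix_mult[OF f(1) J] star_op_matrix[OF f(1) J])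
qed

end

text \<open>Replacing \<pi> by f is a *-homomorphism on the C*-algebra of matrices formed with
  \<pi>, and is therefore contractive.\<close>

lemma norm_op_matrix_le:
  fixes \<tau> :: "'h bop \<Rightarrow> 'k bop \<Rightarrow> 'x bop" and \<tau>' :: "'l bop \<Rightarrow> 'k bop \<Rightarrow> 'y bop"
    and \<pi> :: "'a::unital_cstar_algebra \<Rightarrow> 'h bop"
  assumes "tensor_pairing \<tau>" "tensor_pairing \<tau>'"
    and \<pi>: "star_hom \<pi>" "inj \<pi>" and f: "star_hom f" and J: "finite J"
  shows "norm (op_matrix \<tau>' f J x) \<le> norm (op_matrix \<tau> \<pi> J x)"
proof -
  interpret t: tensor_pairing \<tau> by fact
  interpret t': tensor_pairing \<tau>' by fact
  \<comment> \<open>R determines x on J \<times> J, as \<pi> is isometric. The choice is arbitrary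
    only outside, where \<open>op_matrix\<close> does not look.\<close>
  define F where "F R = op_matrix \<tau>' f J (SOME x. R = op_matrix \<tau> \<pi> J x)" for R
  have F: "F (op_matrix \<tau> \<pi> J x) = op_matrix \<tau>' f J x" for x
  proof -
    define y where "y = (SOME y. op_matrix \<tau> \<pi> J x = op_matrix \<tau> \<pi> J y)"
    have eq: "op_matrix \<tau> \<pi> J x = op_matrix \<tau> \<pi> J y"
      unfolding y_def by (rule someI[of _ x]) simp
    have "y l j = x l j" if "l \<in> J" "j \<in> J" for l j
      using t.norm_entry_le[OF \<pi>(1) J that, of "\<lambda>l j. y l j - x l j"] eq
      by (simp add: t.op_matrix_diff[OF \<pi>(1) J, symmetric] inj_star_hom_norm[OF \<pi>])
    then have "op_matrix \<tau>' f J y = op_matrix \<tau>' f J x" by (simp add: op_matrix_def)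
    then show ?thesis by (simp add: F_def y_def)
  qed
  have "star_hom_on (range (op_matrix \<tau> \<pi> J)) F"
    unfolding star_hom_on_def
    by (auto simp: F t.op_matrix_add[OF \<pi>(1) J] t.op_matrix_scaleC[OF \<pi>(1) J] t.op_matrix_mult[OF \<pi>(1) J]
        t.star_op_matrix[OF \<pi>(1) J] t'.op_matrix_add[OF f J] t'.op_matrix_scaleC[OF f J] t'.op_matrix_mult[OF f J]
        t'.star_op_matrix[OF f J])
  from star_hom_on_norm_le[OF t.cstar_subalgebra_op_matrices[OF \<pi> J] this, of "op_matrix \<tau> \<pi> J x"]
  show ?thesis by (simp add: F)
qed

text \<open>The graph of \<open>f \<otimes> id\<close> on the algebraic tensor product.\<close>

inductive leg_graph :: "('h bop \<Rightarrow> 'k bop \<Rightarrow> 'x bop) \<Rightarrow> ('l bop \<Rightarrow> 'k bop \<Rightarrow> 'y bop) \<Rightarrow>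
    ('a::unital_cstar_algebra \<Rightarrow> 'h bop) \<Rightarrow> ('a \<Rightarrow> 'l bop) \<Rightarrow> 'x bop \<Rightarrow> 'y bop \<Rightarrow> bool"
  for \<tau> \<tau>' \<pi> f where
  simple: "leg_graph \<tau> \<tau>' \<pi> f (\<tau> (\<pi> a) T) (\<tau>' (f a) T)"
| add: "leg_graph \<tau> \<tau>' \<pi> f X Y \<Longrightarrow> leg_graph \<tau> \<tau>' \<pi> f X' Y' \<Longrightarrow> leg_graph \<tau> \<tau>' \<pi> f (X + X') (Y + Y')"

lemma (in tensor_pairing) compress_simple:
  assumes f: "star_hom f"
  shows "\<tau> 1 (coord_proj J) * \<tau> (f a) T * \<tau> 1 (coord_proj J) =
    op_matrix \<tau> f J (\<lambda>l j. ell2_apply (bop_apply T (ket j)) l *\<^sub>C a)"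
  by (simp add: mult coord_proj_sandwich sum_right scaleC_right op_matrix_def star_homD[OF f] scaleC_left)

text \<open>Compression replaces T by its finitely many matrix coefficients, so both sides become
  images of one and the same matrix x over A.\<close>

lemma leg_graph_compress:
  assumes "tensor_pairing \<tau>" "tensor_pairing \<tau>'" and f: "star_hom \<pi>" "star_hom f"
    and J: "finite J" and "leg_graph \<tau> \<tau>' \<pi> f X Y"
  shows "\<exists>x. \<tau> 1 (coord_proj J) * X * \<tau> 1 (coord_proj J) = op_matrix \<tau> \<pi> J x \<and>
    \<tau>' 1 (coord_proj J) * Y * \<tau>' 1 (coord_proj J) = op_matrix \<tau>' f J x"
proof -
  interpret t: tensor_pairing \<tau> by fact
  interpret t': tensor_pairing \<tau>' by fact
  show ?thesis using assms(6)
  proof induction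
    case (simple a T)
    then show ?case using t.compress_simple[OF f(1)] t'.compress_simple[OF f(2)] by blast
  next
    case (add X Y X' Y')
    then obtain x x' where
      "\<tau> 1 (coord_proj J) * X * \<tau> 1 (coord_proj J) = op_matrix \<tau> \<pi> J x"
      "\<tau>' 1 (coord_proj J) * Y * \<tau>' 1 (coord_proj J) = op_matrix \<tau>' f J x"
      "\<tau> 1 (coord_proj J) * X' * \<tau> 1 (coord_proj J) = op_matrix \<tau> \<pi> J x'"
      "\<tau>' 1 (coord_proj J) * Y' * \<tau>' 1 (coord_proj J) = op_matrix \<tau>' f J x'" by blast
    then show ?case
      by (intro exI[of _ "\<lambda>l j. x l j + x' l j"])
         (simp add: distrib_left distrib_right t.op_matrix_add[OF f(1) J] t'.op_matrix_add[OF f(2) J])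
  qed
qed

text \<open>Truncation reduces the claim to compressions by finite J, where it is
  \<open>norm_op_matrix_le\<close>; compressing X does not increase its norm.\<close>

lemma leg_graph_norm_le:
  fixes \<tau> :: "'h bop \<Rightarrow> 'k bop \<Rightarrow> 'x bop" and \<tau>' :: "'l bop \<Rightarrow> 'k bop \<Rightarrow> 'y bop"
  assumes t: "tensor_pairing \<tau>" "tensor_pairing \<tau>'" and \<pi>: "star_hom \<pi>" "inj \<pi>" and f: "star_hom f"
    and XY: "leg_graph \<tau> \<tau>' \<pi> f X Y"
  shows "norm Y \<le> norm X"
proof (rule tensor_pairing.truncation[OF t(2)])
  fix J :: "'k set" assume J: "finite J"
  obtain x where x: "\<tau> 1 (coord_proj J) * X * \<tau> 1 (coord_proj J) = op_matrix \<tau> \<pi> J x"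
    "\<tau>' 1 (coord_proj J) * Y * \<tau>' 1 (coord_proj J) = op_matrix \<tau>' f J x"
    using leg_graph_compress[OF t \<pi>(1) f J XY] by blast
  have "norm (op_matrix \<tau>' f J x) \<le> norm (\<tau> 1 (coord_proj J) * X * \<tau> 1 (coord_proj J))"
    unfolding x by (rule norm_op_matrix_le[OF t \<pi> f J])
  also have "\<dots> \<le> (1 * norm X) * 1"
    by (intro order.trans[OF norm_mult_ineq] mult_mono tensor_pairing.norm_coord_proj[OF t(1) J]) auto
  finally show "norm (\<tau>' 1 (coord_proj J) * Y * \<tau>' 1 (coord_proj J)) \<le> norm X" by (simp add: x)
qed simp

section \<open>The minimal tensor product\<close>

text \<open>The graph of f \<otimes> g on the algebraic tensor product. It is a relation because
  elements have many decompositions; single-valuedness comes from the norm estimate applied to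
  differences. Scalars are absorbed into a.\<close>

inductive tensor_graph :: "('a::unital_cstar_algebra \<Rightarrow> 'i bop) \<Rightarrow> ('b::unital_cstar_algebra \<Rightarrow> 'j bop) \<Rightarrow>
   ('a \<Rightarrow> 'k bop) \<Rightarrow> ('b \<Rightarrow> 'l bop) \<Rightarrow> ('i \<times> 'j) bop \<Rightarrow> ('k \<times> 'l) bop \<Rightarrow> bool"
  for \<pi> \<rho> f g where
  simple: "tensor_graph \<pi> \<rho> f g (op_tensor (\<pi> a) (\<rho> b)) (op_tensor (f a) (g b))"
| add: "tensor_graph \<pi> \<rho> f g X Y \<Longrightarrow> tensor_graph \<pi> \<rho> f g X' Y' \<Longrightarrow> tensor_graph \<pi> \<rho> f g (X + X') (Y + Y')"

text \<open>The two legs are treated one after the other, through \<open>f \<otimes> id\<close>.\<close>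

lemma tensor_graph_norm_le:
  assumes \<pi>: "faithful_rep \<pi>" and \<rho>: "faithful_rep \<rho>" and f: "star_hom f" and g: "star_hom g"
    and XY: "tensor_graph \<pi> \<rho> f g X Y"
  shows "norm Y \<le> norm X"
proof -
  \<comment> \<open>Z is the image of X under f \<otimes> id. It is built along the derivation, so
    that both steps use the same decomposition.\<close>
  have "\<exists>Z. leg_graph op_tensor op_tensor \<pi> f X Z \<and>
      leg_graph (\<lambda>S T. op_tensor T S) (\<lambda>S T. op_tensor T S) \<rho> g Z Y"
    using XY
  proof induction
    case (simple a b)
    show ?case
      using leg_graph.simple[of op_tensor op_tensor \<pi> f a "\<rho> b"]
        leg_graph.simple[of "\<lambda>S T. op_tensor T S" "\<lambda>S T. op_tensor T S" \<rho> g b "f a"] by blast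
  next
    case (add X Y X' Y')
    then obtain Z Z' where "leg_graph op_tensor op_tensor \<pi> f X Z"
      "leg_graph (\<lambda>S T. op_tensor T S) (\<lambda>S T. op_tensor T S) \<rho> g Z Y"
      "leg_graph op_tensor op_tensor \<pi> f X' Z'"
      "leg_graph (\<lambda>S T. op_tensor T S) (\<lambda>S T. op_tensor T S) \<rho> g Z' Y'" by blast
    then show ?case by (intro exI[of _ "Z + Z'"] conjI leg_graph.add)
  qed
  then obtain Z where Z: "leg_graph op_tensor op_tensor \<pi> f X Z"
      "leg_graph (\<lambda>S T. op_tensor T S) (\<lambda>S T. op_tensor T S) \<rho> g Z Y" by blast
  have "norm Y \<le> norm Z"
    by (rule leg_graph_norm_le[OF tensor_pairing_flip tensor_pairing_flip _ _ g Z(2)])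
       (use \<rho> in \<open>auto simp: faithful_rep_def\<close>)
  also have "norm Z \<le> norm X"
    by (rule leg_graph_norm_le[OF tensor_pairing_op_tensor tensor_pairing_op_tensor _ _ f Z(1)])
       (use \<pi> in \<open>auto simp: faithful_rep_def\<close>)
  finally show ?thesis .
qed

section \<open>Closed linear spans and density arguments\<close>

lemma csubspace_cspan: "csubspace (cspan S)"
  by (rule hull_in) (auto simp: csubspace_def)

lemma csubspace_closure:
  assumes "csubspace S"
  shows "csubspace (closure S)"
  unfolding csubspace_def
proof (intro conjI ballI allI)
  show "0 \<in> closure S" using assms closure_subset by (auto simp: csubspace_def)
  fix x y assume "x \<in> closure S" "y \<in> closure S"
  then obtain X Y where "\<And>n. X n \<in> S" "X \<longlonglongrightarrow> x" "\<And>n. Y n \<in> S" "Y \<longlonglongrightarrow> y"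
    unfolding closure_sequential by blast
  then show "x + y \<in> closure S"
    unfolding closure_sequential
    by (intro exI[of _ "\<lambda>n. X n + Y n"]) (auto intro: tendsto_add csubspaceD[OF assms])
next
  fix x c assume "x \<in> closure S"
  then obtain X where "\<And>n. X n \<in> S" "X \<longlonglongrightarrow> x" unfolding closure_sequential by blast
  then show "c *\<^sub>C x \<in> closure S"
    unfolding closure_sequential
    by (intro exI[of _ "\<lambda>n. c *\<^sub>C X n"])
       (auto intro: bounded_linear.tendsto[OF bounded_linear_scaleC] csubspaceD[OF assms])
qed

lemma cstar_subalgebra_closure:
  assumes "csubspace S" "\<And>x y. x \<in> S \<Longrightarrow> y \<in> S \<Longrightarrow> x * y \<in> S" "\<And>x. x \<in> S \<Longrightarrow> star x \<in> S"
  shows "cstar_subalgebra (closure S)"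
  unfolding cstar_subalgebra_def
proof (intro conjI ballI)
  show "csubspace (closure S)" by (rule csubspace_closure[OF assms(1)])
  fix x assume "x \<in> closure S"
  then obtain X where X: "\<And>n. X n \<in> S" "X \<longlonglongrightarrow> x" unfolding closure_sequential by blast
  then show "star x \<in> closure S"
    unfolding closure_sequential
    by (intro exI[of _ "\<lambda>n. star (X n)"]) (auto intro: bounded_linear.tendsto[OF bounded_linear_star] assms)
  fix y assume "y \<in> closure S"
  then obtain Y where "\<And>n. Y n \<in> S" "Y \<longlonglongrightarrow> y" unfolding closure_sequential by blast
  with X show "x * y \<in> closure S"
    unfolding closure_sequential
    by (intro exI[of _ "\<lambda>n. X n * Y n"]) (auto intro: tendsto_mult assms)
qed simp

lemma closure_cspan_subset:
  assumes "csubspace K" "closed K" "S \<subseteq> K"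
  shows "closure (cspan S) \<subseteq> K"
  by (intro closure_minimal hull_minimal assms)

text \<open>The preimage of K under \<phi> is a closed subspace, so checking it on S is enough. The
  maps in use are built from left and right multiplications.\<close>

lemma closure_cspan_image:
  assumes \<phi>: "bounded_linear \<phi>" "\<And>c x. \<phi> (c *\<^sub>C x) = c *\<^sub>C \<phi> x"
    and K: "csubspace K" "closed K" and S: "\<And>x. x \<in> S \<Longrightarrow> \<phi> x \<in> K" and x: "x \<in> closure (cspan S)"
  shows "\<phi> x \<in> K"
proof -
  note lin = linear_0[OF bounded_linear.linear[OF \<phi>(1)]] linear_add[OF bounded_linear.linear[OF \<phi>(1)]]
  have "closed (\<phi> -` K)"
    by (rule closed_vimage[OF K(2)]) (use \<phi>(1) in \<open>auto intro: linear_continuous_on\<close>)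
  moreover have "csubspace (\<phi> -` K)"
    unfolding csubspace_def using csubspaceD[OF K(1)] by (auto simp: lin \<phi>(2))
  ultimately have "closure (cspan S) \<subseteq> \<phi> -` K"
    by (intro closure_cspan_subset) (use S in auto)
  with x show ?thesis by auto
qed

lemma star_hom_on_tendsto:
  assumes D: "cstar_subalgebra D" and F: "star_hom_on D F" and X: "\<And>n. X n \<in> D" "x \<in> D" "X \<longlonglongrightarrow> x"
  shows "(\<lambda>n. F (X n)) \<longlonglongrightarrow> F x"
proof (rule LIM_zero_cancel[OF Lim_null_comparison])
  show "(\<lambda>n. norm (X n - x)) \<longlonglongrightarrow> 0" using X(3) by (simp add: tendsto_norm_zero LIM_zero)
  have "norm (F (X n) - F x) \<le> norm (X n - x)" for n
    using star_hom_on_norm_le[OF D F, of "X n - x"] X csubspaceD(5)[OF cstar_subalgebraD(1)[OF D]]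
    by (simp add: star_hom_on_linear[OF F cstar_subalgebraD(1)[OF D]])
  then show "\<forall>\<^sub>F n in sequentially. norm (F (X n) - F x) \<le> norm (X n - x)" by simp
qed

text \<open>Contractivity makes the set on which F and G agree a closed subspace.\<close>

lemma star_hom_on_eqI:
  assumes D: "cstar_subalgebra D" "D = closure (cspan S)"
    and F: "star_hom_on D F" and G: "star_hom_on D G" and eq: "\<And>x. x \<in> S \<Longrightarrow> F x = G x" and x: "x \<in> D"
  shows "F x = G x"
proof -
  note Ds = csubspaceD[OF cstar_subalgebraD(1)[OF D(1)]]
  define E where "E = {x \<in> D. F x = G x}"
  have "csubspace E"
    unfolding csubspace_def E_def
    using Ds(1-3) star_hom_onD[OF F] star_hom_onD[OF G]
      star_hom_on_linear(1)[OF F cstar_subalgebraD(1)[OF D(1)]] star_hom_on_linear(1)[OF G cstar_subalgebraD(1)[OF D(1)]]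
    by simp
  moreover have "closed E"
    unfolding closed_sequential_limits
  proof (intro allI impI)
    fix X y assume X: "(\<forall>n. X n \<in> E) \<and> X \<longlonglongrightarrow> y"
    then have XD: "\<And>n. X n \<in> D" "\<And>n. F (X n) = G (X n)" "X \<longlonglongrightarrow> y" by (auto simp: E_def)
    have y: "y \<in> D" by (rule closed_sequentially[OF cstar_subalgebraD(4)[OF D(1)] XD(1,3)])
    have "(\<lambda>n. F (X n)) \<longlonglongrightarrow> F y" "(\<lambda>n. F (X n)) \<longlonglongrightarrow> G y"
      using star_hom_on_tendsto[OF D(1) F XD(1) y XD(3)] star_hom_on_tendsto[OF D(1) G XD(1) y XD(3)]
      by (simp_all add: XD(2))
    then show "y \<in> E" using y LIMSEQ_unique by (auto simp: E_def)
  qed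
  moreover have "S \<subseteq> E"
    using eq closure_subset[of "cspan S"] hull_subset[of S csubspace] D(2) by (auto simp: E_def)
  ultimately have "closure (cspan S) \<subseteq> E" by (rule closure_cspan_subset)
  with x D(2) show ?thesis by (auto simp: E_def)
qed

section \<open>Algebra of the graph of f \<otimes> g\<close>

context
  fixes \<pi> :: "'a::unital_cstar_algebra \<Rightarrow> 'i bop" and \<rho> :: "'b::unital_cstar_algebra \<Rightarrow> 'j bop"
    and f :: "'a \<Rightarrow> 'k bop" and g :: "'b \<Rightarrow> 'l bop"
  assumes hom: "star_hom \<pi>" "star_hom \<rho>" "star_hom f" "star_hom g"
begin

lemma tensor_graph_zero: "tensor_graph \<pi> \<rho> f g 0 0"
  using tensor_graph.simple[of \<pi> \<rho> f g 0 0]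
  by (simp add: star_hom_linear(1)[OF hom(1)] star_hom_linear(1)[OF hom(3)] op_tensor_zero_left)

lemma tensor_graph_scaleC: "tensor_graph \<pi> \<rho> f g X Y \<Longrightarrow> tensor_graph \<pi> \<rho> f g (c *\<^sub>C X) (c *\<^sub>C Y)"
proof (induction rule: tensor_graph.induct)
  case (simple a b)
  show ?case
    using tensor_graph.simple[of \<pi> \<rho> f g "c *\<^sub>C a" b]
    by (simp add: star_homD[OF hom(1)] star_homD[OF hom(3)] op_tensor_linear)
qed (simp add: scaleC_add_right tensor_graph.add)

lemma tensor_graph_diff:
  "tensor_graph \<pi> \<rho> f g X Y \<Longrightarrow> tensor_graph \<pi> \<rho> f g X' Y' \<Longrightarrow> tensor_graph \<pi> \<rho> f g (X - X') (Y - Y')"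
  using tensor_graph.add[OF _ tensor_graph_scaleC[of X' Y' "- 1"]] by (simp add: scaleC_minus_one)

lemma tensor_graph_star: "tensor_graph \<pi> \<rho> f g X Y \<Longrightarrow> tensor_graph \<pi> \<rho> f g (star X) (star Y)"
proof (induction rule: tensor_graph.induct)
  case (simple a b)
  show ?case
    using tensor_graph.simple[of \<pi> \<rho> f g "star a" "star b"]
    by (simp add: star_homD[OF hom(1)] star_homD[OF hom(2)] star_homD[OF hom(3)] star_homD[OF hom(4)] star_op_tensor)
qed (simp add: star_add tensor_graph.add)

lemma tensor_graph_mult:
  assumes "tensor_graph \<pi> \<rho> f g X Y" "tensor_graph \<pi> \<rho> f g X' Y'"
  shows "tensor_graph \<pi> \<rho> f g (X * X') (Y * Y')"
  using assms
proof (induction rule: tensor_graph.induct)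
  case (simple a b)
  show ?case using simple
  proof (induction rule: tensor_graph.induct)
    case (simple a' b')
    show ?case
      using tensor_graph.simple[of \<pi> \<rho> f g "a * a'" "b * b'"]
      by (simp add: star_homD[OF hom(1)] star_homD[OF hom(2)] star_homD[OF hom(3)] star_homD[OF hom(4)] op_tensor_mult)
  qed (simp add: distrib_left tensor_graph.add)
qed (simp add: distrib_right tensor_graph.add)

text \<open>The left side does not involve f or g: every element of the algebraic tensor product has
  an image, whatever the two maps are.\<close>

lemma cspan_eq_tensor_graph_domain:
  "cspan {op_tensor (\<pi> a) (\<rho> b) | a b. True} = {X. \<exists>Y. tensor_graph \<pi> \<rho> f g X Y}"
proof (rule antisym)
  show "cspan {op_tensor (\<pi> a) (\<rho> b) | a b. True} \<subseteq> {X. \<exists>Y. tensor_graph \<pi> \<rho> f g X Y}"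
  proof (rule hull_minimal)
    show "csubspace {X. \<exists>Y. tensor_graph \<pi> \<rho> f g X Y}"
      unfolding csubspace_def
      using tensor_graph_zero tensor_graph_scaleC tensor_graph.add[of \<pi> \<rho> f g] by blast
  qed (auto intro: tensor_graph.simple)
  have "X \<in> cspan {op_tensor (\<pi> a) (\<rho> b) | a b. True}" if "tensor_graph \<pi> \<rho> f g X Y" for X Y
    using that by induction (auto intro: hull_inc csubspaceD[OF csubspace_cspan])
  then show "{X. \<exists>Y. tensor_graph \<pi> \<rho> f g X Y} \<subseteq> cspan {op_tensor (\<pi> a) (\<rho> b) | a b. True}" by blast
qed

lemma min_tensor_eq: "min_tensor \<pi> \<rho> = closure {X. \<exists>Y. tensor_graph \<pi> \<rho> f g X Y}"
  unfolding min_tensor_def cspan_eq_tensor_graph_domain ..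

end

lemma cstar_subalgebra_min_tensor:
  assumes "star_hom \<pi>" "star_hom \<rho>"
  shows "cstar_subalgebra (min_tensor \<pi> \<rho>)"
  unfolding min_tensor_def
proof (rule cstar_subalgebra_closure[OF csubspace_cspan])
  \<comment> \<open>Taking \<pi> and \<rho> themselves for f and g, the graph lemmas yield closure
    of the domain under products and adjoints.\<close>
  note hom = assms assms
  show "x * y \<in> cspan {op_tensor (\<pi> a) (\<rho> b) | a b. True}"
    if "x \<in> cspan {op_tensor (\<pi> a) (\<rho> b) | a b. True}" "y \<in> cspan {op_tensor (\<pi> a) (\<rho> b) | a b. True}" for x y
    using that unfolding cspan_eq_tensor_graph_domain[OF hom] by (blast intro: tensor_graph_mult[OF hom])
  show "star x \<in> cspan {op_tensor (\<pi> a) (\<rho> b) | a b. True}"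
    if "x \<in> cspan {op_tensor (\<pi> a) (\<rho> b) | a b. True}" for x
    using that unfolding cspan_eq_tensor_graph_domain[OF hom] by (blast intro: tensor_graph_star[OF hom])
qed

lemma op_tensor_in_min_tensor: "op_tensor (\<pi> a) (\<rho> b) \<in> min_tensor \<pi> \<rho>"
  unfolding min_tensor_def by (rule subsetD[OF closure_subset]) (auto intro: hull_inc)

text \<open>h is obtained by closing the graph. The norm estimate survives limits, so the closed
  relation G is still single-valued, and its compatibility with the operations is inherited
  termwise.\<close>

lemma ex_tensor_hom:
  assumes \<pi>: "faithful_rep \<pi>" and \<rho>: "faithful_rep \<rho>" and f: "star_hom f" and g: "star_hom g"
  shows "\<exists>h. star_hom_on (min_tensor \<pi> \<rho>) h \<and> (\<forall>a b. h (op_tensor (\<pi> a) (\<rho> b)) = op_tensor (f a) (g b))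
    \<and> (\<forall>x. x \<notin> min_tensor \<pi> \<rho> \<longrightarrow> h x = 0)"
proof -
  let ?M = "min_tensor \<pi> \<rho>"
  have hom: "star_hom \<pi>" "star_hom \<rho>" "star_hom f" "star_hom g"
    using assms by (auto simp: faithful_rep_def)
  note M = cstar_subalgebra_min_tensor[OF hom(1,2)]
  define G where "G X Y \<longleftrightarrow> (\<exists>x y. (\<forall>n. tensor_graph \<pi> \<rho> f g (x n) (y n)) \<and> x \<longlonglongrightarrow> X \<and> y \<longlonglongrightarrow> Y)" for X Y
  have graph: "G X Y" if "tensor_graph \<pi> \<rho> f g X Y" for X Y
    unfolding G_def using that by (intro exI[of _ "\<lambda>_. X"] exI[of _ "\<lambda>_. Y"]) simp
  have le: "norm Y \<le> norm X" if GX: "G X Y" for X Y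
  proof -
    obtain x y where xy: "\<And>n. tensor_graph \<pi> \<rho> f g (x n) (y n)" "x \<longlonglongrightarrow> X" "y \<longlonglongrightarrow> Y"
      using GX unfolding G_def by blast
    show ?thesis
      by (rule LIMSEQ_le[OF tendsto_norm[OF xy(3)] tendsto_norm[OF xy(2)]])
         (use tensor_graph_norm_le[OF assms xy(1)] in blast)
  qed
  have G_add: "G (X + X') (Y + Y')" and G_mult: "G (X * X') (Y * Y')" and G_diff: "G (X - X') (Y - Y')"
    if GX: "G X Y" "G X' Y'" for X Y X' Y'
  proof -
    obtain x y x' y' where xy: "\<And>n. tensor_graph \<pi> \<rho> f g (x n) (y n)" "x \<longlonglongrightarrow> X" "y \<longlonglongrightarrow> Y"
      "\<And>n. tensor_graph \<pi> \<rho> f g (x' n) (y' n)" "x' \<longlonglongrightarrow> X'" "y' \<longlonglongrightarrow> Y'"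
      using GX unfolding G_def by blast
    show "G (X + X') (Y + Y')" unfolding G_def
      by (intro exI[of _ "\<lambda>n. x n + x' n"] exI[of _ "\<lambda>n. y n + y' n"])
         (simp add: tensor_graph.add tendsto_add xy)
    show "G (X * X') (Y * Y')" unfolding G_def
      by (intro exI[of _ "\<lambda>n. x n * x' n"] exI[of _ "\<lambda>n. y n * y' n"])
         (simp add: tensor_graph_mult[OF hom] tendsto_mult xy)
    show "G (X - X') (Y - Y')" unfolding G_def
      by (intro exI[of _ "\<lambda>n. x n - x' n"] exI[of _ "\<lambda>n. y n - y' n"])
         (simp add: tensor_graph_diff[OF hom] tendsto_diff xy)
  qed
  have G_scaleC: "G (c *\<^sub>C X) (c *\<^sub>C Y)" and G_star: "G (star X) (star Y)" if GX: "G X Y" for c X Y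
  proof -
    obtain x y where xy: "\<And>n. tensor_graph \<pi> \<rho> f g (x n) (y n)" "x \<longlonglongrightarrow> X" "y \<longlonglongrightarrow> Y"
      using GX unfolding G_def by blast
    show "G (c *\<^sub>C X) (c *\<^sub>C Y)" unfolding G_def
      by (intro exI[of _ "\<lambda>n. c *\<^sub>C x n"] exI[of _ "\<lambda>n. c *\<^sub>C y n"])
         (simp add: tensor_graph_scaleC[OF hom] bounded_linear.tendsto[OF bounded_linear_scaleC] xy)
    show "G (star X) (star Y)" unfolding G_def
      by (intro exI[of _ "\<lambda>n. star (x n)"] exI[of _ "\<lambda>n. star (y n)"])
         (simp add: tensor_graph_star[OF hom] bounded_linear.tendsto[OF bounded_linear_star] xy)
  qed
  \<comment> \<open>The estimate for differences makes the images of a convergent sequence Cauchy,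
    so G is defined on all of \<open>min_tensor \<pi> \<rho>\<close>.\<close>
  have ex: "\<exists>Y. G X Y" if XM: "X \<in> ?M" for X
  proof -
    obtain x where x: "\<forall>n. \<exists>y. tensor_graph \<pi> \<rho> f g (x n) y" "x \<longlonglongrightarrow> X"
      using XM unfolding min_tensor_eq[OF hom] closure_sequential by auto
    then obtain y where y: "\<And>n. tensor_graph \<pi> \<rho> f g (x n) (y n)" by metis
    have "Cauchy y"
    proof (rule metric_CauchyI)
      fix e :: real assume "e > 0"
      then obtain N where N: "\<forall>m\<ge>N. \<forall>n\<ge>N. dist (x m) (x n) < e"
        using LIMSEQ_imp_Cauchy[OF x(2)] unfolding Cauchy_def by blast
      have "dist (y m) (y n) \<le> dist (x m) (x n)" for m n
        unfolding dist_norm by (rule tensor_graph_norm_le[OF assms tensor_graph_diff[OF hom y y]])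
      then show "\<exists>N. \<forall>m\<ge>N. \<forall>n\<ge>N. dist (y m) (y n) < e"
        using N by (meson le_less_trans)
    qed
    then obtain Y where "y \<longlonglongrightarrow> Y" using Cauchy_convergent convergent_def by blast
    then show ?thesis unfolding G_def using x(2) y by blast
  qed
  have uniq: "Y = Y'" if "G X Y" "G X Y'" for X Y Y'
    using le[OF G_diff[OF that]] by simp
  define h where "h X = (if X \<in> ?M then THE Y. G X Y else 0)" for X
  have hG: "G X (h X)" if "X \<in> ?M" for X
    unfolding h_def using that ex[OF that] uniq by (auto intro: theI2)
  have hI: "h X = Y" if "X \<in> ?M" "G X Y" for X Y
    by (rule uniq[OF hG[OF that(1)] that(2)])
  have "star_hom_on ?M h"
    unfolding star_hom_on_def
    using cstar_subalgebraD[OF M] csubspaceD(2,3)[OF cstar_subalgebraD(1)[OF M]]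
    by (auto intro!: hI G_add G_mult G_scaleC G_star hG)
  moreover have "h (op_tensor (\<pi> a) (\<rho> b)) = op_tensor (f a) (g b)" for a b
    by (intro hI op_tensor_in_min_tensor graph tensor_graph.simple)
  ultimately show ?thesis by (intro exI[of _ h]) (auto simp: h_def)
qed

text \<open>The definite description is justified: two candidates agree on simple tensors, hence on
  their closed span, and both vanish outside it.\<close>

lemma tensor_hom:
  assumes \<pi>: "faithful_rep \<pi>" and \<rho>: "faithful_rep \<rho>" and f: "star_hom f" and g: "star_hom g"
  shows "star_hom_on (min_tensor \<pi> \<rho>) (tensor_hom \<pi> \<rho> f g)"
    "tensor_hom \<pi> \<rho> f g (op_tensor (\<pi> a) (\<rho> b)) = op_tensor (f a) (g b)"
proof -
  let ?P = "\<lambda>h. star_hom_on (min_tensor \<pi> \<rho>) h \<and> (\<forall>a b. h (op_tensor (\<pi> a) (\<rho> b)) = op_tensor (f a) (g b))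
    \<and> (\<forall>x. x \<notin> min_tensor \<pi> \<rho> \<longrightarrow> h x = 0)"
  have "\<exists>!h. ?P h"
  proof (rule ex_ex1I[OF ex_tensor_hom[OF assms]])
    fix h h' assume h: "?P h" "?P h'"
    have M: "cstar_subalgebra (min_tensor \<pi> \<rho>)"
      by (rule cstar_subalgebra_min_tensor) (use \<pi> \<rho> in \<open>auto simp: faithful_rep_def\<close>)
    have "h x = h' x" if "x \<in> min_tensor \<pi> \<rho>" for x
      by (rule star_hom_on_eqI[OF M min_tensor_def _ _ _ that]) (use h in auto)
    with h show "h = h'" by (intro ext) metis
  qed
  from theI'[OF this] show "star_hom_on (min_tensor \<pi> \<rho>) (tensor_hom \<pi> \<rho> f g)"
    "tensor_hom \<pi> \<rho> f g (op_tensor (\<pi> a) (\<rho> b)) = op_tensor (f a) (g b)"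
    unfolding tensor_hom_def by blast+
qed

section \<open>Coassociativity\<close>

lemma assoc_ell2_linear:
  "assoc_ell2 (x + y) = assoc_ell2 x + assoc_ell2 y"
  "assoc_ell2 (c *\<^sub>C x) = c *\<^sub>C assoc_ell2 x"
  "assoc_ell2 (tensor_ell2 (tensor_ell2 a b) d) = tensor_ell2 a (tensor_ell2 b d)"
  "assoc_ell2 (ket ((i, j), k)) = ket (i, (j, k))"
  by (rule ell2_eqI, clarsimp simp: assoc_ell2_apply tensor_ell2_apply ket_apply split_paired_all)+

lemma cinner_assoc_ell2: "cinner (assoc_ell2 x) (assoc_ell2 y) = cinner x y"
proof -
  let ?h = "\<lambda>(i, (j, k)). ((i, j), k)"
  have h: "bij ?h"
    by (rule o_bij[of "\<lambda>((i, j), k). (i, (j, k))"]) auto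
  have "cinner (assoc_ell2 x) (assoc_ell2 y) = (\<Sum>\<^sub>\<infinity>p. cnj (ell2_apply x (?h p)) * ell2_apply y (?h p))"
    unfolding cinner_def by (intro infsum_cong) (auto simp: assoc_ell2_apply)
  also have "\<dots> = cinner x y"
    unfolding cinner_def by (rule infsum_reindex_bij_betw[OF h, of "\<lambda>p. cnj (ell2_apply x p) * ell2_apply y p"])
  finally show ?thesis .
qed

lemma bounded_linear_assoc_ell2: "bounded_linear assoc_ell2"
proof (rule bounded_linear_intro[where K = 1])
  fix x :: "(('a \<times> 'b) \<times> 'c) ell2"
  have "of_real ((norm (assoc_ell2 x))\<^sup>2) = complex_of_real ((norm x)\<^sup>2)"
    unfolding cinner_self_norm[symmetric] by (rule cinner_assoc_ell2)
  then have "(norm (assoc_ell2 x))\<^sup>2 = (norm x)\<^sup>2" by (simp only: of_real_eq_iff)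
  then show "norm (assoc_ell2 x) \<le> norm x * 1" by simp
qed (simp_all add: assoc_ell2_linear ell2_scaleR_scaleC)

lemma assoc_eq_add: "assoc_eq R R' \<Longrightarrow> assoc_eq S S' \<Longrightarrow> assoc_eq (R + S) (R' + S')"
  by (simp add: assoc_eq_def bop_apply_simps assoc_ell2_linear)

lemma assoc_eq_scaleC: "assoc_eq R R' \<Longrightarrow> assoc_eq (c *\<^sub>C R) (c *\<^sub>C R')"
  by (simp add: assoc_eq_def bop_apply_scaleC_left assoc_ell2_linear)

lemma assoc_eq_zero: "assoc_eq 0 0"
  using linear_0[OF bounded_linear.linear[OF bounded_linear_assoc_ell2]]
  by (simp add: assoc_eq_def bop_apply_simps)

lemma assoc_eq_sum: "(\<And>i. i \<in> I \<Longrightarrow> assoc_eq (R i) (R' i)) \<Longrightarrow> assoc_eq (\<Sum>i\<in>I. R i) (\<Sum>i\<in>I. R' i)"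
  by (induction I rule: infinite_finite_induct) (auto simp: assoc_eq_zero assoc_eq_add)

lemma assoc_eq_mult: "assoc_eq R R' \<Longrightarrow> assoc_eq S S' \<Longrightarrow> assoc_eq (R * S) (R' * S')"
  by (simp add: assoc_eq_def bop_apply_simps)

text \<open>\<open>assoc_ell2\<close> preserves inner products and maps basis vectors to basis
  vectors, so testing against the latter carries the intertwining relation over to adjoints.\<close>

lemma assoc_eq_star:
  fixes R :: "(('i \<times> 'j) \<times> 'k) bop"
  assumes "assoc_eq R R'"
  shows "assoc_eq (star R) (star R')"
  unfolding assoc_eq_def
proof (intro allI ell2_eqI)
  fix x and p :: "'i \<times> 'j \<times> 'k"
  obtain i j k where p: "p = (i, (j, k))" by (metis prod.exhaust)
  have "ell2_apply (assoc_ell2 (bop_apply (star R) x)) p = cinner (assoc_ell2 (ket ((i, j), k))) (assoc_ell2 (bop_apply (star R) x))"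
    by (simp add: p cinner_ket_left assoc_ell2_linear)
  also have "\<dots> = cinner (assoc_ell2 (bop_apply R (ket ((i, j), k)))) (assoc_ell2 x)"
    by (simp add: cinner_assoc_ell2 star_bop_right)
  also have "\<dots> = cinner (bop_apply R' (ket p)) (assoc_ell2 x)"
    using assms by (simp add: assoc_eq_def assoc_ell2_linear p)
  also have "\<dots> = ell2_apply (bop_apply (star R') (assoc_ell2 x)) p"
    by (simp add: star_bop_right[symmetric] cinner_ket_left)
  finally show "ell2_apply (assoc_ell2 (bop_apply (star R) x)) p = ell2_apply (bop_apply (star R') (assoc_ell2 x)) p" .
qed

lemma tendsto_bop_apply: "R \<longlonglongrightarrow> S \<Longrightarrow> (\<lambda>n. bop_apply (R n) x) \<longlonglongrightarrow> bop_apply S x"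
  by (rule bounded_linear.tendsto[of "\<lambda>T. bop_apply T x"])
     (auto intro!: bounded_linear_intro[where K = "norm x"] simp: bop_apply_simps norm_bop_apply)

lemma assoc_eq_limit:
  assumes "\<And>n. assoc_eq (R n) (R' n)" "R \<longlonglongrightarrow> S" "R' \<longlonglongrightarrow> S'"
  shows "assoc_eq S S'"
  unfolding assoc_eq_def
proof
  fix x
  have "(\<lambda>n. assoc_ell2 (bop_apply (R n) x)) \<longlonglongrightarrow> assoc_ell2 (bop_apply S x)"
    by (intro bounded_linear.tendsto[OF bounded_linear_assoc_ell2] tendsto_bop_apply assms)
  moreover have "(\<lambda>n. assoc_ell2 (bop_apply (R n) x)) \<longlonglongrightarrow> bop_apply S' (assoc_ell2 x)"
    using assms(1) tendsto_bop_apply[OF assms(3)] by (simp add: assoc_eq_def)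
  ultimately show "assoc_ell2 (bop_apply S x) = bop_apply S' (assoc_ell2 x)"
    by (rule LIMSEQ_unique)
qed

lemma assoc_eq_op_tensor:
  fixes S :: "'i bop" and T :: "'j bop" and U :: "'k bop"
  shows "assoc_eq (op_tensor (op_tensor S T) U) (op_tensor S (op_tensor T U))"
  unfolding assoc_eq_def
proof
  fix x
  let ?D = "\<lambda>x. assoc_ell2 (bop_apply (op_tensor (op_tensor S T) U) x) - bop_apply (op_tensor S (op_tensor T U)) (assoc_ell2 x)"
  have "?D x = 0"
  proof (rule bounded_linear_ket_eq_0[of ?D])
    show "bounded_linear ?D"
      by (intro bounded_linear_sub bounded_linear_compose[OF bounded_linear_assoc_ell2 bounded_linear_bop_apply]
          bounded_linear_compose[OF bounded_linear_bop_apply bounded_linear_assoc_ell2])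
    fix c and p :: "('i \<times> 'j) \<times> 'k"
    obtain i j k where p: "p = ((i, j), k)" by (metis prod.exhaust)
    show "?D (c *\<^sub>C ket p) = 0"
      by (simp add: p ket_tensor bop_apply_scaleC op_tensor_apply assoc_ell2_linear)
  qed
  then show "assoc_ell2 (bop_apply (op_tensor (op_tensor S T) U) x) = bop_apply (op_tensor S (op_tensor T U)) (assoc_ell2 x)"
    by simp
qed

text \<open>Reduces coassociativity to the generators; closedness uses the continuity of
  *-homomorphisms.\<close>

lemma cstar_subalgebra_assoc_eq:
  fixes G :: "'a::unital_cstar_algebra \<Rightarrow> _"
  assumes G: "star_hom G" "star_hom G'"
  shows "cstar_subalgebra {a. assoc_eq (G a) (G' a)}"
proof -
  have "closed {a. assoc_eq (G a) (G' a)}"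
    unfolding closed_sequential_limits
  proof (intro allI impI)
    fix X a assume X: "(\<forall>n. X n \<in> {a. assoc_eq (G a) (G' a)}) \<and> X \<longlonglongrightarrow> a"
    have "assoc_eq (G a) (G' a)"
      by (rule assoc_eq_limit[of "\<lambda>n. G (X n)" "\<lambda>n. G' (X n)"])
         (use X in \<open>auto intro: bounded_linear.tendsto[OF star_hom_bounded_linear] G\<close>)
    then show "a \<in> {a. assoc_eq (G a) (G' a)}" by simp
  qed
  then show ?thesis
    unfolding cstar_subalgebra_def csubspace_def
    by (auto simp: star_homD[OF G(1)] star_homD[OF G(2)] star_hom_linear(1)[OF G(1)] star_hom_linear(1)[OF G(2)]
        assoc_eq_add assoc_eq_scaleC assoc_eq_mult assoc_eq_star assoc_eq_zero)
qed

section \<open>Density\<close>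

text \<open>Here \<open>\<alpha> a\<close> and \<open>\<beta> b\<close> stand for \<open>a \<otimes> 1\<close> and \<open>1 \<otimes> b\<close>, or for \<open>1 \<otimes> a\<close> and \<open>b \<otimes> 1\<close>.\<close>

lemma legs_in_closure_cspan:
  fixes \<alpha> \<beta> \<Phi> :: "'a::unital_cstar_algebra \<Rightarrow> 'c::unital_cstar_algebra"
    and u v w :: "nat \<Rightarrow> nat \<Rightarrow> 'a" and n :: nat
  assumes hom: "star_hom \<alpha>" "star_hom \<beta>" "star_hom \<Phi>"
    and comm: "\<And>a b. \<alpha> a * \<beta> b = \<beta> b * \<alpha> a" and unit: "\<And>a. \<alpha> a * \<beta> 1 = \<alpha> a"
    and gen: "cstar_subalgebra hull {u p q | p q. p \<in> {1..n} \<and> q \<in> {1..n}} = UNIV"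
    and \<Phi>: "\<And>p q. p \<in> {1..n} \<Longrightarrow> q \<in> {1..n} \<Longrightarrow> \<Phi> (u p q) = (\<Sum>k=1..n. \<alpha> (u p k) * \<beta> (u k q))"
    and v: "\<And>j q. j \<in> {1..n} \<Longrightarrow> q \<in> {1..n} \<Longrightarrow> (\<Sum>k=1..n. u j k * v k q) = (if j = q then 1 else 0)"
    and w: "\<And>j q. j \<in> {1..n} \<Longrightarrow> q \<in> {1..n} \<Longrightarrow> (\<Sum>k=1..n. star (u j k) * w k q) = (if j = q then 1 else 0)"
  shows "\<alpha> a * \<beta> b \<in> closure (cspan {\<Phi> a * \<beta> b | a b. True})"
proof -
  define W where "W = {\<Phi> a * \<beta> b | a b. True}"
  define K where "K = closure (cspan W)"
  have WK: "\<Phi> a * \<beta> b \<in> K" for a b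
    unfolding K_def by (rule subsetD[OF closure_subset]) (auto intro: hull_inc simp: W_def)
  have K: "csubspace K" "closed K"
    unfolding K_def by (auto intro: csubspace_closure csubspace_cspan)
  have Wl: "\<Phi> c * x \<in> K" if "x \<in> K" for c x
  proof (rule closure_cspan_image[of "\<lambda>x. \<Phi> c * x", OF _ _ K _ that[unfolded K_def]])
    fix x assume "x \<in> W"
    then obtain a b where "x = \<Phi> a * \<beta> b" by (auto simp: W_def)
    then show "\<Phi> c * x \<in> K" using WK[of "c * a" b] by (simp add: star_homD[OF hom(3)] mult.assoc)
  qed (auto simp: mult_scaleC_right bounded_linear_mult_right)
  have Wr: "x * \<beta> d \<in> K" if "x \<in> K" for d x
  proof (rule closure_cspan_image[of "\<lambda>x. x * \<beta> d", OF _ _ K _ that[unfolded K_def]])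
    fix x assume "x \<in> W"
    then obtain a b where "x = \<Phi> a * \<beta> b" by (auto simp: W_def)
    then show "x * \<beta> d \<in> K" using WK[of a "b * d"] by (simp add: star_homD[OF hom(2)] mult.assoc)
  qed (auto simp: mult_scaleC_left bounded_linear_mult_left)
  \<comment> \<open>Commuting the legs gives \<open>\<Phi> c * \<beta> d * \<alpha> b = \<Phi> c *
    \<alpha> b * \<beta> d\<close>, which lies in K by the two preceding facts. This yields closure
    of T under products.\<close>
  have W\<alpha>: "x * \<alpha> b \<in> K" if "x \<in> K" "\<alpha> b \<in> K" for x b
  proof (rule closure_cspan_image[of "\<lambda>x. x * \<alpha> b", OF _ _ K _ that(1)[unfolded K_def]])
    fix x assume "x \<in> W"
    then obtain c d where "x = \<Phi> c * \<beta> d" by (auto simp: W_def)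
    then have "x * \<alpha> b = \<Phi> c * \<alpha> b * \<beta> d" by (simp add: mult.assoc comm)
    then show "x * \<alpha> b \<in> K" using Wl Wr that(2) by simp
  qed (auto simp: mult_scaleC_left bounded_linear_mult_left)
  \<comment> \<open>K is not visibly closed under adjoints, so the condition on
    \<open>star a\<close> is built into T.\<close>
  define T where "T = {a. \<alpha> a \<in> K \<and> \<alpha> (star a) \<in> K}"
  have "T = \<alpha> -` K \<inter> (\<lambda>a. \<alpha> (star a)) -` K" by (auto simp: T_def)
  moreover have "bounded_linear \<alpha>" "bounded_linear (\<lambda>a. \<alpha> (star a))"
    using star_hom_bounded_linear[OF hom(1)] bounded_linear_compose[OF _ bounded_linear_star] by blast+
  ultimately have "closed T"
    by (simp add: closed_Int closed_vimage K(2) linear_continuous_on)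
  then have T: "cstar_subalgebra T"
    unfolding cstar_subalgebra_def csubspace_def using csubspaceD(1-3)[OF K(1)] W\<alpha>
    by (auto simp: T_def star_homD(1-3)[OF hom(1)] star_hom_linear(1)[OF hom(1)] star_add star_scaleC star_mult star_star)
  \<comment> \<open>Kept general in x and y, because it is applied to u with inverse v and to the
    entrywise adjoint of u with inverse w.\<close>
  have \<alpha>K: "\<alpha> a \<in> K"
    if a: "a \<in> A" and A: "A = {x p q | p q. p \<in> {1..n} \<and> q \<in> {1..n}}"
      and \<Phi>x: "\<And>p q. p \<in> {1..n} \<Longrightarrow> q \<in> {1..n} \<Longrightarrow> \<Phi> (x p q) = (\<Sum>k=1..n. \<alpha> (x p k) * \<beta> (x k q))"
      and y: "\<And>j q. j \<in> {1..n} \<Longrightarrow> q \<in> {1..n} \<Longrightarrow> (\<Sum>k=1..n. x j k * y k q) = (if j = q then 1 else 0)"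
    for A a and x y :: "nat \<Rightarrow> nat \<Rightarrow> 'a"
  proof -
    obtain p q where pq: "a = x p q" "p \<in> {1..n}" "q \<in> {1..n}" using a A by auto
    \<comment> \<open>After the sums are exchanged, the inverse relation in the second leg leaves
      only the term j = q.\<close>
    have "(\<Sum>k=1..n. \<Phi> (x p k) * \<beta> (y k q)) = (\<Sum>k=1..n. \<Sum>j=1..n. \<alpha> (x p j) * \<beta> (x j k * y k q))"
      by (rule sum.cong[OF refl])
         (simp add: \<Phi>x[OF pq(2)] sum_distrib_right mult.assoc star_homD[OF hom(2)])
    also have "\<dots> = (\<Sum>j=1..n. \<alpha> (x p j) * \<beta> (\<Sum>k=1..n. x j k * y k q))"
      by (subst sum.swap) (simp add: star_hom_linear(5)[OF hom(2)] sum_distrib_left)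
    also have "\<dots> = (\<Sum>j=1..n. if j = q then \<alpha> (x p j) else 0)"
      by (rule sum.cong[OF refl]) (simp add: y[OF _ pq(3)] unit star_hom_linear(1)[OF hom(2)] del: atLeastAtMost_iff One_nat_def)
    also have "\<dots> = \<alpha> a" using pq by simp
    finally show ?thesis using csubspaceD(7)[OF K(1), of "{1..n}" "\<lambda>k. \<Phi> (x p k) * \<beta> (y k q)"] WK by simp
  qed
  have "{u p q | p q. p \<in> {1..n} \<and> q \<in> {1..n}} \<subseteq> T"
  proof clarify
    fix p q assume pq: "p \<in> {1..n}" "q \<in> {1..n}"
    have "\<alpha> (u p q) \<in> K"
      by (rule \<alpha>K[OF _ refl \<Phi> v]) (use pq in auto)
    moreover have "\<alpha> (star (u p q)) \<in> K"
    proof (rule \<alpha>K[where x = "\<lambda>p q. star (u p q)", OF _ refl _ w])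
      fix p q assume pq: "p \<in> {1..n}" "q \<in> {1..n}"
      have "\<Phi> (star (u p q)) = star (\<Phi> (u p q))" by (rule star_homD(4)[OF hom(3)])
      also have "\<dots> = (\<Sum>k=1..n. \<beta> (star (u k q)) * \<alpha> (star (u p k)))"
        unfolding \<Phi>[OF pq] star_sum star_mult star_homD(4)[OF hom(1)] star_homD(4)[OF hom(2)] ..
      finally show "\<Phi> (star (u p q)) = (\<Sum>k=1..n. \<alpha> (star (u p k)) * \<beta> (star (u k q)))"
        by (simp only: comm)
    qed (use pq in auto)
    ultimately show "u p q \<in> T" by (simp add: T_def)
  qed
  then have "UNIV \<subseteq> T" unfolding gen[symmetric] by (rule hull_minimal) (rule T)
  then have "\<alpha> a \<in> K" by (auto simp: T_def)
  then show ?thesis using Wr by (simp add: K_def W_def)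
qed

lemma matrix_invertible_right_inverse:
  assumes "matrix_invertible n u"
  shows "\<exists>v. \<forall>p\<in>{1..n}. \<forall>q\<in>{1..n}. (\<Sum>k=1..n. u p k * v k q) = (if p = q then 1 else 0)"
  using assms unfolding matrix_invertible_def by blast

text \<open>Taking adjoints reverses products, so a left inverse of the transpose becomes a right
  inverse of the entrywise adjoint.\<close>

lemma matrix_invertible_star_right_inverse:
  assumes "matrix_invertible n (\<lambda>p q. u q p)"
  shows "\<exists>w. \<forall>p\<in>{1..n}. \<forall>q\<in>{1..n}. (\<Sum>k=1..n. star (u p k) * w k q) = (if p = q then 1 else 0)"
proof -
  obtain v where v: "\<And>p q. p \<in> {1..n} \<Longrightarrow> q \<in> {1..n} \<Longrightarrow> (\<Sum>k=1..n. v p k * u q k) = (if p = q then 1 else 0)"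
    using assms unfolding matrix_invertible_def by blast
  have "(\<Sum>k=1..n. star (u p k) * star (v q k)) = (if p = q then 1 else 0)" if "p \<in> {1..n}" "q \<in> {1..n}" for p q
    using v[OF that(2,1)] by (auto simp: star_mult[symmetric] star_sum[symmetric])
  then show ?thesis by (intro exI[of _ "\<lambda>k q. star (v q k)"]) blast
qed

theorem proposition3p8:
  fixes \<pi> :: "'a::unital_cstar_algebra \<Rightarrow> 'i bop"
    and \<Phi> :: "'a \<Rightarrow> ('i \<times> 'i) bop"
    and u :: "nat \<Rightarrow> nat \<Rightarrow> 'a"
    and n :: nat
  assumes "faithful_rep \<pi>"
    and "star_hom \<Phi>" and "range \<Phi> \<subseteq> min_tensor \<pi> \<pi>"
    and "n \<ge> 1"
    and "cstar_subalgebra hull {u p q | p q. p \<in> {1..n} \<and> q \<in> {1..n}} = UNIV"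
    and "\<And>p q. p \<in> {1..n} \<Longrightarrow> q \<in> {1..n} \<Longrightarrow>
           \<Phi> (u p q) = (\<Sum>k=1..n. op_tensor (\<pi> (u p k)) (\<pi> (u k q)))"
    and "matrix_invertible n u"
    and "matrix_invertible n (\<lambda>p q. u q p)"
  shows "compact_quantum_group \<pi> \<Phi>"
proof -
  note \<Phi> = \<open>star_hom \<Phi>\<close> and \<pi>f = \<open>faithful_rep \<pi>\<close> and gen = assms(5) and \<Phi>u = assms(6)
  have \<pi>: "star_hom \<pi>" using \<pi>f by (simp add: faithful_rep_def)
  \<comment> \<open>\<pi> need not be unital: \<open>\<pi> 1\<close> is only a projection that acts
    as a unit on the range of \<pi>.\<close>
  have \<pi>1: "\<pi> a * \<pi> 1 = \<pi> a" "\<pi> 1 * \<pi> a = \<pi> a" "star (\<pi> 1) = \<pi> 1" for a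
    using star_homD(3)[OF \<pi>, of a 1] star_homD(3)[OF \<pi>, of 1 a] star_homD(4)[OF \<pi>, of 1] by auto
  let ?M = "min_tensor \<pi> \<pi>"
  note M = cstar_subalgebra_min_tensor[OF \<pi> \<pi>]
  have \<Phi>M: "\<Phi> a \<in> ?M" for a using assms(3) by auto
  define \<alpha> where "\<alpha> a = op_tensor (\<pi> a) (\<pi> 1)" for a
  define \<beta> where "\<beta> b = op_tensor (\<pi> 1) (\<pi> b)" for b
  have \<alpha>\<beta>: "star_hom \<alpha>" "star_hom \<beta>"
    by (auto simp: star_hom_on_def \<alpha>_def \<beta>_def star_homD[OF \<pi>] op_tensor_linear op_tensor_mult star_op_tensor \<pi>1)
  have mult: "\<alpha> a * \<beta> b = op_tensor (\<pi> a) (\<pi> b)" "\<beta> b * \<alpha> a = op_tensor (\<pi> a) (\<pi> b)" for a b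
    by (simp_all add: \<alpha>_def \<beta>_def op_tensor_mult \<pi>1)
  obtain v where v: "\<And>p q. p \<in> {1..n} \<Longrightarrow> q \<in> {1..n} \<Longrightarrow> (\<Sum>k=1..n. u p k * v k q) = (if p = q then 1 else 0)"
    using matrix_invertible_right_inverse[OF assms(7)] by blast
  \<comment> \<open>With the two legs exchanged, the transpose of u satisfies the same formula for
    \<Phi>. Hence the second leg requires right inverses v' of the transpose and w' of its entrywise
    adjoint.\<close>
  obtain v' where v': "\<And>p q. p \<in> {1..n} \<Longrightarrow> q \<in> {1..n} \<Longrightarrow> (\<Sum>k=1..n. u k p * v' k q) = (if p = q then 1 else 0)"
    using matrix_invertible_right_inverse[OF assms(8)] by blast
  obtain w where w: "\<And>p q. p \<in> {1..n} \<Longrightarrow> q \<in> {1..n} \<Longrightarrow> (\<Sum>k=1..n. star (u p k) * w k q) = (if p = q then 1 else 0)"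
    using matrix_invertible_star_right_inverse[OF assms(8)] by blast
  obtain w' where w': "\<And>p q. p \<in> {1..n} \<Longrightarrow> q \<in> {1..n} \<Longrightarrow> (\<Sum>k=1..n. star (u k p) * w' k q) = (if p = q then 1 else 0)"
    using matrix_invertible_star_right_inverse[of n "\<lambda>p q. u q p"] assms(7) by blast
  have gen': "cstar_subalgebra hull {u q p | p q. p \<in> {1..n} \<and> q \<in> {1..n}} = UNIV"
  proof -
    have "{u q p | p q. p \<in> {1..n} \<and> q \<in> {1..n}} = {u p q | p q. p \<in> {1..n} \<and> q \<in> {1..n}}" by blast
    with gen show ?thesis by simp
  qed
  have leg1: "op_tensor (\<pi> a) (\<pi> b) \<in> closure (cspan {\<Phi> a * \<beta> b | a b. True})" for a b
    unfolding mult(1)[symmetric]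
    by (rule legs_in_closure_cspan[OF \<alpha>\<beta> \<Phi> _ _ gen _ v w])
       (simp_all add: mult \<Phi>u \<alpha>_def \<beta>_def op_tensor_mult \<pi>1 del: atLeastAtMost_iff One_nat_def)
  have leg2: "op_tensor (\<pi> a) (\<pi> b) \<in> closure (cspan {\<Phi> a * \<alpha> b | a b. True})" for a b
    unfolding mult(2)[symmetric]
    by (rule legs_in_closure_cspan[OF \<alpha>\<beta>(2,1) \<Phi> _ _ gen' _ v' w'])
       (simp_all add: mult \<Phi>u \<alpha>_def \<beta>_def op_tensor_mult \<pi>1 del: atLeastAtMost_iff One_nat_def)
  have sub: "closure (cspan {\<Phi> a * \<gamma> b | a b. True}) \<subseteq> ?M" if "\<And>b. \<gamma> b \<in> ?M" for \<gamma> :: "'a \<Rightarrow> _"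
    by (rule closure_cspan_subset) (use M that \<Phi>M in \<open>auto intro: cstar_subalgebraD\<close>)
  have sup: "?M \<subseteq> closure (cspan S)" if "\<And>a b. op_tensor (\<pi> a) (\<pi> b) \<in> closure (cspan S)" for S
    unfolding min_tensor_def
    by (rule closure_cspan_subset) (use that in \<open>auto intro: csubspace_closure csubspace_cspan\<close>)
  have \<Phi>1: "\<Phi> 1 = op_tensor (\<pi> 1) (\<pi> 1)"
  proof -
    let ?I = "op_tensor (\<pi> 1) (\<pi> 1)"
    \<comment> \<open>\<open>\<Phi> 1\<close> is a left unit on every
      \<open>\<Phi> a * \<beta> b\<close>, hence on their closed span, which contains
      \<open>?I\<close> by \<open>leg1\<close>.\<close>
    have "\<Phi> 1 * ?I - ?I \<in> {0}"
    proof (rule closure_cspan_image[of "\<lambda>x. \<Phi> 1 * x - x", OF _ _ _ _ _ leg1])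
      show "bounded_linear (\<lambda>x. \<Phi> 1 * x - x)"
        by (intro bounded_linear_sub bounded_linear_mult_right bounded_linear_ident)
    qed (auto simp: csubspace_def mult_scaleC_right scaleC_diff_right mult.assoc[symmetric] star_homD(3)[OF \<Phi>, symmetric])
    \<comment> \<open>Conversely, \<open>?I\<close> is a right unit on simple tensors, hence on the
      whole minimal tensor product, which contains \<open>\<Phi> 1\<close>.\<close>
    moreover have "\<Phi> 1 * ?I - \<Phi> 1 \<in> {0}"
    proof (rule closure_cspan_image[of "\<lambda>x. x * ?I - x", OF _ _ _ _ _ \<Phi>M[unfolded min_tensor_def]])
      show "bounded_linear (\<lambda>x. x * ?I - x)"
        by (intro bounded_linear_sub bounded_linear_mult_left bounded_linear_ident)
    qed (auto simp: csubspace_def mult_scaleC_left scaleC_diff_right op_tensor_mult \<pi>1)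
    ultimately show ?thesis by simp
  qed
  have "assoc_eq (tensor_hom \<pi> \<pi> \<Phi> \<pi> (\<Phi> a)) (tensor_hom \<pi> \<pi> \<pi> \<Phi> (\<Phi> a))" for a
  proof -
    let ?H = "tensor_hom \<pi> \<pi> \<Phi> \<pi>" and ?H' = "tensor_hom \<pi> \<pi> \<pi> \<Phi>"
    note H = tensor_hom[OF \<pi>f \<pi>f \<Phi> \<pi>] and H' = tensor_hom[OF \<pi>f \<pi>f \<pi> \<Phi>]
    note lin = star_hom_on_linear(5)[OF H(1) cstar_subalgebraD(1)[OF M] op_tensor_in_min_tensor]
      star_hom_on_linear(5)[OF H'(1) cstar_subalgebraD(1)[OF M] op_tensor_in_min_tensor]
    have hom: "star_hom (\<lambda>a. ?H (\<Phi> a))" "star_hom (\<lambda>a. ?H' (\<Phi> a))"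
      by (simp_all add: star_hom_on_def star_homD[OF \<Phi>] star_hom_onD[OF H(1)] star_hom_onD[OF H'(1)] \<Phi>M)
    \<comment> \<open>Both sides expand to the double sum of u_pl \<otimes> u_lk \<otimes> u_kq,
      bracketed to the left and to the right respectively.\<close>
    have "assoc_eq (?H (\<Phi> (u p q))) (?H' (\<Phi> (u p q)))" if pq: "p \<in> {1..n}" "q \<in> {1..n}" for p q
    proof -
      have "?H (\<Phi> (u p q)) = (\<Sum>k=1..n. op_tensor (\<Phi> (u p k)) (\<pi> (u k q)))"
        by (simp add: \<Phi>u[OF pq] lin H(2))
      also have "\<dots> = (\<Sum>k=1..n. \<Sum>l=1..n. op_tensor (op_tensor (\<pi> (u p l)) (\<pi> (u l k))) (\<pi> (u k q)))"
        by (rule sum.cong[OF refl])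
           (simp add: \<Phi>u[OF pq(1)] tensor_pairing.sum_left[OF tensor_pairing_op_tensor])
      also have "\<dots> = (\<Sum>l=1..n. \<Sum>k=1..n. op_tensor (op_tensor (\<pi> (u p l)) (\<pi> (u l k))) (\<pi> (u k q)))"
        by (rule sum.swap)
      finally have L: "?H (\<Phi> (u p q)) = \<dots>" .
      have "?H' (\<Phi> (u p q)) = (\<Sum>l=1..n. op_tensor (\<pi> (u p l)) (\<Phi> (u l q)))"
        by (simp add: \<Phi>u[OF pq] lin H'(2))
      also have "\<dots> = (\<Sum>l=1..n. \<Sum>k=1..n. op_tensor (\<pi> (u p l)) (op_tensor (\<pi> (u l k)) (\<pi> (u k q))))"
        by (rule sum.cong[OF refl])
           (simp add: \<Phi>u[OF _ pq(2)] tensor_pairing.sum_right[OF tensor_pairing_op_tensor])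
      finally show ?thesis unfolding L by (simp add: assoc_eq_sum assoc_eq_op_tensor)
    qed
    then have "cstar_subalgebra hull {u p q | p q. p \<in> {1..n} \<and> q \<in> {1..n}} \<subseteq> {a. assoc_eq (?H (\<Phi> a)) (?H' (\<Phi> a))}"
      by (intro hull_minimal cstar_subalgebra_assoc_eq hom) blast
    with gen show ?thesis by blast
  qed
  moreover have "closure (cspan {\<Phi> a * \<beta> b | a b. True}) = ?M" "closure (cspan {\<Phi> a * \<alpha> b | a b. True}) = ?M"
    by (intro antisym sub sup leg1 leg2; simp add: \<alpha>_def \<beta>_def op_tensor_in_min_tensor)+
  ultimately show ?thesis
    unfolding compact_quantum_group_def comultiplication_def
    using \<Phi> assms(3) \<Phi>1 by (simp add: \<alpha>_def \<beta>_def)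
qed

end
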